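(* Let $(G,\mathfrak S)$ be a hierarchically hyperbolic group, let $\mathfrak S_\infty$ be the set of all unbounded domains in $\mathfrak S$, and suppose that the orthogonality graph $\mathcal O^{\mathfrak S_\infty}$ contains an induced cycle of length at least $5$. Then: (1) If $(G,\mathfrak S)$ satisfies the weak commutativity property and every unbounded domain admits an axial element of $G$ fully supported on it, then $G$ contains a surface subgroup. (2) If every unbounded domain admits an axial element of $G$ rigidly fully supported on it, then $G$ contains an undistorted surface subgroup.
   Context: A surface group is the fundamental group of a closed hyperbolic surface; a surface subgroup is a subgroup isomorphic to a surface group. **Notation.** $2^Y$ is the set of non-empty subsets of $Y$; the distance between two sets is the infimum of distances between their points; the image of a set under a map into $2^Y$ is the union of the images of its points; $\mathcal N_E(\cdot)$ is the $E$-neighborhood; $d_U(x,y)$ abbreviates $d_U(\pi_U(x),\pi_U(y))$ for $x,y\in\mathcal X$. **HHS.** A quasi-geodesic space $(\mathcal X,d_{\mathcal X})$ (any two points are joined by a quasi-geodesic of uniform quality) is a hierarchically hyperbolic space (HHS) if there are a constant $E>0$, an index set $\mathfrak S$ (whose elements are called domains) and $E$-hyperbolic geodesic spaces $(\mathcal CU,d_U)$, $U\in\mathfrak S$, such that: (1) Projections: for each $U$ there is $\pi_U:\mathcal X\to 2^{\mathcal CU}$ sending each point to a set of diameter $\le E$; $\pi_U$ is $(E,E)$-coarsely Lipschitz with $E$-quasi-convex image. $U$ is unbounded (bounded) if $\mathcal CU$ has infinite (finite) diameter. (2) Nesting: $\mathfrak S$ has a partial order $\sqsubseteq$, and either $\mathfrak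 S=\emptyset$ or $\mathfrak S$ has a unique $\sqsubseteq$-maximal element. $\mathfrak S_U=\{V: V\sqsubseteq U\}$. If $U\sqsubsetneq V$ there are a specified subset $\rho^U_V\subset\mathcal CV$ of diameter $\le E$ and a map $\rho^V_U:\mathcal CV\to 2^{\mathcal CU}$. (3) Orthogonality: a symmetric anti-reflexive relation $\bot$ on $\mathfrak S$; $U\sqsubseteq V$ and $V\bot W$ imply $U\bot W$; $U\bot V$ implies $U,V$ are not $\sqsubseteq$-comparable. For $T\in\mathfrak S$ and $U\in\mathfrak S_T$ with $\{V\in\mathfrak S_T: V\bot U\}\ne\emptyset$ there is $W\in\mathfrak S_T\setminus\{T\}$ (a container for the orthogonal complement of $U$ in $T$) such that $V\bot U$, $V\sqsubseteq T$ imply $V\sqsubseteq W$. (4) Transversality and consistency: if $U,V$ are not orthogonal and neither is nested in the other, they are transverse ($U\pitchfork V$); then there are non-empty $\rho^U_V\subseteq\mathcal CV$, $\rho^V_U\subseteq\mathcal CU$ of diameter $\le E$ with $\min\{d_V(\pi_V(x),\rho^U_V),d_U(\pi_U(x),\rho^V_U)\}\le E$ for all $x\in\mathcal X$. If $U\sqsubsetneq V$, then $\min\{d_V(\pi_V(x),\rho^U_V),\operatorname{diam}_{\mathcal CU}(\pi_U(x)\cup\rho^V_U(\pi_V(x)))\}\le E$ for all $x$. If $U\sqsubseteq V$, then $d_W(\rho^U_W,\rho^V_W)\le E$ whenever $V\sqsubsetneq W$, or $V\pitchfork W$ and $W\not\bot U$. (5) Finite complexity: any set of pairwise $\sqsubseteq$-comparable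 domains has cardinality $\le E$. (6) Large links: for $U\in\mathfrak S$, $x,y\in\mathcal X$ and $n=E\,d_U(\pi_U(x),\pi_U(y))+E$ there are $T_1,\dots,T_{\lfloor n\rfloor}\in\mathfrak S_U\setminus\{U\}$ such that each $T\in\mathfrak S_U\setminus\{U\}$ satisfies $T\sqsubseteq T_i$ for some $i$ or $d_T(\pi_T(x),\pi_T(y))\le E$. (7) Partial realization: for any finite collection of pairwise orthogonal domains $U_i$ and $p_i\in\mathcal CU_i$ there is $x\in\mathcal X$ with $d_{U_i}(\pi_{U_i}(x),p_i)\le E$ for all $i$, and $d_V(\pi_V(x),\rho^{U_i}_V)\le E$ whenever $U_i\sqsubsetneq V$ or $U_i\pitchfork V$. (8) Bounded geodesic image: if $U\sqsubsetneq V$, every geodesic $\gamma\subseteq\mathcal CV$ either meets $\mathcal N_E(\rho^U_V)$ or satisfies $\operatorname{diam}_{\mathcal CU}(\rho^V_U(\gamma))\le E$. (9) Uniqueness: for each $\kappa\ge0$ there is $\theta_u(\kappa)$ such that $d_{\mathcal X}(x,y)\ge\theta_u(\kappa)$ implies $d_U(\pi_U(x),\pi_U(y))\ge\kappa$ for some $U\in\mathfrak S$. **Automorphisms and HHGs.** An automorphism of $(\mathcal X,\mathfrak S)$ is a quasi-isometry $f:\mathcal X\to\mathcal X$, a bijection $f:\mathfrak S\to\mathfrak S$ preserving $\sqsubseteq,\bot,\pitchfork$, and isometries $f:\mathcal CU\to\mathcal C(fU)$ which coarsely commute (uniform constants) with the maps $\pi_U$, and with $\rho^U_V$ for $U\not\bot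 V$. A finitely generated group $G$ is a hierarchically hyperbolic group (HHG) $(G,\mathfrak S)$ if it has an HHS structure on $G$ with a word metric $d_G$ such that each $g\in G$ is an automorphism via left multiplication (giving an action of $G$ on $\mathfrak S$ and compatible isometries $g:\mathcal CU\to\mathcal C(gU)$), the action of $G$ on $\mathfrak S$ is cofinite, $g\pi_U(h)=\pi_{gU}(gh)$ for all $g,h\in G$, $U\in\mathfrak S$, and $g\rho^V_U=\rho^{gV}_{gU}$ whenever $U\pitchfork V$ or $V\sqsubsetneq U$. **Elements.** $g\in G$ is axial if $n\mapsto g^nx$ is a quasi-isometric embedding $\mathbb Z\to G$ for some (equivalently any) $x\in G$. An isometry $h$ of a hyperbolic space is loxodromic if $n\mapsto h^nx$ is a quasi-isometric embedding for some (any) $x$. An axial $g\in G$ is *fully supported* on an unbounded domain $U$ if (i) $g$ stabilizes $U$ and every unbounded domain $V\bot U$; (ii) $g$ acts loxodromically on $\mathcal CU$; (iii) for each unbounded $V\bot U$ there is $Q_{g,V}\ge0$ such that every $\langle g\rangle$-orbit in $\mathcal CV$ has diameter at most $Q_{g,V}$. It is *rigidly fully supported* on $U$ if moreover $g$ acts trivially on $\mathcal CV$ for every unbounded $V\bot U$. $(G,\mathfrak S)$ satisfies the *weak commutativity property* if, whenever $g,h\in G$ are axial elements fully supported on orthogonal unbounded domains, there is some integer $N>0$ such that $g^N$ and $h^N$ commute. **Graphs.** The orthogonality graph $\mathcal O^{\mathfrak S_\infty}$ has vertex set $\mathfrak S_\infty$, two distinct vertices being adjacent iff they are orthogonal. A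 finitely generated subgroup is undistorted if its inclusion is a quasi-isometric embedding. *)

theory Defs
  imports
    "HOL-Analysis.Analysis"
    "HOL-Algebra.Generated_Groups"
    "HOL-Algebra.Group_Action"
begin

section \<open>Coarse geometry of metric spaces given by a carrier and a distance\<close>

definition set_dist :: "('a \<Rightarrow> 'a \<Rightarrow> real) \<Rightarrow> 'a set \<Rightarrow> 'a set \<Rightarrow> real" where
  "set_dist d A B = Inf {d a b | a b. a \<in> A \<and> b \<in> B}"

definition nbhd :: "'a set \<Rightarrow> ('a \<Rightarrow> 'a \<Rightarrow> real) \<Rightarrow> real \<Rightarrow> 'a set \<Rightarrow> 'a set" where
  "nbhd M d r A = {x \<in> M. \<exists>a\<in>A. d x a \<le> r}"

definition diam_le :: "('a \<Rightarrow> 'a \<Rightarrow> real) \<Rightarrow> 'a set \<Rightarrow> real \<Rightarrow> bool" where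
  "diam_le d A r \<longleftrightarrow> (\<forall>a\<in>A. \<forall>b\<in>A. d a b \<le> r)"

definition qi_embedding_with ::
  "real \<Rightarrow> real \<Rightarrow> 'a set \<Rightarrow> ('a \<Rightarrow> 'a \<Rightarrow> real) \<Rightarrow> 'b set \<Rightarrow> ('b \<Rightarrow> 'b \<Rightarrow> real) \<Rightarrow> ('a \<Rightarrow> 'b) \<Rightarrow> bool" where
  "qi_embedding_with K C X d Y e f \<longleftrightarrow>
     f \<in> X \<rightarrow> Y \<and> (\<forall>x\<in>X. \<forall>y\<in>X. d x y / K - C \<le> e (f x) (f y) \<and> e (f x) (f y) \<le> K * d x y + C)"

definition qi_embedding ::
  "'a set \<Rightarrow> ('a \<Rightarrow> 'a \<Rightarrow> real) \<Rightarrow> 'b set \<Rightarrow> ('b \<Rightarrow> 'b \<Rightarrow> real) \<Rightarrow> ('a \<Rightarrow> 'b) \<Rightarrow> bool" where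
  "qi_embedding X d Y e f \<longleftrightarrow> (\<exists>K C. K \<ge> 1 \<and> C \<ge> 0 \<and> qi_embedding_with K C X d Y e f)"

definition quasi_isometry ::
  "'a set \<Rightarrow> ('a \<Rightarrow> 'a \<Rightarrow> real) \<Rightarrow> 'b set \<Rightarrow> ('b \<Rightarrow> 'b \<Rightarrow> real) \<Rightarrow> ('a \<Rightarrow> 'b) \<Rightarrow> bool" where
  "quasi_isometry X d Y e f \<longleftrightarrow>
     qi_embedding X d Y e f \<and> (\<exists>C. \<forall>y\<in>Y. \<exists>x\<in>X. e (f x) y \<le> C)"

definition isometry ::
  "'a set \<Rightarrow> ('a \<Rightarrow> 'a \<Rightarrow> real) \<Rightarrow> 'b set \<Rightarrow> ('b \<Rightarrow> 'b \<Rightarrow> real) \<Rightarrow> ('a \<Rightarrow> 'b) \<Rightarrow> bool" where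
  "isometry X d Y e f \<longleftrightarrow> f ` X = Y \<and> (\<forall>x\<in>X. \<forall>y\<in>X. e (f x) (f y) = d x y)"

abbreviation real_dist :: "real \<Rightarrow> real \<Rightarrow> real" where
  "real_dist s t \<equiv> \<bar>s - t\<bar>"

abbreviation int_dist :: "int \<Rightarrow> int \<Rightarrow> real" where
  "int_dist m n \<equiv> \<bar>real_of_int m - real_of_int n\<bar>"

definition quasi_geodesic_space :: "'a set \<Rightarrow> ('a \<Rightarrow> 'a \<Rightarrow> real) \<Rightarrow> bool" where
  "quasi_geodesic_space X d \<longleftrightarrow> Metric_space X d \<and>
     (\<exists>K C. K \<ge> 1 \<and> C \<ge> 0 \<and>
       (\<forall>x\<in>X. \<forall>y\<in>X. \<exists>\<gamma> L. 0 \<le> L \<and> qi_embedding_with K C {0..L} real_dist X d \<gamma> \<and> \<gamma> 0 = x \<and> \<gamma> L = y))"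

text \<open>Geodesic segments are taken as subsets of the space, with end points \<open>x\<close> and \<open>y\<close>.\<close>

definition geodesic_seg :: "'a set \<Rightarrow> ('a \<Rightarrow> 'a \<Rightarrow> real) \<Rightarrow> 'a \<Rightarrow> 'a \<Rightarrow> 'a set \<Rightarrow> bool" where
  "geodesic_seg M d x y A \<longleftrightarrow> A \<subseteq> M \<and>
     (\<exists>\<gamma> L. 0 \<le> L \<and> isometry {0..L} real_dist A d \<gamma> \<and> \<gamma> 0 = x \<and> \<gamma> L = y)"

definition geodesic_space :: "'a set \<Rightarrow> ('a \<Rightarrow> 'a \<Rightarrow> real) \<Rightarrow> bool" where
  "geodesic_space M d \<longleftrightarrow> Metric_space M d \<and> (\<forall>x\<in>M. \<forall>y\<in>M. \<exists>A. geodesic_seg M d x y A)"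

text \<open>Hyperbolicity in the sense of Rips: geodesic triangles are thin.\<close>

definition hyperbolic_geodesic_space :: "real \<Rightarrow> 'a set \<Rightarrow> ('a \<Rightarrow> 'a \<Rightarrow> real) \<Rightarrow> bool" where
  "hyperbolic_geodesic_space \<delta> M d \<longleftrightarrow> geodesic_space M d \<and>
     (\<forall>x\<in>M. \<forall>y\<in>M. \<forall>z\<in>M. \<forall>A B C.
        geodesic_seg M d x y A \<and> geodesic_seg M d y z B \<and> geodesic_seg M d z x C
        \<longrightarrow> A \<subseteq> nbhd M d \<delta> (B \<union> C))"

definition quasi_convex :: "real \<Rightarrow> 'a set \<Rightarrow> ('a \<Rightarrow> 'a \<Rightarrow> real) \<Rightarrow> 'a set \<Rightarrow> bool" where
  "quasi_convex r M d Y \<longleftrightarrow> Y \<subseteq> M \<and>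
     (\<forall>x\<in>Y. \<forall>y\<in>Y. \<forall>A. geodesic_seg M d x y A \<longrightarrow> A \<subseteq> nbhd M d r Y)"


section \<open>Word metrics\<close>

definition finite_generating_set :: "('g, 'b) monoid_scheme \<Rightarrow> 'g set \<Rightarrow> bool" where
  "finite_generating_set G A \<longleftrightarrow> finite A \<and> A \<subseteq> carrier G \<and> generate G A = carrier G"

definition finitely_generated :: "('g, 'b) monoid_scheme \<Rightarrow> bool" where
  "finitely_generated G \<longleftrightarrow> (\<exists>A. finite_generating_set G A)"

definition word_length :: "('g, 'b) monoid_scheme \<Rightarrow> 'g set \<Rightarrow> 'g \<Rightarrow> nat" where
  "word_length G A g = (LEAST n. \<exists>ws. length ws = n \<and> set ws \<subseteq> A \<union> m_inv G ` A \<and>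
     foldr (\<otimes>\<^bsub>G\<^esub>) ws \<one>\<^bsub>G\<^esub> = g)"

text \<open>The value 0 outside the carrier is needed because the locale \<^locale>\<open>Metric_space\<close>
  requires symmetry on the whole type.\<close>

definition word_dist :: "('g, 'b) monoid_scheme \<Rightarrow> 'g set \<Rightarrow> 'g \<Rightarrow> 'g \<Rightarrow> real" where
  "word_dist G A x y =
     (if x \<in> carrier G \<and> y \<in> carrier G then real (word_length G A (inv\<^bsub>G\<^esub> x \<otimes>\<^bsub>G\<^esub> y)) else 0)"

context group begin

lemma foldr_mult_closed: "set ws \<subseteq> carrier G \<Longrightarrow> foldr (\<otimes>) ws \<one> \<in> carrier G"
  by (induction ws) auto

lemma foldr_mult_append:
  "set us \<subseteq> carrier G \<Longrightarrow> set vs \<subseteq> carrier G \<Longrightarrow>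
   foldr (\<otimes>) (us @ vs) \<one> = foldr (\<otimes>) us \<one> \<otimes> foldr (\<otimes>) vs \<one>"
proof (induction us)
  case Nil
  then show ?case using foldr_mult_closed[of vs] by simp
next
  case (Cons u us)
  then show ?case using foldr_mult_closed[of us] foldr_mult_closed[of vs]
    by (simp add: m_assoc)
qed

lemma foldr_mult_inv:
  "set ws \<subseteq> carrier G \<Longrightarrow> foldr (\<otimes>) (rev (map (m_inv G) ws)) \<one> = inv (foldr (\<otimes>) ws \<one>)"
proof (induction ws)
  case (Cons w ws)
  have "set (rev (map (m_inv G) ws)) \<subseteq> carrier G" using Cons.prems by auto
  then have "foldr (\<otimes>) (rev (map (m_inv G) ws) @ [inv w]) \<one>
      = foldr (\<otimes>) (rev (map (m_inv G) ws)) \<one> \<otimes> foldr (\<otimes>) [inv w] \<one>"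
    using Cons.prems by (intro foldr_mult_append) auto
  with Cons show ?case by (simp add: inv_mult_group foldr_mult_closed del: foldr_append)
qed simp

lemma word_exists:
  assumes A: "A \<subseteq> carrier G" and "g \<in> generate G A"
  shows "\<exists>ws. set ws \<subseteq> A \<union> m_inv G ` A \<and> foldr (\<otimes>) ws \<one> = g"
  using assms(2)
proof (induction rule: generate.induct)
  case one
  show ?case by (intro exI[of _ "[]"]) simp
next
  case (incl h)
  with A show ?case by (intro exI[of _ "[h]"]) auto
next
  case (inv h)
  with A show ?case by (intro exI[of _ "[inv h]"]) auto
next
  case (eng h1 h2)
  then obtain us vs where
    us: "set us \<subseteq> A \<union> m_inv G ` A" "foldr (\<otimes>) us \<one> = h1" and
    vs: "set vs \<subseteq> A \<union> m_inv G ` A" "foldr (\<otimes>) vs \<one> = h2"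
    by blast
  have "A \<union> m_inv G ` A \<subseteq> carrier G" using A by auto
  then have "foldr (\<otimes>) (us @ vs) \<one> = h1 \<otimes> h2"
    using foldr_mult_append[of us vs] us vs by (meson order_trans)
  moreover have "set (us @ vs) \<subseteq> A \<union> m_inv G ` A" using us vs by simp
  ultimately show ?case by blast
qed

lemma word_length_le:
  "\<lbrakk>set ws \<subseteq> A \<union> m_inv G ` A; foldr (\<otimes>) ws \<one> = g\<rbrakk> \<Longrightarrow> word_length G A g \<le> length ws"
  unfolding word_length_def by (rule Least_le) blast

lemma word_length_attained:
  assumes "finite_generating_set G A" and "g \<in> carrier G"
  obtains ws where "set ws \<subseteq> A \<union> m_inv G ` A" "foldr (\<otimes>) ws \<one> = g" "length ws = word_length G A g"
proof -
  have "\<exists>n ws. length ws = n \<and> set ws \<subseteq> A \<union> m_inv G ` A \<and> foldr (\<otimes>) ws \<one> = g"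
    using word_exists[of A g] assms unfolding finite_generating_set_def by blast
  then have "\<exists>ws. length ws = word_length G A g \<and> set ws \<subseteq> A \<union> m_inv G ` A \<and> foldr (\<otimes>) ws \<one> = g"
    unfolding word_length_def by (rule LeastI_ex)
  then show ?thesis using that by blast
qed

lemma word_length_inv_le:
  assumes A: "finite_generating_set G A" and g: "g \<in> carrier G"
  shows "word_length G A (inv g) \<le> word_length G A g"
proof -
  obtain ws where ws: "set ws \<subseteq> A \<union> m_inv G ` A" "foldr (\<otimes>) ws \<one> = g" "length ws = word_length G A g"
    using word_length_attained[OF A g] .
  have A': "A \<subseteq> carrier G" using A by (simp add: finite_generating_set_def)
  have "set ws \<subseteq> carrier G" using ws(1) A' by auto
  then have "foldr (\<otimes>) (rev (map (m_inv G) ws)) \<one> = inv g" using foldr_mult_inv ws(2) by simp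
  moreover have "set (rev (map (m_inv G) ws)) \<subseteq> A \<union> m_inv G ` A" using ws(1) A' by force
  ultimately show ?thesis using word_length_le[of "rev (map (m_inv G) ws)" A] ws(3) by simp
qed

lemma Metric_space_word_dist:
  assumes A: "finite_generating_set G A"
  shows "Metric_space (carrier G) (word_dist G A)"
proof
  have A': "A \<union> m_inv G ` A \<subseteq> carrier G" using A by (auto simp: finite_generating_set_def)
  fix x y
  show "0 \<le> word_dist G A x y" by (simp add: word_dist_def)
  have "word_length G A (inv x \<otimes> y) \<le> word_length G A (inv y \<otimes> x)"
    if "x \<in> carrier G" "y \<in> carrier G" for x y
    using word_length_inv_le[OF A, of "inv y \<otimes> x"] that by (simp add: inv_mult_group)
  then show "word_dist G A x y = word_dist G A y x"
    by (auto simp: word_dist_def intro: le_antisym)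
  assume x: "x \<in> carrier G" and y: "y \<in> carrier G"
  show "word_dist G A x y = 0 \<longleftrightarrow> x = y"
  proof
    assume "word_dist G A x y = 0"
    moreover obtain ws where "foldr (\<otimes>) ws \<one> = inv x \<otimes> y" "length ws = word_length G A (inv x \<otimes> y)"
      using word_length_attained[OF A, of "inv x \<otimes> y"] x y by auto
    ultimately have "inv x \<otimes> y = \<one>" using x y by (simp add: word_dist_def)
    then show "x = y" using x y by (metis inv_closed inv_equality inv_inv)
  next
    assume "x = y"
    then show "word_dist G A x y = 0"
      using word_length_le[of "[]" A \<one>] x by (simp add: word_dist_def)
  qed
  fix z assume z: "z \<in> carrier G"
  obtain us where us: "set us \<subseteq> A \<union> m_inv G ` A" "foldr (\<otimes>) us \<one> = inv x \<otimes> y"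
      "length us = word_length G A (inv x \<otimes> y)"
    using word_length_attained[OF A, of "inv x \<otimes> y"] x y by auto
  obtain vs where vs: "set vs \<subseteq> A \<union> m_inv G ` A" "foldr (\<otimes>) vs \<one> = inv y \<otimes> z"
      "length vs = word_length G A (inv y \<otimes> z)"
    using word_length_attained[OF A, of "inv y \<otimes> z"] z y by auto
  have "foldr (\<otimes>) (us @ vs) \<one> = (inv x \<otimes> y) \<otimes> (inv y \<otimes> z)"
    using foldr_mult_append[of us vs] us vs A' by (metis order_trans)
  also have "\<dots> = inv x \<otimes> z"
    using x y z by (metis inv_closed m_assoc m_closed r_inv l_one)
  finally have "word_length G A (inv x \<otimes> z) \<le> length (us @ vs)"
    using us(1) vs(1) by (intro word_length_le) auto
  then show "word_dist G A x z \<le> word_dist G A x y + word_dist G A y z"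
    using us(3) vs(3) x y z by (simp add: word_dist_def)
qed

end

definition undistorted :: "('g, 'b) monoid_scheme \<Rightarrow> 'g set \<Rightarrow> bool" where
  "undistorted G H \<longleftrightarrow>
     finitely_generated G \<and> finitely_generated (G\<lparr>carrier := H\<rparr>) \<and>
     (\<forall>A B. finite_generating_set G A \<and> finite_generating_set (G\<lparr>carrier := H\<rparr>) B \<longrightarrow>
        qi_embedding H (word_dist (G\<lparr>carrier := H\<rparr>) B) (carrier G) (word_dist G A) (\<lambda>h. h))"


section \<open>Surface groups\<close>

definition based_loops :: "'a topology \<Rightarrow> 'a \<Rightarrow> (real \<Rightarrow> 'a) set" where
  "based_loops X b = {p. pathin X p \<and> p 0 = b \<and> p 1 = b}"

definition loop_homotopy :: "'a topology \<Rightarrow> 'a \<Rightarrow> ((real \<Rightarrow> 'a) \<times> (real \<Rightarrow> 'a)) set" where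
  "loop_homotopy X b = {(p, q). p \<in> based_loops X b \<and> q \<in> based_loops X b \<and>
     homotopic_with (\<lambda>h. h 0 = b \<and> h 1 = b) (top_of_set {0..1}) X p q}"

text \<open>The library's concatenation \<^const>\<open>joinpaths\<close> is only available for type-class topologies.\<close>

definition loop_concat :: "(real \<Rightarrow> 'a) \<Rightarrow> (real \<Rightarrow> 'a) \<Rightarrow> real \<Rightarrow> 'a" where
  "loop_concat p q t = (if t \<le> 1/2 then p (2 * t) else q (2 * t - 1))"

definition fundamental_group :: "'a topology \<Rightarrow> 'a \<Rightarrow> (real \<Rightarrow> 'a) set monoid" where
  "fundamental_group X b =
     \<lparr>carrier = based_loops X b // loop_homotopy X b,
      mult = (\<lambda>P Q. \<Union>p\<in>P. \<Union>q\<in>Q. loop_homotopy X b `` {loop_concat p q}),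
      one = loop_homotopy X b `` {\<lambda>_. b}\<rparr>"

text \<open>The upper half plane model of the hyperbolic plane.\<close>

definition upper_half_plane :: "complex set" where
  "upper_half_plane = {z. Im z > 0}"

definition hyp_dist :: "complex \<Rightarrow> complex \<Rightarrow> real" where
  "hyp_dist z w = arcosh (1 + (cmod (z - w))\<^sup>2 / (2 * Im z * Im w))"

text \<open>A closed hyperbolic surface is a non-empty compact connected metric space that is locally
  isometric to the hyperbolic plane.  As full balls are compared with open balls of the plane,
  there is no boundary.\<close>

definition closed_hyperbolic_surface :: "'a set \<Rightarrow> ('a \<Rightarrow> 'a \<Rightarrow> real) \<Rightarrow> bool" where
  "closed_hyperbolic_surface M d \<longleftrightarrow> M \<noteq> {} \<and> Metric_space M d \<and>
     compact_space (Metric_space.mtopology M d) \<and>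
     connected_space (Metric_space.mtopology M d) \<and>
     (\<forall>x\<in>M. \<exists>r>0. \<exists>z\<in>upper_half_plane. \<exists>\<phi>.
        isometry (Metric_space.mball M d x r) d {w \<in> upper_half_plane. hyp_dist z w < r} hyp_dist \<phi>)"

text \<open>Closed surfaces have the cardinality of the continuum, so fixing \<^typ>\<open>complex\<close> as the type
  of points (with an arbitrary carrier and an arbitrary distance) loses no generality.\<close>

definition surface_group :: "('g, 'b) monoid_scheme \<Rightarrow> bool" where
  "surface_group H \<longleftrightarrow> group H \<and>
     (\<exists>(M :: complex set) d. closed_hyperbolic_surface M d \<and>
        (\<exists>b\<in>M. H \<cong> fundamental_group (Metric_space.mtopology M d) b))"

definition surface_subgroup :: "'g set \<Rightarrow> ('g, 'b) monoid_scheme \<Rightarrow> bool" where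
  "surface_subgroup H G \<longleftrightarrow> subgroup H G \<and> surface_group (G\<lparr>carrier := H\<rparr>)"


section \<open>Hierarchically hyperbolic spaces\<close>

text \<open>All the spaces indexed by the domains have points in one type \<^typ>\<open>'p\<close>, with a carrier and a
  distance for each domain.  When \<open>U\<close> is transverse to, or properly nested in, \<open>V\<close>, the
  set \<open>rho U V\<close> is the subset of the space of \<open>V\<close> written $\rho^U_V$; when \<open>U\<close> is properly
  nested in \<open>V\<close>, \<open>rho_map V U\<close> is the map $\rho^V_U$ from the space of \<open>V\<close> to the subsets
  of the space of \<open>U\<close>.  For other arguments these fields carry no information.\<close>

record ('x, 'u, 'p) hhs_structure =
  domains :: "'u set"
  cspace :: "'u \<Rightarrow> 'p set"
  cdist :: "'u \<Rightarrow> 'p \<Rightarrow> 'p \<Rightarrow> real"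
  cproj :: "'u \<Rightarrow> 'x \<Rightarrow> 'p set"
  nested :: "'u \<Rightarrow> 'u \<Rightarrow> bool"
  orth :: "'u \<Rightarrow> 'u \<Rightarrow> bool"
  rho :: "'u \<Rightarrow> 'u \<Rightarrow> 'p set"
  rho_map :: "'u \<Rightarrow> 'u \<Rightarrow> 'p \<Rightarrow> 'p set"

definition pnested :: "('x, 'u, 'p, 'z) hhs_structure_scheme \<Rightarrow> 'u \<Rightarrow> 'u \<Rightarrow> bool" where
  "pnested S U V \<longleftrightarrow> nested S U V \<and> U \<noteq> V"

definition transverse :: "('x, 'u, 'p, 'z) hhs_structure_scheme \<Rightarrow> 'u \<Rightarrow> 'u \<Rightarrow> bool" where
  "transverse S U V \<longleftrightarrow> \<not> orth S U V \<and> \<not> nested S U V \<and> \<not> nested S V U"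

definition below :: "('x, 'u, 'p, 'z) hhs_structure_scheme \<Rightarrow> 'u \<Rightarrow> 'u set" where
  "below S U = {V \<in> domains S. nested S V U}"

abbreviation dom_dist :: "('x, 'u, 'p, 'z) hhs_structure_scheme \<Rightarrow> 'u \<Rightarrow> 'x \<Rightarrow> 'x \<Rightarrow> real" where
  "dom_dist S U x y \<equiv> set_dist (cdist S U) (cproj S U x) (cproj S U y)"

definition unbounded_domains :: "('x, 'u, 'p, 'z) hhs_structure_scheme \<Rightarrow> 'u set" where
  "unbounded_domains S = {U \<in> domains S. \<not> (\<exists>r. diam_le (cdist S U) (cspace S U) r)}"

text \<open>A bound on a minimum of two quantities is written as a disjunction, as the diameters involved
  may be infinite.  In \<open>large_links\<close> the list of domains is treated as a set with at most
  the prescribed number of elements, so that it may be empty when \<open>U\<close> is nesting-minimal.\<close>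

locale hhs = Metric_space X d
  for X :: "'x set" and d :: "'x \<Rightarrow> 'x \<Rightarrow> real" +
  fixes S :: "('x, 'u, 'p, 'z) hhs_structure_scheme" and E :: real
  assumes quasi_geodesic: "quasi_geodesic_space X d"
    and E_pos: "E > 0"
    and hyperbolic: "U \<in> domains S \<Longrightarrow> hyperbolic_geodesic_space E (cspace S U) (cdist S U)"
    and proj_subset: "\<lbrakk>U \<in> domains S; x \<in> X\<rbrakk> \<Longrightarrow>
          cproj S U x \<subseteq> cspace S U \<and> cproj S U x \<noteq> {} \<and> diam_le (cdist S U) (cproj S U x) E"
    and proj_lipschitz: "\<lbrakk>U \<in> domains S; x \<in> X; y \<in> X\<rbrakk> \<Longrightarrow> dom_dist S U x y \<le> E * d x y + E"
    and proj_quasi_convex: "U \<in> domains S \<Longrightarrow>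
          quasi_convex E (cspace S U) (cdist S U) (\<Union>x\<in>X. cproj S U x)"
    and nested_refl: "U \<in> domains S \<Longrightarrow> nested S U U"
    and nested_antisym: "\<lbrakk>U \<in> domains S; V \<in> domains S; nested S U V; nested S V U\<rbrakk> \<Longrightarrow> U = V"
    and nested_trans: "\<lbrakk>U \<in> domains S; V \<in> domains S; W \<in> domains S; nested S U V; nested S V W\<rbrakk>
          \<Longrightarrow> nested S U W"
    and maximal_domain: "domains S = {} \<or>
          (\<exists>!U. U \<in> domains S \<and> (\<forall>V\<in>domains S. nested S U V \<longrightarrow> V = U))"
    and rho_nested: "\<lbrakk>U \<in> domains S; V \<in> domains S; pnested S U V\<rbrakk> \<Longrightarrow>
          rho S U V \<subseteq> cspace S V \<and> rho S U V \<noteq> {} \<and> diam_le (cdist S V) (rho S U V) E"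
    and rho_map_subset: "\<lbrakk>U \<in> domains S; V \<in> domains S; pnested S U V; p \<in> cspace S V\<rbrakk> \<Longrightarrow>
          rho_map S V U p \<subseteq> cspace S U \<and> rho_map S V U p \<noteq> {}"
    and orth_sym: "\<lbrakk>U \<in> domains S; V \<in> domains S; orth S U V\<rbrakk> \<Longrightarrow> orth S V U"
    and orth_irrefl: "U \<in> domains S \<Longrightarrow> \<not> orth S U U"
    and orth_nested: "\<lbrakk>U \<in> domains S; V \<in> domains S; W \<in> domains S; nested S U V; orth S V W\<rbrakk>
          \<Longrightarrow> orth S U W"
    and orth_incomparable: "\<lbrakk>U \<in> domains S; V \<in> domains S; orth S U V\<rbrakk>
          \<Longrightarrow> \<not> nested S U V \<and> \<not> nested S V U"
    and containers: "\<lbrakk>T \<in> domains S; U \<in> below S T; {V \<in> below S T. orth S V U} \<noteq> {}\<rbrakk> \<Longrightarrow>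
          \<exists>W \<in> below S T - {T}. \<forall>V \<in> below S T. orth S V U \<longrightarrow> nested S V W"
    and rho_transverse: "\<lbrakk>U \<in> domains S; V \<in> domains S; transverse S U V\<rbrakk> \<Longrightarrow>
          rho S U V \<subseteq> cspace S V \<and> rho S U V \<noteq> {} \<and> diam_le (cdist S V) (rho S U V) E"
    and consistency_transverse:
        "\<lbrakk>U \<in> domains S; V \<in> domains S; transverse S U V; x \<in> X\<rbrakk> \<Longrightarrow>
          set_dist (cdist S V) (cproj S V x) (rho S U V) \<le> E \<or>
          set_dist (cdist S U) (cproj S U x) (rho S V U) \<le> E"
    and consistency_nested:
        "\<lbrakk>U \<in> domains S; V \<in> domains S; pnested S U V; x \<in> X\<rbrakk> \<Longrightarrow>
          set_dist (cdist S V) (cproj S V x) (rho S U V) \<le> E \<or>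
          diam_le (cdist S U) (cproj S U x \<union> (\<Union>p\<in>cproj S V x. rho_map S V U p)) E"
    and consistency_rho:
        "\<lbrakk>U \<in> domains S; V \<in> domains S; W \<in> domains S; nested S U V;
          pnested S V W \<or> (transverse S V W \<and> \<not> orth S W U)\<rbrakk> \<Longrightarrow>
          set_dist (cdist S W) (rho S U W) (rho S V W) \<le> E"
    and finite_complexity:
        "\<lbrakk>\<C> \<subseteq> domains S; \<And>U V. \<lbrakk>U \<in> \<C>; V \<in> \<C>\<rbrakk> \<Longrightarrow> nested S U V \<or> nested S V U\<rbrakk> \<Longrightarrow>
          finite \<C> \<and> real (card \<C>) \<le> E"
    and large_links:
        "\<lbrakk>U \<in> domains S; x \<in> X; y \<in> X\<rbrakk> \<Longrightarrow>
          \<exists>\<T> \<subseteq> below S U - {U}. finite \<T> \<and> int (card \<T>) \<le> \<lfloor>E * dom_dist S U x y + E\<rfloor> \<and>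
            (\<forall>T \<in> below S U - {U}. (\<exists>T'\<in>\<T>. nested S T T') \<or> dom_dist S T x y \<le> E)"
    and partial_realization:
        "\<lbrakk>\<U> \<subseteq> domains S; finite \<U>; \<And>U V. \<lbrakk>U \<in> \<U>; V \<in> \<U>; U \<noteq> V\<rbrakk> \<Longrightarrow> orth S U V;
          \<And>U. U \<in> \<U> \<Longrightarrow> r U \<in> cspace S U\<rbrakk> \<Longrightarrow>
          \<exists>x\<in>X. \<forall>U\<in>\<U>. set_dist (cdist S U) (cproj S U x) {r U} \<le> E \<and>
            (\<forall>V\<in>domains S. pnested S U V \<or> transverse S U V \<longrightarrow>
               set_dist (cdist S V) (cproj S V x) (rho S U V) \<le> E)"
    and bounded_geodesic_image:
        "\<lbrakk>U \<in> domains S; V \<in> domains S; pnested S U V;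
          p \<in> cspace S V; q \<in> cspace S V; geodesic_seg (cspace S V) (cdist S V) p q A\<rbrakk> \<Longrightarrow>
          A \<inter> nbhd (cspace S V) (cdist S V) E (rho S U V) \<noteq> {} \<or>
          diam_le (cdist S U) (\<Union>a\<in>A. rho_map S V U a) E"
    and uniqueness:
        "\<kappa> \<ge> 0 \<Longrightarrow> \<exists>\<theta>. \<forall>x\<in>X. \<forall>y\<in>X. d x y \<ge> \<theta> \<longrightarrow> (\<exists>U\<in>domains S. dom_dist S U x y \<ge> \<kappa>)"

definition hierarchically_hyperbolic_space ::
  "'x set \<Rightarrow> ('x \<Rightarrow> 'x \<Rightarrow> real) \<Rightarrow> ('x, 'u, 'p, 'z) hhs_structure_scheme \<Rightarrow> bool" where
  "hierarchically_hyperbolic_space X d S \<longleftrightarrow> (\<exists>E. hhs X d S E)"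

text \<open>An automorphism consists of a map \<open>f\<close> of the space, a map \<open>\<phi>\<close> of the domains, and maps
  \<open>\<psi> U\<close> from the space of \<open>U\<close> to the space of \<open>\<phi> U\<close>.\<close>

definition hhs_automorphism ::
  "'x set \<Rightarrow> ('x \<Rightarrow> 'x \<Rightarrow> real) \<Rightarrow> ('x, 'u, 'p, 'z) hhs_structure_scheme \<Rightarrow>
   ('x \<Rightarrow> 'x) \<Rightarrow> ('u \<Rightarrow> 'u) \<Rightarrow> ('u \<Rightarrow> 'p \<Rightarrow> 'p) \<Rightarrow> bool" where
  "hhs_automorphism X d S f \<phi> \<psi> \<longleftrightarrow>
     quasi_isometry X d X d f \<and>
     bij_betw \<phi> (domains S) (domains S) \<and>
     (\<forall>U\<in>domains S. \<forall>V\<in>domains S.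
        (nested S (\<phi> U) (\<phi> V) \<longleftrightarrow> nested S U V) \<and>
        (orth S (\<phi> U) (\<phi> V) \<longleftrightarrow> orth S U V) \<and>
        (transverse S (\<phi> U) (\<phi> V) \<longleftrightarrow> transverse S U V)) \<and>
     (\<forall>U\<in>domains S.
        isometry (cspace S U) (cdist S U) (cspace S (\<phi> U)) (cdist S (\<phi> U)) (\<psi> U)) \<and>
     (\<exists>K.
        (\<forall>U\<in>domains S. \<forall>x\<in>X.
           set_dist (cdist S (\<phi> U)) (\<psi> U ` cproj S U x) (cproj S (\<phi> U) (f x)) \<le> K) \<and>
        (\<forall>U\<in>domains S. \<forall>V\<in>domains S. pnested S U V \<or> transverse S U V \<longrightarrow>
           set_dist (cdist S (\<phi> V)) (\<psi> V ` rho S U V) (rho S (\<phi> U) (\<phi> V)) \<le> K) \<and>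
        (\<forall>U\<in>domains S. \<forall>V\<in>domains S. pnested S U V \<longrightarrow> (\<forall>p\<in>cspace S V.
           set_dist (cdist S (\<phi> U)) (\<psi> U ` rho_map S V U p) (rho_map S (\<phi> V) (\<phi> U) (\<psi> V p)) \<le> K)))"


section \<open>Hierarchically hyperbolic groups\<close>

text \<open>The structure is extended by the action of the group on the domains and by the isometries
  \<open>iso_act g U\<close> from the space of \<open>U\<close> to the space of \<open>g U\<close>.\<close>

record ('x, 'u, 'p) hhg_structure = "('x, 'u, 'p) hhs_structure" +
  dom_act :: "'x \<Rightarrow> 'u \<Rightarrow> 'u"
  iso_act :: "'x \<Rightarrow> 'u \<Rightarrow> 'p \<Rightarrow> 'p"

definition hierarchically_hyperbolic_group ::
  "('g, 'b) monoid_scheme \<Rightarrow> ('g, 'u, 'p, 'z) hhg_structure_scheme \<Rightarrow> bool" where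
  "hierarchically_hyperbolic_group G S \<longleftrightarrow>
     group G \<and>
     (\<exists>A. finite_generating_set G A \<and>
        hierarchically_hyperbolic_space (carrier G) (word_dist G A) S \<and>
        (\<forall>g\<in>carrier G. hhs_automorphism (carrier G) (word_dist G A) S
           (\<lambda>x. g \<otimes>\<^bsub>G\<^esub> x) (dom_act S g) (iso_act S g))) \<and>
     group_action G (domains S) (dom_act S) \<and>
     (\<forall>U\<in>domains S. \<forall>p\<in>cspace S U. iso_act S \<one>\<^bsub>G\<^esub> U p = p) \<and>
     (\<forall>g\<in>carrier G. \<forall>h\<in>carrier G. \<forall>U\<in>domains S. \<forall>p\<in>cspace S U.
        iso_act S (g \<otimes>\<^bsub>G\<^esub> h) U p = iso_act S g (dom_act S h U) (iso_act S h U p)) \<and>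
     finite (orbits G (domains S) (dom_act S)) \<and>
     (\<forall>g\<in>carrier G. \<forall>h\<in>carrier G. \<forall>U\<in>domains S.
        iso_act S g U ` cproj S U h = cproj S (dom_act S g U) (g \<otimes>\<^bsub>G\<^esub> h)) \<and>
     (\<forall>g\<in>carrier G. \<forall>U\<in>domains S. \<forall>V\<in>domains S. transverse S U V \<or> pnested S V U \<longrightarrow>
        iso_act S g U ` rho S V U = rho S (dom_act S g V) (dom_act S g U))"

definition axial :: "('g, 'b) monoid_scheme \<Rightarrow> 'g \<Rightarrow> bool" where
  "axial G g \<longleftrightarrow> g \<in> carrier G \<and>
     (\<exists>A. finite_generating_set G A \<and>
        (\<exists>x\<in>carrier G. qi_embedding (UNIV :: int set) int_dist (carrier G) (word_dist G A)
           (\<lambda>n. g [^]\<^bsub>G\<^esub> n \<otimes>\<^bsub>G\<^esub> x)))"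

text \<open>For \<open>g\<close> stabilizing \<open>U\<close>.\<close>

definition loxodromic_on ::
  "('g, 'b) monoid_scheme \<Rightarrow> ('g, 'u, 'p, 'z) hhg_structure_scheme \<Rightarrow> 'g \<Rightarrow> 'u \<Rightarrow> bool" where
  "loxodromic_on G S g U \<longleftrightarrow>
     (\<exists>p\<in>cspace S U. qi_embedding (UNIV :: int set) int_dist (cspace S U) (cdist S U)
        (\<lambda>n. iso_act S (g [^]\<^bsub>G\<^esub> n) U p))"

definition fully_supported ::
  "('g, 'b) monoid_scheme \<Rightarrow> ('g, 'u, 'p, 'z) hhg_structure_scheme \<Rightarrow> 'g \<Rightarrow> 'u \<Rightarrow> bool" where
  "fully_supported G S g U \<longleftrightarrow>
     axial G g \<and> U \<in> unbounded_domains S \<and>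
     dom_act S g U = U \<and>
     (\<forall>V\<in>unbounded_domains S. orth S V U \<longrightarrow> dom_act S g V = V) \<and>
     loxodromic_on G S g U \<and>
     (\<forall>V\<in>unbounded_domains S. orth S V U \<longrightarrow>
        (\<exists>Q\<ge>0. \<forall>p\<in>cspace S V.
           diam_le (cdist S V) (range (\<lambda>n :: int. iso_act S (g [^]\<^bsub>G\<^esub> n) V p)) Q))"

definition rigidly_fully_supported ::
  "('g, 'b) monoid_scheme \<Rightarrow> ('g, 'u, 'p, 'z) hhg_structure_scheme \<Rightarrow> 'g \<Rightarrow> 'u \<Rightarrow> bool" where
  "rigidly_fully_supported G S g U \<longleftrightarrow>
     fully_supported G S g U \<and>
     (\<forall>V\<in>unbounded_domains S. orth S V U \<longrightarrow> (\<forall>p\<in>cspace S V. iso_act S g V p = p))"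

definition weak_commutativity ::
  "('g, 'b) monoid_scheme \<Rightarrow> ('g, 'u, 'p, 'z) hhg_structure_scheme \<Rightarrow> bool" where
  "weak_commutativity G S \<longleftrightarrow>
     (\<forall>g h U V. orth S U V \<and> fully_supported G S g U \<and> fully_supported G S h V \<longrightarrow>
        (\<exists>N::nat. N > 0 \<and>
           (g [^]\<^bsub>G\<^esub> N) \<otimes>\<^bsub>G\<^esub> (h [^]\<^bsub>G\<^esub> N) = (h [^]\<^bsub>G\<^esub> N) \<otimes>\<^bsub>G\<^esub> (g [^]\<^bsub>G\<^esub> N)))"


section \<open>The orthogonality graph\<close>

definition orthogonality_adj :: "('x, 'u, 'p, 'z) hhs_structure_scheme \<Rightarrow> 'u \<Rightarrow> 'u \<Rightarrow> bool" where
  "orthogonality_adj S U V \<longleftrightarrow>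
     U \<in> unbounded_domains S \<and> V \<in> unbounded_domains S \<and> U \<noteq> V \<and> orth S U V"

text \<open>An induced cycle is given by the list of its vertices in cyclic order.\<close>

definition induced_cycle :: "'v set \<Rightarrow> ('v \<Rightarrow> 'v \<Rightarrow> bool) \<Rightarrow> 'v list \<Rightarrow> bool" where
  "induced_cycle Vs adj xs \<longleftrightarrow>
     length xs \<ge> 3 \<and> distinct xs \<and> set xs \<subseteq> Vs \<and>
     (\<forall>i < length xs. \<forall>j < length xs.
        adj (xs ! i) (xs ! j) \<longleftrightarrow> j = Suc i mod length xs \<or> i = Suc j mod length xs)"

end

theory Submission
  imports Defs
begin

text \<open>
  The statement rests on two actions of one Coxeter group. Let \<open>U\<^sub>0, \<dots>, U\<^sub>n\<^sub>-\<^sub>1\<close> be an induced cycle of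
  orthogonal domains with \<open>n \<ge> 5\<close>. Domains that are not neighbours in the cycle are transverse: if
  \<open>U\<^sub>i\<close> were nested in \<open>U\<^sub>j\<close>, it would be orthogonal to both neighbours of \<open>U\<^sub>j\<close>, and two vertices of a
  cycle share both neighbours only in a square (\<open>opposed_transverse\<close>). Choose elements fully supported on
  the domains and replace them by large powers \<open>a\<^sub>i\<close>, so that neighbours commute, and let \<open>gap\<^sub>i(x)\<close>
  be the distance in the space of \<open>U\<^sub>i\<close> from a base point to the projection of \<open>x\<close>. Multiplying
  by \<open>a\<^sub>i\<close> makes a small \<open>gap\<^sub>i\<close> large, multiplying by a neighbour of \<open>a\<^sub>i\<close> changes \<open>gap\<^sub>i\<close> by a
  bounded amount, and for transverse domains the consistency inequality forbids that both gaps are large.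

  The right-angled Coxeter group \<open>W\<close> of the cycle acts on \<open>G\<close> times the set of sign vectors: the letter
  \<open>i\<close> multiplies by \<open>a\<^sub>i\<close> or its inverse, according to the \<open>i\<close>-th sign, and flips that sign
  (\<open>turn\<close>). It also acts on the hyperbolic plane, as the reflection group of a regular right-angled
  \<open>n\<close>-gon. A word with an even number of occurrences of each letter preserves all signs, so it has a value
  in \<open>G\<close>; such words form a subgroup of finite index of \<open>W\<close>, which moves all points of the plane by a definite amount
  and is cocompact, hence is the fundamental group of the quotient surface
  (\<open>free_cocompact_action.is_surface_group\<close>).
  Both actions are instances of one ping-pong argument about reduced words. In particular a word with trivial
  value in \<open>G\<close> cancels to the empty word (\<open>val_trivial\<close>), and therefore the values of the even
  words form a surface subgroup (\<open>surface_subgroup_image\<close>).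

  If the elements are rigidly supported, multiplying by a neighbour of \<open>a\<^sub>i\<close> does not change \<open>gap\<^sub>i\<close> at
  all. Every occurrence of a letter \<open>i\<close> in a reduced word is then a wall in the Cayley graph of \<open>G\<close> that
  a path from the identity to the value of the word has to cross, and the walls of equal letters are
  crossed at different times (\<open>crossings\<close>). So the word length in \<open>G\<close> bounds the length of the
  reduced word, and the subgroup is undistorted.
  Rigidity also yields commuting powers (\<open>rigid_commute\<close>): starting from a point near the
  product region of two orthogonal domains, multiplying by \<open>g\<^sup>a h\<close> and by \<open>h g\<^sup>a\<close> leads to points with uniformly
  close projections to all domains. By uniqueness the commutators of \<open>g\<^sup>a\<close> and \<open>h\<close> take finitely many
  values, and two equal values give a power of \<open>g\<close> that commutes with \<open>h\<close>.
\<close>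


section \<open>Words in a right-angled Coxeter group\<close>

text \<open>A letter can be brought to the front of a word by commutations exactly if all letters before its first
occurrence commute with it. By the recursion, that
this is invariant under swapping commuting letters is a matter of simplification.\<close>

primrec front :: "('i \<Rightarrow> 'i \<Rightarrow> bool) \<Rightarrow> 'i \<Rightarrow> 'i list \<Rightarrow> bool" where
  "front adj i [] \<longleftrightarrow> False"
| "front adj i (j # w) \<longleftrightarrow> i = j \<or> (adj i j \<and> front adj i w)"

primrec reduced :: "('i \<Rightarrow> 'i \<Rightarrow> bool) \<Rightarrow> 'i list \<Rightarrow> bool" where
  "reduced adj [] \<longleftrightarrow> True"
| "reduced adj (i # w) \<longleftrightarrow> \<not> front adj i w \<and> reduced adj w"

inductive cancels :: "('i \<Rightarrow> 'i \<Rightarrow> bool) \<Rightarrow> 'i list \<Rightarrow> 'i list \<Rightarrow> bool" for adj where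
  "(\<And>j. j \<in> set c \<Longrightarrow> adj i j) \<Longrightarrow> cancels adj (u @ i # c @ i # v) (u @ c @ v)"

lemma front_append:
  "front adj i (u @ v) \<longleftrightarrow> front adj i u \<or> ((\<forall>j\<in>set u. adj i j) \<and> front adj i v)"
  by (induction u) auto

lemma front_split:
  "front adj i w \<Longrightarrow> \<exists>c v. w = c @ i # v \<and> (\<forall>j\<in>set c. adj i j)"
proof (induction w)
  case (Cons j w)
  show ?case
  proof (cases "i = j")
    case True
    then show ?thesis by (intro exI[of _ "[]"] exI[of _ w]) simp
  next
    case False
    with Cons obtain c v where "w = c @ i # v" "\<forall>j\<in>set c. adj i j" "adj i j" by auto
    then show ?thesis by (intro exI[of _ "j # c"] exI[of _ v]) simp
  qed
qed simp

lemma front_in_set: "front adj i w \<Longrightarrow> i \<in> set w"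
  by (induction w) auto

text \<open>A letter that occurs but cannot be moved to the front is held back by a letter that does not commute with it.\<close>

lemma not_front_ex_blocking:
  "i \<in> set w \<Longrightarrow> \<not> front adj i w \<Longrightarrow> \<exists>j\<in>set w. j \<noteq> i \<and> \<not> adj i j"
  by (induction w) auto

lemma reduced_iff_no_cancellation:
  "reduced adj w \<longleftrightarrow> \<not> (\<exists>u i c v. w = u @ i # c @ i # v \<and> (\<forall>j\<in>set c. adj i j))"
proof (induction w)
  case (Cons k w)
  show ?case
  proof
    assume red: "reduced adj (k # w)"
    show "\<not> (\<exists>u i c v. k # w = u @ i # c @ i # v \<and> (\<forall>j\<in>set c. adj i j))"
    proof (safe)
      fix u i c v assume *: "k # w = u @ i # c @ i # v" "\<forall>j\<in>set c. adj i j"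
      show False
      proof (cases u)
        case Nil
        with * red show False by (auto simp: front_append)
      next
        case (Cons a list)
        then have "w = list @ i # c @ i # v" using * by simp
        with * have "\<not> reduced adj w" using Cons.IH by blast
        with red show False by simp
      qed
    qed
  next
    assume none: "\<not> (\<exists>u i c v. k # w = u @ i # c @ i # v \<and> (\<forall>j\<in>set c. adj i j))"
    have "\<not> front adj k w"
      using none front_split[of adj k w] by (metis append_Nil)
    moreover have "reduced adj w"
      using none Cons.IH by (metis append_Cons)
    ultimately show "reduced adj (k # w)" by simp
  qed
qed simp

lemma reduced_rev: "reduced adj (rev w) \<longleftrightarrow> reduced adj w"
proof -
  have "reduced adj (rev w)" if "reduced adj w" for w
    unfolding reduced_iff_no_cancellation
  proof (safe)
    fix u i c v assume *: "rev w = u @ i # c @ i # v" "\<forall>j\<in>set c. adj i j"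
    have "w = rev v @ i # rev c @ i # rev u"
      using arg_cong[OF *(1), of rev] by simp
    with *(2) that show False unfolding reduced_iff_no_cancellation by (metis set_rev)
  qed
  from this[of w] this[of "rev w"] show ?thesis by auto
qed

lemma reduced_append: "reduced adj (u @ v) \<Longrightarrow> reduced adj u \<and> reduced adj v"
  by (induction u) (auto simp: front_append)

text \<open>The reduction of a word does not refer to any action. Applied to two actions of the Coxeter group, it shows
that they have the same kernel as soon as nonempty reduced words act nontrivially in both.\<close>

lemma cancels_to_reduced: "\<exists>w'. (cancels adj)\<^sup>*\<^sup>* w w' \<and> reduced adj w'"
proof (induction "length w" arbitrary: w rule: less_induct)
  case less
  show ?case
  proof (cases "reduced adj w")
    case False
    then obtain u i c v where w: "w = u @ i # c @ i # v" "\<forall>j\<in>set c. adj i j"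
      unfolding reduced_iff_no_cancellation by blast
    have "cancels adj w (u @ c @ v)" using w by (auto intro: cancels.intros)
    moreover obtain w' where "(cancels adj)\<^sup>*\<^sup>* (u @ c @ v) w'" "reduced adj w'"
      using less[of "u @ c @ v"] w by auto
    ultimately show ?thesis by (meson converse_rtranclp_into_rtranclp)
  qed blast
qed

lemma cancels_set: "(cancels adj)\<^sup>*\<^sup>* w w' \<Longrightarrow> set w' \<subseteq> set w"
  by (induction rule: rtranclp_induct) (auto elim!: cancels.cases)

lemma cancels_parity:
  "(cancels adj)\<^sup>*\<^sup>* w w' \<Longrightarrow> even (count_list w' i) \<longleftrightarrow> even (count_list w i)"
  by (induction rule: rtranclp_induct) (auto elim!: cancels.cases simp: count_list_append split: if_splits)

text \<open>Letters are opposed if they neither agree nor commute; for the domains this will mean transverse, for the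
sides of a polygon it will mean ultraparallel.\<close>

locale commutation_graph =
  fixes I :: "'i set" and adj :: "'i \<Rightarrow> 'i \<Rightarrow> bool"
  assumes adj_sym: "adj i j \<Longrightarrow> adj j i" and adj_irrefl: "\<not> adj i i"
begin

definition opposed :: "'i \<Rightarrow> 'i \<Rightarrow> bool" where
  "opposed i j \<longleftrightarrow> i \<noteq> j \<and> \<not> adj i j"

lemma front_swap: "adj j m \<Longrightarrow> front adj i (p @ j # m # v) \<longleftrightarrow> front adj i (p @ m # j # v)"
  using adj_sym[of j m] adj_sym[of m j] by (induction p) auto

lemma reduced_swap: "adj j m \<Longrightarrow> reduced adj (p @ j # m # v) \<longleftrightarrow> reduced adj (p @ m # j # v)"
proof (induction p)
  case Nil
  then show ?case using adj_irrefl[of j] adj_sym[of j m] by auto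
next
  case (Cons a p)
  then show ?case using front_swap[of j m a p v] by simp
qed

lemma reduced_move:
  "(\<forall>j\<in>set c. adj m j) \<Longrightarrow> reduced adj (p @ c @ m # v) \<longleftrightarrow> reduced adj (p @ m # c @ v)"
proof (induction c arbitrary: p)
  case (Cons j c)
  have "reduced adj (p @ (j # c) @ m # v) \<longleftrightarrow> reduced adj ((p @ [j]) @ c @ m # v)" by simp
  also have "\<dots> \<longleftrightarrow> reduced adj ((p @ [j]) @ m # c @ v)" using Cons by (intro Cons.IH) simp
  also have "\<dots> \<longleftrightarrow> reduced adj (p @ m # j # c @ v)"
    using reduced_swap[of j m p "c @ v"] Cons.prems adj_sym[of m j] by simp
  finally show ?case by simp
qed simp

end

section \<open>Ping-pong for reduced words\<close>

locale involutions = commutation_graph I adj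
  for I :: "'i set" and adj +
  fixes t :: "'i \<Rightarrow> 'z \<Rightarrow> 'z" and Z :: "'z set"
  assumes t_closed: "i \<in> I \<Longrightarrow> z \<in> Z \<Longrightarrow> t i z \<in> Z"
    and t_involution: "i \<in> I \<Longrightarrow> z \<in> Z \<Longrightarrow> t i (t i z) = z"
    and t_commute: "i \<in> I \<Longrightarrow> j \<in> I \<Longrightarrow> adj i j \<Longrightarrow> z \<in> Z \<Longrightarrow> t i (t j z) = t j (t i z)"
begin

lemma act_closed: "set w \<subseteq> I \<Longrightarrow> z \<in> Z \<Longrightarrow> foldr t w z \<in> Z"
  by (induction w) (auto intro: t_closed)

lemma act_commute:
  "set c \<subseteq> I \<Longrightarrow> i \<in> I \<Longrightarrow> (\<forall>j\<in>set c. adj i j) \<Longrightarrow> z \<in> Z \<Longrightarrow> foldr t c (t i z) = t i (foldr t c z)"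
  by (induction c) (auto simp: act_closed t_commute)

lemma act_cancels:
  assumes "cancels adj w w'" "set w \<subseteq> I" "z \<in> Z"
  shows "foldr t w z = foldr t w' z"
  using assms
proof cases
  case (1 c i u v)
  have "foldr t v z \<in> Z" using 1 assms by (auto intro: act_closed)
  then show ?thesis using 1 assms act_commute[of c i "foldr t v z"]
    by (auto simp: t_involution act_closed)
qed

lemma act_cancels_star:
  "(cancels adj)\<^sup>*\<^sup>* w w' \<Longrightarrow> set w \<subseteq> I \<Longrightarrow> z \<in> Z \<Longrightarrow> foldr t w z = foldr t w' z"
proof (induction rule: rtranclp_induct)
  case (step y w')
  then show ?case using act_cancels[of y w' z] cancels_set by fastforce
qed simp

lemma act_rev: "set w \<subseteq> I \<Longrightarrow> z \<in> Z \<Longrightarrow> foldr t (rev w) (foldr t w z) = z"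
  by (induction w arbitrary: z) (auto simp: act_closed t_involution)

lemma act_rev': "set w \<subseteq> I \<Longrightarrow> z \<in> Z \<Longrightarrow> foldr t w (foldr t (rev w) z) = z"
  using act_rev[of "rev w"] by simp

end

text \<open>\<open>N i z\<close> measures how far \<open>z\<close> lies beyond the \<open>i\<close>-th wall. Values up to \<open>D\<close> count as near and values
from \<open>T'\<close> on as far; the involution \<open>i\<close> exchanges the two sides, and no point is far beyond two opposed walls.
The two instances are the distances in the domains, with large \<open>T\<close>, and the signed distances to the sides of
a polygon, with \<open>T = T' = D = Q = 0\<close>. In the second one a point beyond a wall
has a definite distance from the opposed walls, which is recorded by \<open>D'\<close>.\<close>

locale ping_pong = involutions I adj t Z
  for I :: "'i set" and adj and t :: "'i \<Rightarrow> 'z \<Rightarrow> 'z" and Z +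
  fixes N :: "'i \<Rightarrow> 'z \<Rightarrow> real" and D D' Q T T' :: real
  assumes N_adj: "i \<in> I \<Longrightarrow> j \<in> I \<Longrightarrow> adj i j \<Longrightarrow> z \<in> Z \<Longrightarrow> \<bar>N i (t j z) - N i z\<bar> \<le> Q"
    and N_self: "i \<in> I \<Longrightarrow> z \<in> Z \<Longrightarrow> N i (t i z) \<ge> T - N i z"
    and N_opposed: "i \<in> I \<Longrightarrow> j \<in> I \<Longrightarrow> opposed i j \<Longrightarrow> z \<in> Z \<Longrightarrow> N i z \<ge> T' \<Longrightarrow> N j z \<le> D'"
    and D'_le: "D' \<le> D" and Q_nonneg: "0 \<le> Q" and threshold: "T' \<le> T - D - Q"
begin

text \<open>The errors \<open>Q\<close> do not accumulate, although a word may contain long stretches of letters that commute with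
a given one. The letters at the front of a word commute pairwise, so without triangles there are at
most two of them. Removing these, say \<open>b\<close> and \<open>m\<close>, leaves a word that is far beyond the wall of one of its own front
letters. That letter is opposed to \<open>b\<close> or to \<open>m\<close>, say to \<open>b\<close>, so the remaining word is near for \<open>b\<close>; then \<open>m\<close> adds
one error \<open>Q\<close>, and \<open>b\<close> takes the point far beyond its wall.\<close>

lemma reduced_word_far:
  assumes no_triangle: "\<And>i j k. i \<in> I \<Longrightarrow> j \<in> I \<Longrightarrow> k \<in> I \<Longrightarrow> adj i j \<Longrightarrow> adj j k \<Longrightarrow> \<not> adj i k"
    and base: "\<And>i. i \<in> I \<Longrightarrow> N i z \<le> D" and z: "z \<in> Z"
  shows "w \<noteq> [] \<Longrightarrow> reduced adj w \<Longrightarrow> set w \<subseteq> I \<Longrightarrow> \<exists>e. front adj e w \<and> N e (foldr t w z) \<ge> T - D - Q"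
proof (induction "length w" arbitrary: w rule: less_induct)
  case less
  then obtain b w0 where w: "w = b # w0" by (meson neq_Nil_conv)
  have b: "b \<in> I" and w0: "set w0 \<subseteq> I" "reduced adj w0" "\<not> front adj b w0" using less w by auto
  have push: "N e (t e y) \<ge> T - D - Q" if "e \<in> I" "y \<in> Z" "N e y \<le> D + Q" for e y
    using N_self[of e y] that by linarith
  show ?case
  proof (cases "w0 = []")
    case True
    have "N b (foldr t w z) \<ge> T - D - Q" using push[of b z] base[OF b] z b True w Q_nonneg by simp
    then show ?thesis using w by auto
  next
    case w0_ne: False
    show ?thesis
    proof (cases "\<exists>m. front adj m w0 \<and> adj m b")
      case False
      obtain e where e: "front adj e w0" "N e (foldr t w0 z) \<ge> T - D - Q"
        using less.hyps[of w0] w w0 w0_ne by auto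
      have eI: "e \<in> I" using front_in_set e w0 by fast
      have "opposed e b" using False e w0 by (auto simp: opposed_def)
      then have "N b (foldr t w0 z) \<le> D"
        using N_opposed[of e b "foldr t w0 z"] eI b e threshold D'_le act_closed w0 z by force
      then have "N b (foldr t w z) \<ge> T - D - Q"
        using push[of b "foldr t w0 z"] b act_closed w0 z w Q_nonneg by simp
      then show ?thesis using w by auto
    next
      case True
      then obtain m where m: "front adj m w0" "adj m b" by blast
      have mI: "m \<in> I" using front_in_set m w0 by fast
      obtain c v where cv: "w0 = c @ m # v" "\<forall>j\<in>set c. adj m j" using front_split[OF m(1)] by blast
      let ?y = "c @ v"
      have yI: "set ?y \<subseteq> I" using cv w0 by auto
      let ?x = "foldr t ?y z"
      have xZ: "?x \<in> Z" using act_closed yI z by blast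
      have "foldr t w z = t b (foldr t c (t m (foldr t v z)))" using w cv by simp
      also have "foldr t c (t m (foldr t v z)) = t m ?x"
        using act_commute[of c m "foldr t v z"] cv mI yI act_closed z by simp
      finally have wz: "foldr t w z = t b (t m ?x)" .
      have wz': "foldr t w z = t m (t b ?x)" using wz t_commute[of b m ?x] b mI m adj_sym xZ by simp
      have red_bm: "reduced adj (b # m # ?y)"
        using reduced_move[of c m "[b]" v] cv less.prems(2) w by simp
      then have red_mb: "reduced adj (m # b # ?y)"
        using reduced_swap[of b m "[]" ?y] m adj_sym by simp
      have front_m: "front adj m w" using w cv m by (simp add: front_append)
      have front_b: "front adj b w" using w by simp
      show ?thesis
      proof (cases "?y = []")
        case True
        then have "N b ?x \<le> D" using base b by simp
        then have "N b (t m ?x) \<le> D + Q"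
          using N_adj[of b m ?x] b mI m adj_sym[OF m(2)] xZ by linarith
        then have "N b (foldr t w z) \<ge> T - D - Q" using push[of b "t m ?x"] b mI xZ t_closed wz by simp
        then show ?thesis using front_b by blast
      next
        case False
        obtain e where e: "front adj e ?y" "N e ?x \<ge> T - D - Q"
          using less.hyps[of ?y] w cv yI red_bm False by auto
        have eI: "e \<in> I" using front_in_set e yI by fast
        have ne: "e \<noteq> m" "e \<noteq> b" using red_bm red_mb e by auto
        have "\<not> (adj e b \<and> adj e m)" using no_triangle[of e b m] eI b mI m adj_sym by blast
        then consider "opposed e b" | "opposed e m" using ne by (auto simp: opposed_def)
        then show ?thesis
        proof cases
          case 1
          have "N b ?x \<le> D" using N_opposed[of e b ?x] 1 eI b e threshold D'_le xZ by force
          then have "N b (t m ?x) \<le> D + Q"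
            using N_adj[of b m ?x] b mI m adj_sym[OF m(2)] xZ by linarith
          then have "N b (foldr t w z) \<ge> T - D - Q" using push[of b "t m ?x"] b mI xZ t_closed wz by simp
          then show ?thesis using front_b by blast
        next
          case 2
          have "N m ?x \<le> D" using N_opposed[of e m ?x] 2 eI mI e threshold D'_le xZ by force
          then have "N m (t b ?x) \<le> D + Q" using N_adj[of m b ?x] b mI m xZ by linarith
          then have "N m (foldr t w z) \<ge> T - D - Q" using push[of m "t b ?x"] b mI xZ t_closed wz' by simp
          then show ?thesis using front_m by blast
        qed
      qed
    qed
  qed
qed

end

text \<open>Without errors the stretches of commuting letters are invisible, and the position of a point with respect to
one wall can be followed along a whole word.\<close>

locale rigid_ping_pong = ping_pong I adj t Z N D D' 0 T T'
  for I :: "'i set" and adj and t :: "'i \<Rightarrow> 'z \<Rightarrow> 'z" and Z N D D' T T'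
begin

lemma N_adj_eq: "i \<in> I \<Longrightarrow> j \<in> I \<Longrightarrow> adj i j \<Longrightarrow> z \<in> Z \<Longrightarrow> N i (t j z) = N i z"
  using N_adj[of i j z] by simp

text \<open>The first letter of \<open>y\<close> either commutes with \<open>i\<close> and can be ignored, or is opposed to \<open>i\<close>. In the second case the
induction hypothesis for that letter shows that it takes the point beyond its own wall,
hence near for \<open>i\<close>. Only the letters that can be moved to the very end of the word meet the
original point \<open>x\<close>.\<close>

lemma near_after_word:
  assumes "reduced adj (i # y)" "set (i # y) \<subseteq> I" "x \<in> Z"
    and "\<And>b. front adj b (rev (i # y)) \<Longrightarrow> N b x \<le> D"
  shows "N i (foldr t y x) \<le> D"
  using assms
proof (induction y arbitrary: i)
  case (Cons b y)
  have x: "foldr t y x \<in> Z" using Cons.prems act_closed by simp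
  show ?case
  proof (cases "adj i b")
    case True
    have "N i (foldr t y x) \<le> D"
      using Cons.prems True by (intro Cons.IH) (auto simp: front_append)
    then show ?thesis using N_adj_eq[of i b "foldr t y x"] True Cons.prems x by simp
  next
    case False
    have "N b (foldr t y x) \<le> D"
      using Cons.prems by (intro Cons.IH) (auto simp: front_append)
    then have "N b (t b (foldr t y x)) \<ge> T'"
      using N_self[of b "foldr t y x"] Cons.prems x threshold by simp
    moreover have "opposed b i" using False Cons.prems adj_sym by (auto simp: opposed_def)
    ultimately show ?thesis
      using N_opposed[of b i "t b (foldr t y x)"] Cons.prems x t_closed D'_le by simp
  qed
qed auto

lemma near_base_after_word:
  assumes "reduced adj (i # y)" "set (i # y) \<subseteq> I" "x \<in> Z" and "\<And>b. b \<in> I \<Longrightarrow> N b x \<le> D"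
  shows "N i (foldr t y x) \<le> D"
  using assms front_in_set[of adj _ "rev (i # y)"] by (intro near_after_word) auto

lemma deep_after_word:
  assumes "reduced adj (i # y)" "set (i # y) \<subseteq> I" "x \<in> Z" and base: "\<And>b. b \<in> I \<Longrightarrow> N b x \<le> D"
    and "\<exists>j\<in>set y. opposed i j"
  shows "N i (foldr t y x) \<le> D'"
  using assms
proof (induction y)
  case (Cons b y)
  have x: "foldr t y x \<in> Z" using Cons.prems act_closed by simp
  show ?case
  proof (cases "adj i b")
    case True
    have "N i (foldr t y x) \<le> D'"
      using Cons.prems True by (intro Cons.IH) (auto simp: opposed_def)
    then show ?thesis using N_adj_eq[of i b "foldr t y x"] True Cons.prems x by simp
  next
    case False
    have "N b (foldr t y x) \<le> D"
      using Cons.prems by (intro near_base_after_word) auto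
    then have "N b (t b (foldr t y x)) \<ge> T'"
      using N_self[of b "foldr t y x"] Cons.prems x threshold by simp
    moreover have "opposed b i" using False Cons.prems adj_sym by (auto simp: opposed_def)
    ultimately show ?thesis
      using N_opposed[of b i "t b (foldr t y x)"] Cons.prems x t_closed by simp
  qed
qed simp

text \<open>A point that is far beyond a wall is near for the next parallel copy of the wall. Letters at the front of \<open>m\<close>
that commute with \<open>i\<close> do not change the assumption on \<open>x\<close> and are moved into it; the
remaining front letters are opposed to \<open>i\<close>, so \<open>x\<close> is near for them.\<close>

lemma far_then_near:
  assumes "reduced adj (i # m @ [i])" "set (i # m) \<subseteq> I" "x \<in> Z" "N i x \<ge> T'"
  shows "N i (foldr t (rev m) x) \<le> D"
  using assms
proof (induction "length m" arbitrary: m x rule: less_induct)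
  case less
  show ?case
  proof (cases "\<exists>b. front adj b m \<and> adj i b")
    case True
    then obtain b where b: "front adj b m" "adj i b" by blast
    obtain c v where cv: "m = c @ b # v" "\<forall>j\<in>set c. adj b j" using front_split[OF b(1)] by blast
    have I: "b \<in> I" "set c \<subseteq> I" "set v \<subseteq> I" "i \<in> I" using less.prems cv by auto
    have bx: "t b x \<in> Z" using I less.prems t_closed by blast
    have "reduced adj (i # b # c @ v @ [i])"
      using reduced_move[of c b "[i]" "v @ [i]"] cv less.prems by simp
    then have "reduced adj (b # i # c @ v @ [i])" using reduced_swap[of i b "[]"] b by simp
    then have "reduced adj (i # (c @ v) @ [i])" by simp
    moreover have "N i (t b x) \<ge> T'" using N_adj_eq[of i b x] I b less.prems by simp
    ultimately have "N i (foldr t (rev (c @ v)) (t b x)) \<le> D"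
      using cv I bx by (intro less.hyps) auto
    moreover have "foldr t (rev c) (t b x) = t b (foldr t (rev c) x)"
      using act_commute[of "rev c" b x] I cv less.prems by simp
    ultimately show ?thesis using cv by simp
  next
    case False
    have nf: "\<not> front adj i (m @ [i])" using less.prems by simp
    show ?thesis
    proof (rule near_after_word)
      have "reduced adj (m @ [i])" using less.prems by simp
      then have "reduced adj (rev (m @ [i]))" by (simp only: reduced_rev)
      then show "reduced adj (i # rev m)" by simp
      fix b assume "front adj b (rev (i # rev m))"
      then have f: "front adj b (m @ [i])" by simp
      with nf have "b \<noteq> i" by blast
      then have fb: "front adj b m" using f by (auto simp: front_append)
      then have "opposed i b" using False \<open>b \<noteq> i\<close> by (auto simp: opposed_def)
      moreover have "b \<in> I" using fb front_in_set less.prems by fastforce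
      ultimately show "N b x \<le> D" using N_opposed[of i b x] less.prems D'_le by simp
    qed (use less.prems in auto)
  qed
qed

end

section \<open>The upper half plane and the hyperboloid\<close>

text \<open>The distance of the upper half plane becomes bilinear on the hyperboloid: its hyperbolic cosine is minus the Minkowski
product. Reflections are linear there, and inequalities between distances are statements about Gram determinants.\<close>

definition mink :: "real \<times> real \<times> real \<Rightarrow> real \<times> real \<times> real \<Rightarrow> real" where
  "mink x y = fst x * fst y + fst (snd x) * fst (snd y) - snd (snd x) * snd (snd y)"

definition height :: "real \<times> real \<times> real \<Rightarrow> real" where
  "height x = snd (snd x)"

definition hyperboloid :: "(real \<times> real \<times> real) set" where
  "hyperboloid = {x. mink x x = -1 \<and> height x > 0}"

lemma mink_commute: "mink x y = mink y x"
  by (simp add: mink_def)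

lemma mink_linear [simp]:
  "mink (x + y) z = mink x z + mink y z" "mink (x - y) z = mink x z - mink y z"
  "mink (c *\<^sub>R x) z = c * mink x z" "mink z (x + y) = mink z x + mink z y"
  "mink z (x - y) = mink z x - mink z y" "mink z (c *\<^sub>R x) = c * mink z x"
  "mink (- x) z = - mink x z" "mink z (- x) = - mink z x"
  by (simp_all add: mink_def algebra_simps)

text \<open>The Gram determinant of three vectors is the determinant of the Minkowski form, which is negative, times a square.\<close>

lemma gram_nonpos:
  "mink x x * mink y y * mink z z + 2 * mink x y * mink y z * mink x z
    \<le> mink x x * (mink y z)\<^sup>2 + mink y y * (mink x z)\<^sup>2 + mink z z * (mink x y)\<^sup>2"
proof -
  obtain a b c where x: "x = (a, b, c)" by (cases x) auto
  obtain p q r where y: "y = (p, q, r)" by (cases y) auto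
  obtain u v w where z: "z = (u, v, w)" by (cases z) auto
  have "mink x x * (mink y z)\<^sup>2 + mink y y * (mink x z)\<^sup>2 + mink z z * (mink x y)\<^sup>2
     - (mink x x * mink y y * mink z z + 2 * mink x y * mink y z * mink x z)
    = (a * (q * w - r * v) - b * (p * w - r * u) + c * (p * v - q * u))\<^sup>2"
    unfolding x y z mink_def by simp algebra
  then show ?thesis using zero_le_power2 by (metis diff_ge_0_iff_ge)
qed

lemma mink_timelike_less:
  assumes x: "x \<in> hyperboloid" and y: "mink y y < 0" "height y > 0"
  shows "mink x y < 0"
proof -
  obtain a b c where xe: "x = (a, b, c)" by (cases x) auto
  obtain p q r where ye: "y = (p, q, r)" by (cases y) auto
  have c: "c\<^sup>2 = 1 + a\<^sup>2 + b\<^sup>2" "c > 0"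
    using x by (auto simp: hyperboloid_def xe mink_def height_def power2_eq_square)
  have r: "p\<^sup>2 + q\<^sup>2 < r\<^sup>2" "r > 0"
    using y by (auto simp: ye mink_def height_def power2_eq_square)
  have "(a * p + b * q)\<^sup>2 = (a\<^sup>2 + b\<^sup>2) * (p\<^sup>2 + q\<^sup>2) - (a * q - b * p)\<^sup>2"
    by algebra
  also have "\<dots> \<le> (a\<^sup>2 + b\<^sup>2) * (p\<^sup>2 + q\<^sup>2)" by simp
  also have "\<dots> \<le> c\<^sup>2 * (p\<^sup>2 + q\<^sup>2)" using c by (intro mult_right_mono) auto
  also have "\<dots> < c\<^sup>2 * r\<^sup>2"
    using mult_strict_left_mono[OF r(1) zero_less_power[OF c(2), of 2]] .
  finally have "(a * p + b * q)\<^sup>2 < (c * r)\<^sup>2" by (simp add: power_mult_distrib)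
  then have "a * p + b * q < c * r" using c r by (intro power2_less_imp_less[of _ "c * r"]) auto
  then show ?thesis by (simp add: xe ye mink_def)
qed

lemma mink_orthogonal_spacelike:
  assumes x: "x \<in> hyperboloid" and y: "mink x y = 0"
  shows "mink y y \<ge> 0"
proof (rule ccontr)
  assume n: "\<not> mink y y \<ge> 0"
  have h: "height y \<noteq> 0"
  proof
    assume "height y = 0"
    then have "mink y y \<ge> 0" by (simp add: mink_def height_def)
    with n show False by simp
  qed
  then consider "height y > 0" | "height (- y) > 0" by (force simp: height_def)
  then show False
  proof cases
    case 1
    then show False using mink_timelike_less[OF x, of y] n y by simp
  next
    case 2
    then show False using mink_timelike_less[OF x, of "- y"] n y by simp
  qed
qed

text \<open>The reversed Cauchy-Schwarz inequality: the component of \<open>y\<close> orthogonal to \<open>x\<close> is spacelike.\<close>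

lemma mink_timelike_bound:
  assumes x: "x \<in> hyperboloid" and y: "mink y y < 0" "height y > 0"
  shows "mink x y \<le> - sqrt (- mink y y)"
proof -
  have xx: "mink x x = -1" using x by (simp add: hyperboloid_def)
  have "mink x (y + mink x y *\<^sub>R x) = 0" using xx by simp
  then have "mink (y + mink x y *\<^sub>R x) (y + mink x y *\<^sub>R x) \<ge> 0"
    using mink_orthogonal_spacelike x by blast
  then have "- mink y y \<le> (mink x y)\<^sup>2"
    using xx mink_commute[of y x] by (simp add: power2_eq_square algebra_simps)
  then have "sqrt (- mink y y) \<le> \<bar>mink x y\<bar>" by (metis real_sqrt_le_mono real_sqrt_abs)
  then show ?thesis using mink_timelike_less[OF assms] by simp
qed

lemma mink_hyperboloid_le: "x \<in> hyperboloid \<Longrightarrow> y \<in> hyperboloid \<Longrightarrow> mink x y \<le> - 1"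
  using mink_timelike_bound[of x y] by (simp add: hyperboloid_def)

definition reflection :: "real \<times> real \<times> real \<Rightarrow> real \<times> real \<times> real \<Rightarrow> real \<times> real \<times> real" where
  "reflection e x = x - (2 * mink x e) *\<^sub>R e"

lemma mink_reflection:
  "mink e e = 1 \<Longrightarrow> mink (reflection e x) (reflection e y) = mink x y"
  using mink_commute[of e x] mink_commute[of e y] by (simp add: reflection_def algebra_simps)

lemma reflection_involution: "mink e e = 1 \<Longrightarrow> reflection e (reflection e x) = x"
  by (simp add: reflection_def algebra_simps)

lemma mink_reflection_left:
  "mink (reflection e x) f = mink x f - 2 * mink x e * mink e f"
  by (simp add: reflection_def)

lemma reflection_commute:
  "mink e f = 0 \<Longrightarrow> reflection e (reflection f x) = reflection f (reflection e x)"
  using mink_commute[of e f] by (simp add: reflection_def algebra_simps)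

lemma reflection_hyperboloid:
  assumes e: "mink e e = 1" and x: "x \<in> hyperboloid"
  shows "reflection e x \<in> hyperboloid"
proof -
  let ?y = "reflection e x"
  have yy: "mink ?y ?y = - 1" using mink_reflection[OF e] x by (simp add: hyperboloid_def)
  have xx: "mink x x = - 1" using x by (simp add: hyperboloid_def)
  have "mink x ?y = - 1 - 2 * (mink x e)\<^sup>2" using xx
    by (simp add: reflection_def power2_eq_square)
  then have xy: "mink x ?y < 0" by (smt (verit) zero_le_power2)
  have "height ?y \<noteq> 0"
  proof
    assume "height ?y = 0"
    then have "mink ?y ?y \<ge> 0" by (simp add: mink_def height_def)
    with yy show False by simp
  qed
  moreover have "\<not> height ?y < 0"
  proof
    assume "height ?y < 0"
    then have "mink x (- ?y) < 0"
      using yy by (intro mink_timelike_less[OF x]) (simp_all add: height_def)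
    with xy show False by simp
  qed
  ultimately show ?thesis using yy by (simp add: hyperboloid_def)
qed

text \<open>The point \<open>x + i y\<close> corresponds to the positive definite symmetric matrix of determinant 1 with entries \<open>(x\<^sup>2 + y\<^sup>2) / y\<close>,
\<open>x / y\<close>, \<open>1 / y\<close>. The coordinates are half the difference of the diagonal entries, the entry
off the diagonal, and half the trace; minus the determinant is the Minkowski form.\<close>

definition to_hyperboloid :: "complex \<Rightarrow> real \<times> real \<times> real" where
  "to_hyperboloid z = (((cmod z)\<^sup>2 - 1) / (2 * Im z), Re z / Im z, ((cmod z)\<^sup>2 + 1) / (2 * Im z))"

definition of_hyperboloid :: "real \<times> real \<times> real \<Rightarrow> complex" where
  "of_hyperboloid x = Complex (fst (snd x) / (height x - fst x)) (1 / (height x - fst x))"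

lemma mink_to_hyperboloid:
  assumes "z \<in> upper_half_plane" "w \<in> upper_half_plane"
  shows "- mink (to_hyperboloid z) (to_hyperboloid w) = 1 + (cmod (z - w))\<^sup>2 / (2 * Im z * Im w)"
proof -
  have yv: "Im z > 0" "Im w > 0" using assms by (auto simp: upper_half_plane_def)
  have "- mink (to_hyperboloid z) (to_hyperboloid w)
      = ((cmod z)\<^sup>2 + (cmod w)\<^sup>2 - 2 * Re z * Re w) / (2 * Im z * Im w)"
    using yv by (simp add: mink_def to_hyperboloid_def field_simps)
  also have "(cmod z)\<^sup>2 + (cmod w)\<^sup>2 - 2 * Re z * Re w = (cmod (z - w))\<^sup>2 + 2 * Im z * Im w"
    by (simp add: cmod_power2 power2_diff)
  also have "\<dots> / (2 * Im z * Im w) = 1 + (cmod (z - w))\<^sup>2 / (2 * Im z * Im w)"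
    using yv by (simp add: field_simps)
  finally show ?thesis .
qed

lemma to_hyperboloid_mem: "z \<in> upper_half_plane \<Longrightarrow> to_hyperboloid z \<in> hyperboloid"
  using mink_to_hyperboloid[of z z]
  by (auto simp: hyperboloid_def height_def to_hyperboloid_def upper_half_plane_def
      intro!: divide_pos_pos add_nonneg_pos)

lemma hyperboloid_height_gt: "x \<in> hyperboloid \<Longrightarrow> height x > fst x"
proof -
  assume x: "x \<in> hyperboloid"
  obtain a b c where xe: "x = (a, b, c)" by (cases x) auto
  have "c\<^sup>2 = 1 + a\<^sup>2 + b\<^sup>2" "c > 0"
    using x by (auto simp: hyperboloid_def xe mink_def height_def power2_eq_square)
  then have "a < c" by (intro power2_less_imp_less[of a c]) (auto simp: add_pos_nonneg)
  then show ?thesis by (simp add: xe height_def)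
qed

lemma of_hyperboloid_mem: "x \<in> hyperboloid \<Longrightarrow> of_hyperboloid x \<in> upper_half_plane"
  using hyperboloid_height_gt[of x] by (simp add: of_hyperboloid_def upper_half_plane_def)

lemma of_to_hyperboloid: "z \<in> upper_half_plane \<Longrightarrow> of_hyperboloid (to_hyperboloid z) = z"
proof -
  assume "z \<in> upper_half_plane"
  then have y: "Im z > 0" by (simp add: upper_half_plane_def)
  have "((cmod z)\<^sup>2 + 1) / (2 * Im z) - ((cmod z)\<^sup>2 - 1) / (2 * Im z) = 1 / Im z"
    using y by (simp add: field_simps)
  then show ?thesis using y by (simp add: of_hyperboloid_def to_hyperboloid_def height_def complex_eq_iff)
qed

lemma to_of_hyperboloid: "x \<in> hyperboloid \<Longrightarrow> to_hyperboloid (of_hyperboloid x) = x"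
proof -
  assume x: "x \<in> hyperboloid"
  obtain a b c where xe: "x = (a, b, c)" by (cases x) auto
  have c: "c * c = 1 + a * a + b * b"
    using x by (auto simp: hyperboloid_def xe mink_def height_def power2_eq_square)
  have ac: "c - a > 0" using hyperboloid_height_gt[OF x] by (simp add: xe height_def)
  have m: "(cmod (of_hyperboloid x))\<^sup>2 = (c + a) / (c - a)"
  proof -
    have "(cmod (of_hyperboloid x))\<^sup>2 = (b / (c - a))\<^sup>2 + (1 / (c - a))\<^sup>2"
      by (simp add: of_hyperboloid_def xe height_def cmod_power2)
    also have "\<dots> = (b * b + 1) / ((c - a) * (c - a))"
      by (simp add: power2_eq_square add_divide_distrib)
    also have "b * b + 1 = (c + a) * (c - a)" using c by (simp add: algebra_simps)
    finally show ?thesis using ac by simp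
  qed
  have "Im (of_hyperboloid x) = 1 / (c - a)" "Re (of_hyperboloid x) = b / (c - a)"
    by (simp_all add: of_hyperboloid_def xe height_def)
  then have "to_hyperboloid (of_hyperboloid x)
      = (((c + a) / (c - a) - 1) * (c - a) / 2, b, ((c + a) / (c - a) + 1) * (c - a) / 2)"
    using m ac by (simp add: to_hyperboloid_def)
  also have "((c + a) / (c - a) - 1) * (c - a) / 2 = a" using ac by (simp add: field_simps)
  also have "((c + a) / (c - a) + 1) * (c - a) / 2 = c" using ac by (simp add: field_simps)
  finally show ?thesis by (simp add: xe)
qed

lemma hyp_dist_arcosh:
  assumes "z \<in> upper_half_plane" "w \<in> upper_half_plane"
  shows "hyp_dist z w = arcosh (- mink (to_hyperboloid z) (to_hyperboloid w))"
  using mink_to_hyperboloid[OF assms] by (simp add: hyp_dist_def)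

lemma hyp_dist_arg_ge_1:
  "z \<in> upper_half_plane \<Longrightarrow> w \<in> upper_half_plane \<Longrightarrow> 1 + (cmod (z - w))\<^sup>2 / (2 * Im z * Im w) \<ge> 1"
  by (simp add: upper_half_plane_def)

lemma hyp_dist_nonneg: "z \<in> upper_half_plane \<Longrightarrow> w \<in> upper_half_plane \<Longrightarrow> hyp_dist z w \<ge> 0"
  unfolding hyp_dist_def using hyp_dist_arg_ge_1 by (intro arcosh_nonneg_real) auto

lemma hyp_dist_commute: "hyp_dist z w = hyp_dist w z"
  by (simp add: hyp_dist_def norm_minus_commute mult.commute mult.left_commute)

lemma hyp_dist_eq_0_iff:
  assumes "z \<in> upper_half_plane" "w \<in> upper_half_plane"
  shows "hyp_dist z w = 0 \<longleftrightarrow> z = w"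
  using assms hyp_dist_arg_ge_1[OF assms]
  by (simp add: hyp_dist_def arcosh_eq_0_iff_real upper_half_plane_def)

text \<open>With \<open>a\<close>, \<open>b\<close>, \<open>c\<close> the hyperbolic cosines of the three distances, the sign of the Gram determinant says that
\<open>c\<close> differs from \<open>a b\<close> by at most the product of the hyperbolic sines, which is the addition theorem.\<close>

lemma hyp_dist_triangle:
  assumes z: "z \<in> upper_half_plane" and w: "w \<in> upper_half_plane" and u: "u \<in> upper_half_plane"
  shows "hyp_dist z u \<le> hyp_dist z w + hyp_dist w u"
proof -
  let ?x = "to_hyperboloid z" and ?y = "to_hyperboloid w" and ?t = "to_hyperboloid u"
  define a b c where "a = - mink ?x ?y" and "b = - mink ?y ?t" and "c = - mink ?x ?t"
  have mem: "?x \<in> hyperboloid" "?y \<in> hyperboloid" "?t \<in> hyperboloid"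
    using z w u to_hyperboloid_mem by auto
  have ge: "a \<ge> 1" "b \<ge> 1" "c \<ge> 1"
    using mink_hyperboloid_le[OF mem(1,2)] mink_hyperboloid_le[OF mem(2,3)]
      mink_hyperboloid_le[OF mem(1,3)] by (simp_all add: a_def b_def c_def)
  have "1 + 2 * a * b * c - a\<^sup>2 - b\<^sup>2 - c\<^sup>2 \<ge> 0"
    using gram_nonpos[of ?x ?y ?t] mem by (simp add: hyperboloid_def a_def b_def c_def)
  then have "(c - a * b)\<^sup>2 \<le> (a\<^sup>2 - 1) * (b\<^sup>2 - 1)" by (simp add: power2_eq_square algebra_simps)
  then have "\<bar>c - a * b\<bar> \<le> sqrt ((a\<^sup>2 - 1) * (b\<^sup>2 - 1))"
    by (metis real_sqrt_abs real_sqrt_le_mono)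
  then have "c \<le> a * b + sqrt (a\<^sup>2 - 1) * sqrt (b\<^sup>2 - 1)" by (simp add: real_sqrt_mult)
  also have "\<dots> = cosh (arcosh a + arcosh b)"
    using ge by (simp add: cosh_add sinh_arcosh_real)
  finally have le: "c \<le> cosh (arcosh a + arcosh b)" .
  have "arcosh c \<le> arcosh (cosh (arcosh a + arcosh b))"
    using le ge by (metis arcosh_less_iff_real linorder_not_less order_trans)
  also have "\<dots> = arcosh a + arcosh b" using ge by (simp add: arcosh_cosh_real)
  finally show ?thesis using z w u by (simp add: hyp_dist_arcosh a_def b_def c_def)
qed

lemma convex_upper_half_plane: "convex upper_half_plane"
  unfolding upper_half_plane_def by (rule convex_halfspace_Im_gt)

lemma continuous_on_hyp_dist [continuous_intros]:
  assumes "continuous_on A f" "continuous_on A g" "f ` A \<subseteq> upper_half_plane" "g ` A \<subseteq> upper_half_plane"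
  shows "continuous_on A (\<lambda>x. hyp_dist (f x) (g x))"
proof -
  let ?h = "\<lambda>x. 1 + (cmod (f x - g x))\<^sup>2 / (2 * Im (f x) * Im (g x))"
  have "Im (f x) \<noteq> 0" "Im (g x) \<noteq> 0" if "x \<in> A" for x
    using that assms(3,4) by (auto simp: upper_half_plane_def image_subset_iff)
  then have "continuous_on A ?h" using assms(1,2) by (intro continuous_intros) auto
  moreover have "?h ` A \<subseteq> {1..}" using assms(3,4) hyp_dist_arg_ge_1 by force
  ultimately show ?thesis
    unfolding hyp_dist_def by (intro continuous_on_compose2[OF continuous_on_arcosh[of "{1..}"]]) auto
qed

text \<open>The hyperbolic and the Euclidean metric induce the same topology; the other direction is \<open>continuous_on_hyp_dist\<close>.\<close>

lemma hyp_dist_controls_dist: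
  assumes z: "z \<in> upper_half_plane" and e: "e > 0"
  obtains r where "r > 0" "\<And>w. w \<in> upper_half_plane \<Longrightarrow> hyp_dist z w < r \<Longrightarrow> dist z w < e"
proof
  have y: "Im z > 0" using z by (simp add: upper_half_plane_def)
  \<comment> \<open>The value of \<open>D\<^sup>2 / (2 Im z Im w)\<close> at Euclidean distance \<open>D = e\<close> and the largest possible \<open>Im w\<close>; it
  increases with \<open>D\<close>.\<close>
  define s where "s = e\<^sup>2 / (2 * Im z * (Im z + e))"
  have s: "s > 0" using y e by (simp add: s_def)
  show "arcosh (1 + s) > 0" using s by simp
  fix w assume w: "w \<in> upper_half_plane" and "hyp_dist z w < arcosh (1 + s)"
  then have *: "(cmod (z - w))\<^sup>2 / (2 * Im z * Im w) < s"
    using hyp_dist_arg_ge_1[OF z w] s unfolding hyp_dist_def by simp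
  have v: "Im w > 0" using w by (simp add: upper_half_plane_def)
  let ?D = "cmod (z - w)"
  have "Im w \<le> Im z + ?D" using abs_Im_le_cmod[of "z - w"] by simp
  have "?D\<^sup>2 < s * (2 * Im z * Im w)" using * y v by (simp add: pos_divide_less_eq)
  also have "\<dots> \<le> s * (2 * Im z * (Im z + ?D))"
    using s y \<open>Im w \<le> Im z + ?D\<close> by (intro mult_left_mono) auto
  also have "\<dots> = e\<^sup>2 * (Im z + ?D) / (Im z + e)" using y by (simp add: s_def)
  finally have "?D\<^sup>2 * (Im z + e) < e\<^sup>2 * (Im z + ?D)"
    using y e by (simp add: pos_less_divide_eq)
  then have "(?D - e) * (Im z * (?D + e) + ?D * e) < 0"
    by (simp add: power2_eq_square algebra_simps)
  moreover have "Im z * (?D + e) + ?D * e > 0" using y e by (simp add: add_nonneg_pos add_pos_nonneg)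
  ultimately have "?D < e" by (simp add: mult_less_0_iff)
  then show "dist z w < e" by (simp add: dist_norm)
qed

section \<open>Uniformly free cocompact actions on the hyperbolic plane\<close>

text \<open>The displacement is bounded below uniformly, which includes proper discontinuity and gives a lower bound for the injectivity
radius of the quotient.\<close>

locale free_cocompact_action = group \<Gamma> for \<Gamma> :: "('g, 'b) monoid_scheme" (structure) +
  fixes \<alpha> :: "'g \<Rightarrow> complex \<Rightarrow> complex" and \<epsilon> :: real and C :: "complex set"
  assumes act_closed: "g \<in> carrier \<Gamma> \<Longrightarrow> z \<in> upper_half_plane \<Longrightarrow> \<alpha> g z \<in> upper_half_plane"
    and act_one: "z \<in> upper_half_plane \<Longrightarrow> \<alpha> \<one> z = z"
    and act_mult: "g \<in> carrier \<Gamma> \<Longrightarrow> h \<in> carrier \<Gamma> \<Longrightarrow> z \<in> upper_half_plane \<Longrightarrow>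
      \<alpha> (g \<otimes> h) z = \<alpha> g (\<alpha> h z)"
    and act_isometry: "g \<in> carrier \<Gamma> \<Longrightarrow> z \<in> upper_half_plane \<Longrightarrow> w \<in> upper_half_plane \<Longrightarrow>
      hyp_dist (\<alpha> g z) (\<alpha> g w) = hyp_dist z w"
    and \<epsilon>_pos: "\<epsilon> > 0"
    and act_free: "g \<in> carrier \<Gamma> \<Longrightarrow> g \<noteq> \<one> \<Longrightarrow> z \<in> upper_half_plane \<Longrightarrow> hyp_dist z (\<alpha> g z) \<ge> \<epsilon>"
    and C_compact: "compact C" "C \<subseteq> upper_half_plane"
    and act_cocompact: "z \<in> upper_half_plane \<Longrightarrow> \<exists>g\<in>carrier \<Gamma>. \<alpha> g z \<in> C"
begin

lemma act_inv: "g \<in> carrier \<Gamma> \<Longrightarrow> z \<in> upper_half_plane \<Longrightarrow> \<alpha> (inv g) (\<alpha> g z) = z"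
  using act_mult[of "inv g" g z] act_one by simp

subsection \<open>The quotient surface\<close>

text \<open>The quotient is realized on a set of orbit representatives, so that its points are again complex numbers.\<close>

definition orbit_rep :: "complex \<Rightarrow> complex" where
  "orbit_rep z = (SOME w. \<exists>g\<in>carrier \<Gamma>. w = \<alpha> g z)"

definition surface :: "complex set" where
  "surface = orbit_rep ` upper_half_plane"

definition orbit_dist :: "complex \<Rightarrow> complex \<Rightarrow> real" where
  "orbit_dist z w = (INF g\<in>carrier \<Gamma>. hyp_dist z (\<alpha> g w))"

text \<open>Outside the surface the value is 0, since a metric has to be symmetric and nonnegative on the whole type.\<close>

definition surface_dist :: "complex \<Rightarrow> complex \<Rightarrow> real" where
  "surface_dist x y = (if x \<in> surface \<and> y \<in> surface then orbit_dist x y else 0)"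

lemma orbit_rep_ex: "z \<in> upper_half_plane \<Longrightarrow> \<exists>g\<in>carrier \<Gamma>. orbit_rep z = \<alpha> g z"
  unfolding orbit_rep_def by (rule someI_ex) (use one_closed in blast)

lemma orbit_rep_act:
  assumes g: "g \<in> carrier \<Gamma>" and z: "z \<in> upper_half_plane"
  shows "orbit_rep (\<alpha> g z) = orbit_rep z"
proof -
  have "(\<exists>h\<in>carrier \<Gamma>. w = \<alpha> h (\<alpha> g z)) \<longleftrightarrow> (\<exists>h\<in>carrier \<Gamma>. w = \<alpha> h z)" for w
  proof (safe)
    fix h assume h: "h \<in> carrier \<Gamma>"
    show "\<exists>h'\<in>carrier \<Gamma>. \<alpha> h (\<alpha> g z) = \<alpha> h' z"
      using act_mult[OF h g z] h g by (metis m_closed)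
    have "\<alpha> (h \<otimes> inv g) (\<alpha> g z) = \<alpha> h z"
      using act_mult[of h "inv g" "\<alpha> g z"] h g z act_closed act_inv by simp
    then show "\<exists>h'\<in>carrier \<Gamma>. \<alpha> h z = \<alpha> h' (\<alpha> g z)"
      using h g by (metis inv_closed m_closed)
  qed
  then show ?thesis unfolding orbit_rep_def by simp
qed

lemma orbit_rep_eqD:
  assumes z: "z \<in> upper_half_plane" and w: "w \<in> upper_half_plane" and eq: "orbit_rep z = orbit_rep w"
  shows "\<exists>g\<in>carrier \<Gamma>. w = \<alpha> g z"
proof -
  obtain g h where g: "g \<in> carrier \<Gamma>" "orbit_rep z = \<alpha> g z" and h: "h \<in> carrier \<Gamma>" "orbit_rep w = \<alpha> h w"
    using orbit_rep_ex z w by blast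
  have "w = \<alpha> (inv h) (\<alpha> g z)" using act_inv[OF h(1) w] h g eq by simp
  also have "\<dots> = \<alpha> (inv h \<otimes> g) z" using act_mult g h z by simp
  finally show ?thesis using g h by blast
qed

lemma surface_subset: "surface \<subseteq> upper_half_plane"
  using orbit_rep_ex act_closed unfolding surface_def by fastforce

lemma orbit_rep_mem: "z \<in> upper_half_plane \<Longrightarrow> orbit_rep z \<in> surface"
  by (simp add: surface_def)

lemma orbit_rep_surface: "x \<in> surface \<Longrightarrow> orbit_rep x = x"
  unfolding surface_def using orbit_rep_ex orbit_rep_act by fastforce

lemma orbit_dist_bdd: "z \<in> upper_half_plane \<Longrightarrow> w \<in> upper_half_plane \<Longrightarrow>
    bdd_below ((\<lambda>g. hyp_dist z (\<alpha> g w)) ` carrier \<Gamma>)"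
  using hyp_dist_nonneg act_closed by (intro bdd_belowI2[of _ 0]) auto

lemma orbit_dist_le: "g \<in> carrier \<Gamma> \<Longrightarrow> z \<in> upper_half_plane \<Longrightarrow> w \<in> upper_half_plane \<Longrightarrow>
    orbit_dist z w \<le> hyp_dist z (\<alpha> g w)"
  unfolding orbit_dist_def using orbit_dist_bdd by (intro cINF_lower) auto

lemma orbit_dist_le_hyp_dist:
  "z \<in> upper_half_plane \<Longrightarrow> w \<in> upper_half_plane \<Longrightarrow> orbit_dist z w \<le> hyp_dist z w"
  using orbit_dist_le[of \<one> z w] act_one by simp

lemma orbit_dist_greatest:
  "(\<And>g. g \<in> carrier \<Gamma> \<Longrightarrow> r \<le> hyp_dist z (\<alpha> g w)) \<Longrightarrow> r \<le> orbit_dist z w"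
  unfolding orbit_dist_def by (rule cINF_greatest) (use one_closed in auto)

lemma orbit_dist_nonneg: "z \<in> upper_half_plane \<Longrightarrow> w \<in> upper_half_plane \<Longrightarrow> orbit_dist z w \<ge> 0"
  using act_closed hyp_dist_nonneg by (intro orbit_dist_greatest) auto

lemma orbit_dist_attained:
  assumes "orbit_dist z w < r"
  shows "\<exists>g\<in>carrier \<Gamma>. hyp_dist z (\<alpha> g w) < r"
  using orbit_dist_greatest[of r z w] assms by force

text \<open>The substitution \<open>g k h\<^sup>-\<^sup>1\<close> for \<open>k\<close> in the infimum.\<close>

lemma orbit_dist_act_le:
  assumes g: "g \<in> carrier \<Gamma>" and h: "h \<in> carrier \<Gamma>" and z: "z \<in> upper_half_plane" and w: "w \<in> upper_half_plane"
  shows "orbit_dist (\<alpha> g z) (\<alpha> h w) \<le> orbit_dist z w"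
proof (rule orbit_dist_greatest)
  fix k assume k: "k \<in> carrier \<Gamma>"
  have "\<alpha> (g \<otimes> k \<otimes> inv h) (\<alpha> h w) = \<alpha> g (\<alpha> k w)"
    using act_mult[of "g \<otimes> k" "inv h" "\<alpha> h w"] act_mult[of g k w] act_inv g h k w act_closed by simp
  then have "orbit_dist (\<alpha> g z) (\<alpha> h w) \<le> hyp_dist (\<alpha> g z) (\<alpha> g (\<alpha> k w))"
    using orbit_dist_le[of "g \<otimes> k \<otimes> inv h" "\<alpha> g z" "\<alpha> h w"] g h k z w act_closed by simp
  also have "\<dots> = hyp_dist z (\<alpha> k w)" using act_isometry g k z w act_closed by simp
  finally show "orbit_dist (\<alpha> g z) (\<alpha> h w) \<le> hyp_dist z (\<alpha> k w)" .
qed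

lemma orbit_dist_act:
  assumes g: "g \<in> carrier \<Gamma>" and h: "h \<in> carrier \<Gamma>" and z: "z \<in> upper_half_plane" and w: "w \<in> upper_half_plane"
  shows "orbit_dist (\<alpha> g z) (\<alpha> h w) = orbit_dist z w"
  using orbit_dist_act_le[OF assms] orbit_dist_act_le[of "inv g" "inv h" "\<alpha> g z" "\<alpha> h w"] assms
  by (simp add: act_inv act_closed)

lemma orbit_dist_commute_le:
  assumes z: "z \<in> upper_half_plane" and w: "w \<in> upper_half_plane"
  shows "orbit_dist z w \<le> orbit_dist w z"
proof (rule orbit_dist_greatest)
  fix g assume g: "g \<in> carrier \<Gamma>"
  have "orbit_dist z w \<le> hyp_dist z (\<alpha> (inv g) w)" using orbit_dist_le g z w by simp
  also have "\<dots> = hyp_dist (\<alpha> g z) (\<alpha> g (\<alpha> (inv g) w))" using act_isometry g z w act_closed by simp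
  also have "\<alpha> g (\<alpha> (inv g) w) = w" using act_inv[of "inv g" w] g w by simp
  finally show "orbit_dist z w \<le> hyp_dist w (\<alpha> g z)" by (simp add: hyp_dist_commute)
qed

lemma orbit_dist_triangle:
  assumes z: "z \<in> upper_half_plane" and w: "w \<in> upper_half_plane" and u: "u \<in> upper_half_plane"
  shows "orbit_dist z u \<le> orbit_dist z w + orbit_dist w u"
proof (rule field_le_epsilon)
  fix e :: real assume e: "e > 0"
  obtain g where g: "g \<in> carrier \<Gamma>" "hyp_dist z (\<alpha> g w) < orbit_dist z w + e / 2"
    using orbit_dist_attained[of z w "orbit_dist z w + e / 2"] e by auto
  obtain h where h: "h \<in> carrier \<Gamma>" "hyp_dist w (\<alpha> h u) < orbit_dist w u + e / 2"
    using orbit_dist_attained[of w u "orbit_dist w u + e / 2"] e by auto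
  have "orbit_dist z u \<le> hyp_dist z (\<alpha> g (\<alpha> h u))"
    using orbit_dist_le[of "g \<otimes> h" z u] act_mult[of g h u] g h z u by simp
  also have "\<dots> \<le> hyp_dist z (\<alpha> g w) + hyp_dist (\<alpha> g w) (\<alpha> g (\<alpha> h u))"
    using g h z w u act_closed by (intro hyp_dist_triangle) auto
  also have "hyp_dist (\<alpha> g w) (\<alpha> g (\<alpha> h u)) = hyp_dist w (\<alpha> h u)"
    using g h w u act_closed act_isometry by auto
  finally show "orbit_dist z u \<le> orbit_dist z w + orbit_dist w u + e" using g h by linarith
qed

lemma surface_dist_rep:
  assumes "z \<in> upper_half_plane" "w \<in> upper_half_plane"
  shows "surface_dist (orbit_rep z) (orbit_rep w) = orbit_dist z w"
proof -
  obtain g h where "g \<in> carrier \<Gamma>" "orbit_rep z = \<alpha> g z" "h \<in> carrier \<Gamma>" "orbit_rep w = \<alpha> h w"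
    using orbit_rep_ex assms by blast
  then show ?thesis using orbit_dist_act assms orbit_rep_mem unfolding surface_dist_def by metis
qed

text \<open>Below half the displacement bound the infimum is attained by the identity, as every other translate of \<open>w\<close> is at distance at least
\<open>\<epsilon>\<close> from \<open>w\<close>. So the quotient map is an isometry on small balls; all facts about lifts rest on this and on \<open>surface_dist_lift\<close>.\<close>

lemma surface_dist_local:
  assumes z: "z \<in> upper_half_plane" and w: "w \<in> upper_half_plane" and near: "hyp_dist z w < \<epsilon> / 2"
  shows "surface_dist (orbit_rep z) (orbit_rep w) = hyp_dist z w"
proof -
  have "hyp_dist z w \<le> orbit_dist z w"
  proof (rule orbit_dist_greatest)
    fix g assume g: "g \<in> carrier \<Gamma>"
    show "hyp_dist z w \<le> hyp_dist z (\<alpha> g w)"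
    proof (cases "g = \<one>")
      case False
      then have "\<epsilon> \<le> hyp_dist w (\<alpha> g w)" using act_free g w by blast
      also have "\<dots> \<le> hyp_dist w z + hyp_dist z (\<alpha> g w)"
        using z w g act_closed by (intro hyp_dist_triangle) auto
      finally show ?thesis using near by (simp add: hyp_dist_commute)
    qed (use w act_one in simp)
  qed
  then show ?thesis using orbit_dist_le_hyp_dist[OF z w] surface_dist_rep[OF z w] by simp
qed

lemma orbit_rep_inj_local:
  assumes "z \<in> upper_half_plane" "w \<in> upper_half_plane" "hyp_dist z w < \<epsilon> / 2" "orbit_rep z = orbit_rep w"
  shows "z = w"
proof -
  have "hyp_dist z w = surface_dist (orbit_rep z) (orbit_rep z)" using surface_dist_local[OF assms(1-3)] assms(4) by simp
  also have "\<dots> = 0"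
    using surface_dist_rep[of z z] orbit_dist_le_hyp_dist[of z z] orbit_dist_nonneg[of z z] assms
      hyp_dist_eq_0_iff[of z z] by simp
  finally show ?thesis using hyp_dist_eq_0_iff assms by blast
qed

lemma surface_dist_lift:
  assumes z: "z \<in> upper_half_plane" and m: "m \<in> surface" and near: "surface_dist (orbit_rep z) m < r"
  shows "\<exists>w\<in>upper_half_plane. orbit_rep w = m \<and> hyp_dist z w < r"
proof -
  obtain w where w: "w \<in> upper_half_plane" "m = orbit_rep w" using m by (auto simp: surface_def)
  have "orbit_dist z w < r" using near w surface_dist_rep z by simp
  then obtain g where "g \<in> carrier \<Gamma>" "hyp_dist z (\<alpha> g w) < r" using orbit_dist_attained by blast
  then show ?thesis using w act_closed orbit_rep_act by metis
qed

sublocale quotient: Metric_space surface surface_dist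
proof
  fix x y
  show "0 \<le> surface_dist x y"
    using surface_subset orbit_dist_nonneg by (auto simp: surface_dist_def)
  show "surface_dist x y = surface_dist y x"
    using surface_subset orbit_dist_commute_le by (auto simp: surface_dist_def intro!: antisym)
  fix x y assume x: "x \<in> surface" and y: "y \<in> surface"
  have xy: "x \<in> upper_half_plane" "y \<in> upper_half_plane" using x y surface_subset by auto
  show "surface_dist x y = 0 \<longleftrightarrow> x = y"
  proof
    assume "surface_dist x y = 0"
    then have "surface_dist (orbit_rep x) y < \<epsilon> / 2" using x orbit_rep_surface \<epsilon>_pos by simp
    then obtain w where w: "w \<in> upper_half_plane" "orbit_rep w = y" "hyp_dist x w < \<epsilon> / 2"
      using surface_dist_lift xy y by blast
    have "hyp_dist x w = 0"
      using surface_dist_local[of x w] w xy x orbit_rep_surface \<open>surface_dist x y = 0\<close> by simp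
    then show "x = y" using w xy hyp_dist_eq_0_iff x orbit_rep_surface by metis
  next
    assume "x = y"
    then show "surface_dist x y = 0"
      using surface_dist_local[of x x] xy x orbit_rep_surface \<epsilon>_pos hyp_dist_eq_0_iff[of x x] by simp
  qed
  fix z assume "z \<in> surface"
  then show "surface_dist x z \<le> surface_dist x y + surface_dist y z"
    using x y surface_subset orbit_dist_triangle[of x y z] by (auto simp: surface_dist_def subset_iff)
qed

lemma continuous_map_orbit_rep:
  assumes F: "continuous_on S F" "F ` S \<subseteq> upper_half_plane"
  shows "continuous_map (top_of_set S) quotient.mtopology (\<lambda>x. orbit_rep (F x))"
  unfolding quotient.continuous_map_to_metric
proof (intro ballI allI impI)
  fix x and e :: real assume x: "x \<in> topspace (top_of_set S)" and e: "e > 0"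
  have xS: "x \<in> S" using x by simp
  have "continuous_on S (\<lambda>y. hyp_dist (F x) (F y))"
    using F xS by (intro continuous_on_hyp_dist) auto
  then have "openin (top_of_set S) (S \<inter> (\<lambda>y. hyp_dist (F x) (F y)) -` {..<e})"
    by (rule continuous_openin_preimage_gen) simp
  moreover have "x \<in> S \<inter> (\<lambda>y. hyp_dist (F x) (F y)) -` {..<e}"
    using xS F e hyp_dist_eq_0_iff[of "F x" "F x"] by auto
  moreover have "orbit_rep (F y) \<in> quotient.mball (orbit_rep (F x)) e"
    if "y \<in> S \<inter> (\<lambda>y. hyp_dist (F x) (F y)) -` {..<e}" for y
  proof -
    have U: "F x \<in> upper_half_plane" "F y \<in> upper_half_plane" using that xS F by auto
    have "surface_dist (orbit_rep (F x)) (orbit_rep (F y)) < e"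
      using surface_dist_rep[OF U] orbit_dist_le_hyp_dist[OF U] that by simp
    then show ?thesis using U orbit_rep_mem by simp
  qed
  ultimately show "\<exists>U. openin (top_of_set S) U \<and> x \<in> U \<and> (\<forall>y\<in>U. orbit_rep (F y) \<in> quotient.mball (orbit_rep (F x)) e)"
    by blast
qed

lemma closed_hyperbolic_surface_quotient: "closed_hyperbolic_surface surface surface_dist"
proof -
  have cont: "continuous_map (top_of_set upper_half_plane) quotient.mtopology orbit_rep"
    using continuous_map_orbit_rep[of upper_half_plane "\<lambda>x. x"] by simp
  have "surface = orbit_rep ` C"
  proof
    show "surface \<subseteq> orbit_rep ` C"
    proof
      fix x assume "x \<in> surface"
      then obtain z where z: "z \<in> upper_half_plane" "x = orbit_rep z" by (auto simp: surface_def)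
      obtain g where g: "g \<in> carrier \<Gamma>" "\<alpha> g z \<in> C" using act_cocompact z by blast
      have "x = orbit_rep (\<alpha> g z)" using orbit_rep_act g z by simp
      with g show "x \<in> orbit_rep ` C" by blast
    qed
    show "orbit_rep ` C \<subseteq> surface" using C_compact orbit_rep_mem by blast
  qed
  moreover have "compactin (top_of_set upper_half_plane) C"
    using C_compact by (simp add: compactin_subtopology)
  ultimately have "compactin quotient.mtopology surface"
    using image_compactin[OF _ cont] by metis
  then have compact: "compact_space quotient.mtopology" by (simp add: compact_space_def)
  have "connectedin (top_of_set upper_half_plane) upper_half_plane"
    by (simp add: connectedin_subtopology convex_connected convex_upper_half_plane)
  then have "connectedin quotient.mtopology (orbit_rep ` upper_half_plane)"
    by (rule connectedin_continuous_map_image[OF cont])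
  then have connected: "connected_space quotient.mtopology"
    by (metis connectedin_topspace quotient.topspace_mtopology surface_def)
  have local_isometry: "\<exists>r>0. \<exists>z\<in>upper_half_plane. \<exists>\<phi>.
      isometry (quotient.mball x r) surface_dist {w \<in> upper_half_plane. hyp_dist z w < r} hyp_dist \<phi>"
    if x: "x \<in> surface" for x
  proof (intro exI bexI conjI)
    define r where "r = \<epsilon> / 4"
    show "r > 0" using \<epsilon>_pos by (simp add: r_def)
    show xU: "x \<in> upper_half_plane" using x surface_subset by blast
    define lift where "lift y = (SOME w. w \<in> upper_half_plane \<and> orbit_rep w = y \<and> hyp_dist x w < r)" for y
    have lift: "lift y \<in> upper_half_plane \<and> orbit_rep (lift y) = y \<and> hyp_dist x (lift y) < r"
      if "y \<in> quotient.mball x r" for y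
    proof -
      have "\<exists>w. w \<in> upper_half_plane \<and> orbit_rep w = y \<and> hyp_dist x w < r"
        using surface_dist_lift[OF xU, of y r] that x orbit_rep_surface by auto
      then show ?thesis unfolding lift_def by (rule someI_ex)
    qed
    have close: "hyp_dist v w < \<epsilon> / 2"
      if "v \<in> upper_half_plane" "w \<in> upper_half_plane" "hyp_dist x v < r" "hyp_dist x w < r" for v w
      using hyp_dist_triangle[of v x w] that xU by (simp add: hyp_dist_commute[of v x] r_def)
    show "isometry (quotient.mball x r) surface_dist {w \<in> upper_half_plane. hyp_dist x w < r} hyp_dist lift"
      unfolding isometry_def
    proof (intro conjI ballI)
      show "lift ` quotient.mball x r = {w \<in> upper_half_plane. hyp_dist x w < r}"
      proof
        show "lift ` quotient.mball x r \<subseteq> {w \<in> upper_half_plane. hyp_dist x w < r}"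
          using lift by blast
        show "{w \<in> upper_half_plane. hyp_dist x w < r} \<subseteq> lift ` quotient.mball x r"
        proof
          fix w assume "w \<in> {w \<in> upper_half_plane. hyp_dist x w < r}"
          then have w: "w \<in> upper_half_plane" "hyp_dist x w < r" by auto
          have "surface_dist x (orbit_rep w) < r"
            using surface_dist_rep[OF xU w(1)] orbit_dist_le_hyp_dist[OF xU w(1)] w(2)
              orbit_rep_surface[OF x] by simp
          then have b: "orbit_rep w \<in> quotient.mball x r" using x w(1) orbit_rep_mem by simp
          note l = lift[OF b]
          have "lift (orbit_rep w) = w"
            by (rule orbit_rep_inj_local) (use l w close in blast)+
          then show "w \<in> lift ` quotient.mball x r" using b by (rule image_eqI[OF sym])
        qed
      qed
    next
      fix y y' assume y: "y \<in> quotient.mball x r" and y': "y' \<in> quotient.mball x r"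
      have "hyp_dist (lift y) (lift y') < \<epsilon> / 2" using lift[OF y] lift[OF y'] close by blast
      then have "surface_dist (orbit_rep (lift y)) (orbit_rep (lift y')) = hyp_dist (lift y) (lift y')"
        using surface_dist_local lift[OF y] lift[OF y'] by blast
      then show "hyp_dist (lift y) (lift y') = surface_dist y y'"
        using lift[OF y] lift[OF y'] by metis
    qed
  qed
  have "surface \<noteq> {}" by (auto simp: surface_def upper_half_plane_def intro: exI[of _ \<i>])
  then show ?thesis
    unfolding closed_hyperbolic_surface_def
    using quotient.Metric_space_axioms compact connected local_isometry by blast
qed

subsection \<open>Lifting to the plane\<close>

text \<open>The distance of two lifts of a path is 0 or at least \<open>\<epsilon> / 2\<close>, and it is continuous.\<close>

lemma lift_unique:
  assumes F: "continuous_on {0..1::real} F" "F ` {0..1} \<subseteq> upper_half_plane"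
    and F': "continuous_on {0..1} F'" "F' ` {0..1} \<subseteq> upper_half_plane"
    and eq: "\<And>t. t \<in> {0..1} \<Longrightarrow> orbit_rep (F t) = orbit_rep (F' t)" and start: "F 0 = F' 0"
  shows "F 1 = F' 1"
proof (rule ccontr)
  assume ne: "F 1 \<noteq> F' 1"
  have U: "F t \<in> upper_half_plane" "F' t \<in> upper_half_plane" if "t \<in> {0..1}" for t using that F F' by auto
  define u where "u t = hyp_dist (F t) (F' t)" for t
  have gap: "u t = 0 \<or> u t \<ge> \<epsilon> / 2" if "t \<in> {0..1}" for t
    using orbit_rep_inj_local[of "F t" "F' t"] U that eq hyp_dist_eq_0_iff[of "F t" "F' t"]
    unfolding u_def by force
  have "continuous_on {0..1} u" unfolding u_def using F F' by (intro continuous_on_hyp_dist)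
  moreover have "u 0 = 0" using U[of 0] start hyp_dist_eq_0_iff[of "F 0" "F' 0"] by (simp add: u_def)
  moreover have "u 1 \<ge> \<epsilon> / 2" using gap[of 1] ne U[of 1] hyp_dist_eq_0_iff[of "F 1" "F' 1"] by (simp add: u_def)
  ultimately obtain t where "0 \<le> t" "t \<le> 1" "u t = \<epsilon> / 4"
    using IVT'[of u 0 "\<epsilon> / 4" 1] \<epsilon>_pos by auto
  then show False using gap[of t] \<epsilon>_pos by auto
qed

text \<open>A lift can be pushed to any map that is close to its projection, by taking the unique nearby preimage. The new lift is
continuous because nearby points of it have the same distance as their images.\<close>

lemma lift_step:
  fixes F :: "'a::real_normed_vector \<Rightarrow> complex"
  assumes F: "continuous_on S F" "F ` S \<subseteq> upper_half_plane"
    and g: "continuous_map (top_of_set S) quotient.mtopology g"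
    and near: "\<And>x. x \<in> S \<Longrightarrow> surface_dist (orbit_rep (F x)) (g x) < \<epsilon> / 4"
  shows "\<exists>F'. continuous_on S F' \<and> F' ` S \<subseteq> upper_half_plane \<and>
    (\<forall>x\<in>S. orbit_rep (F' x) = g x \<and> hyp_dist (F x) (F' x) < \<epsilon> / 4)"
proof -
  have gM: "g x \<in> surface" if "x \<in> S" for x
    using g that unfolding continuous_map_def by auto
  have FU: "F x \<in> upper_half_plane" if "x \<in> S" for x using F that by auto
  have "\<forall>x\<in>S. \<exists>w. w \<in> upper_half_plane \<and> orbit_rep w = g x \<and> hyp_dist (F x) w < \<epsilon> / 4"
    using surface_dist_lift[OF FU gM near] by blast
  then obtain F' where F': "\<And>x. x \<in> S \<Longrightarrow> F' x \<in> upper_half_plane \<and> orbit_rep (F' x) = g x \<and> hyp_dist (F x) (F' x) < \<epsilon> / 4"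
    by metis
  have "continuous_on S F'"
    unfolding continuous_on_iff
  proof (intro ballI allI impI)
    fix x and e :: real assume x: "x \<in> S" and e: "e > 0"
    obtain r where r: "r > 0" "\<And>w. w \<in> upper_half_plane \<Longrightarrow> hyp_dist (F' x) w < r \<Longrightarrow> dist (F' x) w < e"
      using hyp_dist_controls_dist[of "F' x" e] F' x e by metis
    define gap where "gap = \<epsilon> / 4 - hyp_dist (F x) (F' x)"
    have gap: "gap > 0" using F' x by (simp add: gap_def)
    have "continuous_on S (\<lambda>y. hyp_dist (F x) (F y))"
      using F x by (intro continuous_on_hyp_dist) auto
    then obtain d1 where d1: "d1 > 0"
        "\<And>y. y \<in> S \<Longrightarrow> dist y x < d1 \<Longrightarrow> dist (hyp_dist (F x) (F y)) (hyp_dist (F x) (F x)) < gap"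
      using x gap unfolding continuous_on_iff by metis
    obtain U where U: "openin (top_of_set S) U" "x \<in> U" "\<forall>y\<in>U. g y \<in> quotient.mball (g x) r"
      using g x r(1) unfolding quotient.continuous_map_to_metric topspace_euclidean_subtopology by meson
    obtain d2 where d2: "d2 > 0" "\<And>y. y \<in> S \<Longrightarrow> dist y x < d2 \<Longrightarrow> y \<in> U"
      using U(1,2) unfolding openin_euclidean_subtopology_iff by metis
    show "\<exists>d>0. \<forall>x'\<in>S. dist x' x < d \<longrightarrow> dist (F' x') (F' x) < e"
    proof (intro exI[of _ "min d1 d2"] conjI ballI impI)
      show "min d1 d2 > 0" using d1 d2 by simp
      fix y assume y: "y \<in> S" "dist y x < min d1 d2"
      have 1: "hyp_dist (F x) (F y) < gap"
        using d1(2)[of y] y hyp_dist_eq_0_iff[of "F x" "F x"] FU[OF x] by (simp add: dist_real_def)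
      have 2: "surface_dist (g x) (g y) < r" using U(3) d2 y by simp
      have "hyp_dist (F' x) (F' y) \<le> hyp_dist (F' x) (F x) + hyp_dist (F x) (F' y)"
        using F' x y FU by (intro hyp_dist_triangle) auto
      also have "hyp_dist (F x) (F' y) \<le> hyp_dist (F x) (F y) + hyp_dist (F y) (F' y)"
        using F' x y FU by (intro hyp_dist_triangle) auto
      finally have "hyp_dist (F' x) (F' y) < \<epsilon> / 2"
        using 1 F' y x by (force simp: gap_def hyp_dist_commute[of "F' x" "F x"])
      then have "hyp_dist (F' x) (F' y) = surface_dist (g x) (g y)"
        using surface_dist_local[of "F' x" "F' y"] F' x y by simp
      then show "dist (F' y) (F' x) < e" using r(2)[of "F' y"] 2 F' y by (simp add: dist_commute)
    qed
  qed
  then show ?thesis using F' by blast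
qed

text \<open>A map from a convex compact set is lifted along the homotopy that contracts the set to the base point:
by compactness finitely many short steps suffice. Intervals give the lifting of paths, and squares the lifting of
homotopies.\<close>

lemma lift_exists:
  fixes K :: "'a::real_normed_vector set"
  assumes K: "compact K" "convex K" "c \<in> K"
    and f: "continuous_map (top_of_set K) quotient.mtopology f"
    and z: "z \<in> upper_half_plane" "orbit_rep z = f c"
  shows "\<exists>F. continuous_on K F \<and> F ` K \<subseteq> upper_half_plane \<and> (\<forall>x\<in>K. orbit_rep (F x) = f x) \<and> F c = z"
proof -
  have fM: "f x \<in> surface" if "x \<in> K" for x
    using f that unfolding continuous_map_def by auto
  let ?G = "{T. open T \<and> (\<exists>m. f ` (K \<inter> T) \<subseteq> quotient.mball m (\<epsilon> / 8))}"
  have e8: "\<epsilon> / 8 > 0" using \<epsilon>_pos by simp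
  have cover: "K \<subseteq> \<Union>?G"
  proof
    fix x assume x: "x \<in> K"
    obtain U where U: "openin (top_of_set K) U" "x \<in> U" "\<forall>y\<in>U. f y \<in> quotient.mball (f x) (\<epsilon> / 8)"
      using f x e8 unfolding quotient.continuous_map_to_metric topspace_euclidean_subtopology by meson
    then obtain T where "open T" "U = K \<inter> T" by (auto simp: openin_open)
    with U x show "x \<in> \<Union>?G" by blast
  qed
  obtain \<delta> where \<delta>: "\<delta> > 0" "\<And>x. x \<in> K \<Longrightarrow> \<exists>T\<in>?G. ball x \<delta> \<subseteq> T"
    by (rule Heine_Borel_lemma[OF K(1) cover]) auto
  have near: "surface_dist (f x) (f y) < \<epsilon> / 4" if xy: "x \<in> K" "y \<in> K" "dist x y < \<delta>" for x y
  proof -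
    obtain T m where T: "ball x \<delta> \<subseteq> T" "f ` (K \<inter> T) \<subseteq> quotient.mball m (\<epsilon> / 8)" using \<delta>(2)[OF xy(1)] by blast
    have "x \<in> T" "y \<in> T" using T xy \<delta> by auto
    then have "f x \<in> quotient.mball m (\<epsilon> / 8)" "f y \<in> quotient.mball m (\<epsilon> / 8)" using T xy by auto
    then show ?thesis using quotient.triangle[of "f x" m "f y"] quotient.commute[of "f x" m] by auto
  qed
  obtain B where B: "\<And>x. x \<in> K \<Longrightarrow> norm (x - c) \<le> B" "B > 0"
  proof -
    have "bounded ((\<lambda>x. x - c) ` K)"
      using K by (intro compact_imp_bounded compact_continuous_image continuous_intros)
    then show ?thesis using that unfolding bounded_pos by auto
  qed
  obtain m :: nat where m: "B / \<delta> < real m" using reals_Archimedean2 by blast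
  have "m > 0" using m B \<delta> by (metis divide_pos_pos gr0I not_less_iff_gr_or_eq of_nat_0 order_less_trans)
  \<comment> \<open>The \<open>k\<close>-th of \<open>m\<close> stages of the contraction; consecutive stages are closer than the Lebesgue number \<open>\<delta>\<close>.\<close>
  define s where "s k x = c + (real k / real m) *\<^sub>R (x - c)" for k x
  have sK: "s k x \<in> K" if "k \<le> m" "x \<in> K" for k x
  proof -
    have "s k x = (1 - real k / real m) *\<^sub>R c + (real k / real m) *\<^sub>R x" by (simp add: s_def algebra_simps)
    then show ?thesis using K that \<open>m > 0\<close> by (auto intro!: convexD)
  qed
  have "\<exists>F. continuous_on K F \<and> F ` K \<subseteq> upper_half_plane \<and> (\<forall>x\<in>K. orbit_rep (F x) = f (s k x)) \<and> F c = z"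
    if "k \<le> m" for k
    using that
  proof (induction k)
    case 0
    show ?case using z by (intro exI[of _ "\<lambda>_. z"]) (auto simp: s_def)
  next
    case (Suc k)
    then obtain F where F: "continuous_on K F" "F ` K \<subseteq> upper_half_plane" "\<And>x. x \<in> K \<Longrightarrow> orbit_rep (F x) = f (s k x)" "F c = z"
      by auto
    have cs: "continuous_map (top_of_set K) (top_of_set K) (s (Suc k))"
      using sK[OF Suc.prems] unfolding s_def
      by (auto simp: continuous_map_in_subtopology intro!: continuous_intros)
    have g: "continuous_map (top_of_set K) quotient.mtopology (\<lambda>x. f (s (Suc k) x))"
      using continuous_map_compose[OF cs f] by (simp add: o_def)
    have "surface_dist (orbit_rep (F x)) (f (s (Suc k) x)) < \<epsilon> / 4" if x: "x \<in> K" for x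
    proof -
      have "s (Suc k) x - s k x = (1 / real m) *\<^sub>R (x - c)"
        by (simp add: s_def add_divide_distrib scaleR_add_left)
      then have "dist (s k x) (s (Suc k) x) = norm (x - c) / m"
        by (metis dist_commute dist_norm norm_scaleR abs_of_nonneg divide_inverse mult.commute mult_1
            of_nat_0_le_iff zero_le_divide_1_iff)
      also have "\<dots> \<le> B / m" using B x by (simp add: divide_right_mono)
      also have "\<dots> < \<delta>" using m \<delta> \<open>m > 0\<close> by (simp add: field_simps)
      finally show ?thesis using near sK Suc.prems x F(3) by simp
    qed
    then obtain F' where F': "continuous_on K F'" "F' ` K \<subseteq> upper_half_plane"
        "\<And>x. x \<in> K \<Longrightarrow> orbit_rep (F' x) = f (s (Suc k) x) \<and> hyp_dist (F x) (F' x) < \<epsilon> / 4"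
      using lift_step[OF F(1,2) g] by metis
    have "orbit_rep (F' c) = f c" "hyp_dist z (F' c) < \<epsilon> / 4" "F' c \<in> upper_half_plane"
      using F'(2) F'(3)[OF K(3)] F(4) K(3) by (auto simp: s_def)
    then have "z = F' c" using z \<epsilon>_pos orbit_rep_inj_local[of z "F' c"] by simp
    then have "F' c = z" by simp
    with F' show ?case by (intro exI[of _ F'] conjI ballI) auto
  qed
  moreover have "s m x = x" for x using \<open>m > 0\<close> by (simp add: s_def)
  ultimately show ?thesis by (metis order_refl)
qed

subsection \<open>The fundamental group\<close>

abbreviation base :: complex where "base \<equiv> orbit_rep \<i>"

lemma i_upper: "\<i> \<in> upper_half_plane"
  by (simp add: upper_half_plane_def)

abbreviation loops :: "(real \<Rightarrow> complex) set" where
  "loops \<equiv> based_loops quotient.mtopology base"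

abbreviation homotopy :: "((real \<Rightarrow> complex) \<times> (real \<Rightarrow> complex)) set" where
  "homotopy \<equiv> loop_homotopy quotient.mtopology base"

text \<open>Loops are functions on all real numbers, of which only the values on the unit interval matter.\<close>

definition lifts_to :: "(real \<Rightarrow> complex) \<Rightarrow> (real \<Rightarrow> complex) \<Rightarrow> bool" where
  "lifts_to f F \<longleftrightarrow> continuous_on {0..1} F \<and> F ` {0..1} \<subseteq> upper_half_plane \<and>
     (\<forall>t\<in>{0..1}. orbit_rep (F t) = f t)"

text \<open>The monodromy of a loop: the lift that starts at \<open>\<i>\<close> ends at the translate of \<open>\<i>\<close> by a unique group element.\<close>

definition ends_at :: "(real \<Rightarrow> complex) \<Rightarrow> 'g \<Rightarrow> bool" where
  "ends_at f g \<longleftrightarrow> (\<exists>F. lifts_to f F \<and> F 0 = \<i> \<and> F 1 = \<alpha> g \<i>)"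

lemma lifts_to_unique: "lifts_to f F \<Longrightarrow> lifts_to f F' \<Longrightarrow> F 0 = F' 0 \<Longrightarrow> F 1 = F' 1"
  unfolding lifts_to_def by (rule lift_unique) auto

lemma act_inj: "g \<in> carrier \<Gamma> \<Longrightarrow> h \<in> carrier \<Gamma> \<Longrightarrow> \<alpha> g \<i> = \<alpha> h \<i> \<Longrightarrow> g = h"
proof -
  assume g: "g \<in> carrier \<Gamma>" and h: "h \<in> carrier \<Gamma>" and eq: "\<alpha> g \<i> = \<alpha> h \<i>"
  have "\<alpha> (inv h \<otimes> g) \<i> = \<i>" using act_mult[of "inv h" g \<i>] act_inv[of h \<i>] g h eq i_upper by simp
  then have "inv h \<otimes> g = \<one>"
    using act_free[of "inv h \<otimes> g" \<i>] g h i_upper \<epsilon>_pos hyp_dist_eq_0_iff[of \<i> \<i>] by fastforce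
  then show "g = h" using g h by (metis inv_closed inv_equality inv_inv)
qed

lemma ends_at_unique:
  assumes "ends_at f g" "ends_at f h" "g \<in> carrier \<Gamma>" "h \<in> carrier \<Gamma>"
  shows "g = h"
proof -
  obtain F F' where "lifts_to f F" "F 0 = \<i>" "F 1 = \<alpha> g \<i>" "lifts_to f F'" "F' 0 = \<i>" "F' 1 = \<alpha> h \<i>"
    using assms(1,2) unfolding ends_at_def by blast
  then show ?thesis using lifts_to_unique[of f F F'] act_inj assms(3,4) by simp
qed

lemma ends_at_exists:
  assumes f: "f \<in> loops"
  shows "\<exists>g\<in>carrier \<Gamma>. ends_at f g"
proof -
  have "continuous_map (top_of_set {0..1}) quotient.mtopology f" "orbit_rep \<i> = f 0"
    using f by (auto simp: based_loops_def pathin_def)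
  then obtain F where F: "continuous_on {0..1} F" "F ` {0..1} \<subseteq> upper_half_plane"
      "\<forall>x\<in>{0..1}. orbit_rep (F x) = f x" "F 0 = \<i>"
    using lift_exists[of "{0..1}" 0 f \<i>] i_upper by auto
  have "orbit_rep \<i> = orbit_rep (F 1)" using F(3) f by (auto simp: based_loops_def)
  moreover have "F 1 \<in> upper_half_plane" using F(2) by auto
  ultimately obtain g where "g \<in> carrier \<Gamma>" "F 1 = \<alpha> g \<i>" using orbit_rep_eqD[of \<i> "F 1"] i_upper by blast
  then show ?thesis using F unfolding ends_at_def lifts_to_def by blast
qed

lemma lifts_to_end_points: "lifts_to f F \<Longrightarrow> f 0 = orbit_rep (F 0) \<and> f 1 = orbit_rep (F 1)"
  by (simp add: lifts_to_def)

lemma lifts_to_loop: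
  assumes "lifts_to f F" "F 0 = \<i>" "F 1 = \<alpha> g \<i>" "g \<in> carrier \<Gamma>"
  shows "f \<in> loops"
proof -
  have "continuous_map (top_of_set {0..1}) quotient.mtopology (\<lambda>t. orbit_rep (F t))"
    using assms by (intro continuous_map_orbit_rep) (auto simp: lifts_to_def)
  then have "continuous_map (top_of_set {0..1}) quotient.mtopology f"
    by (rule continuous_map_eq) (use assms in \<open>auto simp: lifts_to_def\<close>)
  moreover have "f 0 = orbit_rep (F 0)" "f 1 = orbit_rep (F 1)"
    using lifts_to_end_points[OF assms(1)] by auto
  ultimately show ?thesis
    using assms i_upper orbit_rep_act by (simp add: based_loops_def pathin_def)
qed

lemma ends_at_loop_exists:
  assumes g: "g \<in> carrier \<Gamma>"
  shows "\<exists>f\<in>loops. ends_at f g"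
proof -
  let ?F = "linepath \<i> (\<alpha> g \<i>)"
  have "?F ` {0..1} \<subseteq> upper_half_plane"
    using convex_upper_half_plane i_upper act_closed[OF g i_upper]
    by (metis closed_segment_subset linepath_image_01)
  then have "lifts_to (\<lambda>t. orbit_rep (?F t)) ?F"
    by (simp add: lifts_to_def continuous_on_linepath)
  moreover have "?F 0 = \<i>" "?F 1 = \<alpha> g \<i>" by (simp_all add: linepath_def)
  ultimately show ?thesis using lifts_to_loop g unfolding ends_at_def by blast
qed

text \<open>The half plane is convex, so two paths with common end points are joined by a straight line homotopy.\<close>

lemma ends_at_homotopic:
  assumes f: "f \<in> loops" "ends_at f g" and f': "f' \<in> loops" "ends_at f' g" and g: "g \<in> carrier \<Gamma>"
  shows "(f, f') \<in> homotopy"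
proof -
  obtain F where F: "lifts_to f F" "F 0 = \<i>" "F 1 = \<alpha> g \<i>" using f(2) unfolding ends_at_def by blast
  obtain F' where F': "lifts_to f' F'" "F' 0 = \<i>" "F' 1 = \<alpha> g \<i>" using f'(2) unfolding ends_at_def by blast
  define H where "H = (\<lambda>p. (1 - fst p) *\<^sub>R F (snd p) + fst p *\<^sub>R F' (snd p))"
  \<comment> \<open>A homotopy has to agree with the loops on all real numbers, also where the lifts say nothing.\<close>
  define h where "h = (\<lambda>p. if snd p \<in> {0..1} then orbit_rep (H p) else if fst p = 0 then f (snd p) else f' (snd p))"
  let ?S = "{0..1::real} \<times> {0..1::real}"
  have "continuous_on ?S (\<lambda>p. G (snd p))" if "continuous_on {0..1} G" for G :: "real \<Rightarrow> complex"
    by (rule continuous_on_compose2[OF that continuous_on_snd[OF continuous_on_id]]) auto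
  then have "continuous_on ?S (\<lambda>p. F (snd p))" "continuous_on ?S (\<lambda>p. F' (snd p))"
    using F(1) F'(1) unfolding lifts_to_def by blast+
  then have "continuous_on ?S H" unfolding H_def by (intro continuous_intros)
  moreover have "H ` ?S \<subseteq> upper_half_plane"
  proof
    fix w assume "w \<in> H ` ?S"
    then obtain s t where st: "s \<in> {0..1}" "t \<in> {0..1}" "w = H (s, t)" by auto
    have "F t \<in> upper_half_plane" "F' t \<in> upper_half_plane"
      using F(1) F'(1) st unfolding lifts_to_def by auto
    then show "w \<in> upper_half_plane" using st convex_upper_half_plane
      by (auto simp: H_def intro!: convexD)
  qed
  ultimately have "continuous_map (top_of_set ?S) quotient.mtopology (\<lambda>p. orbit_rep (H p))"
    by (rule continuous_map_orbit_rep)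
  then have "continuous_map (top_of_set ?S) quotient.mtopology h"
    by (rule continuous_map_eq) (auto simp: h_def)
  then have cont: "continuous_map (prod_topology (top_of_set {0..1}) (top_of_set {0..1})) quotient.mtopology h"
    by (simp add: prod_topology_subtopology_eu)
  have "homotopic_with (\<lambda>h. h 0 = base \<and> h 1 = base) (top_of_set {0..1}) quotient.mtopology f f'"
    unfolding homotopic_with_def
  proof (intro exI[of _ h] conjI allI ballI)
    show "continuous_map (prod_topology (top_of_set {0..1}) (top_of_set {0..1})) quotient.mtopology h" by (rule cont)
    fix x :: real
    show "h (0, x) = f x" using F(1) by (auto simp: h_def H_def lifts_to_def)
    show "h (1, x) = f' x" using F'(1) by (auto simp: h_def H_def lifts_to_def)
  next
    fix s :: real
    have line: "(1 - s) *\<^sub>R z + s *\<^sub>R z = z" for z :: complex by (simp add: algebra_simps)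
    show "h (s, 0) = base" using F(2) F'(2) line[of \<i>] by (simp add: h_def H_def)
    have "H (s, 1) = \<alpha> g \<i>" unfolding H_def using F(3) F'(3) line by simp
    then show "h (s, 1) = base" using orbit_rep_act g i_upper by (simp add: h_def)
  qed
  then show ?thesis using f(1) f'(1) by (simp add: loop_homotopy_def)
qed

text \<open>The homotopy is lifted to the square. The sides of the square over the base point are constant, because a constant path
has a constant lift; so the lifts of the two loops have the same end points.\<close>

lemma homotopic_ends_at:
  assumes hom: "(f, f') \<in> homotopy" and e: "ends_at f g"
  shows "ends_at f' g"
proof -
  obtain h :: "real \<times> real \<Rightarrow> complex" where
      h: "continuous_map (prod_topology (top_of_set {0..1}) (top_of_set {0..1})) quotient.mtopology h"
      "\<And>x. h (0, x) = f x" "\<And>x. h (1, x) = f' x"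
      "\<And>s. s \<in> {0..1} \<Longrightarrow> h (s, 0) = base \<and> h (s, 1) = base"
    using hom unfolding loop_homotopy_def homotopic_with_def by blast
  let ?S = "{0..1::real} \<times> {0..1::real}"
  have "continuous_map (top_of_set ?S) quotient.mtopology h"
    using h(1) by (simp add: prod_topology_subtopology_eu)
  moreover have "orbit_rep \<i> = h (0, 0)" using h(4)[of 0] by simp
  moreover have "compact ?S" "convex ?S" by (auto intro: compact_Times convex_Times)
  ultimately obtain H where H: "continuous_on ?S H" "H ` ?S \<subseteq> upper_half_plane"
      "\<And>p. p \<in> ?S \<Longrightarrow> orbit_rep (H p) = h p" "H (0, 0) = \<i>"
    using lift_exists[of ?S "(0, 0)" h \<i>] i_upper by auto
  have side: "continuous_on {0..1} (\<lambda>t. H (u t))" "(\<lambda>t. H (u t)) ` {0..1} \<subseteq> upper_half_plane"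
    if "continuous_on {0..1} u" "u ` {0..1} \<subseteq> ?S" for u
    using continuous_on_compose2[OF H(1) that] H(2) that(2) by auto
  have edge: "lifts_to k (\<lambda>t. H (u t))"
    if u: "continuous_on {0..1} u" "u ` {0..1} \<subseteq> ?S" and k: "\<And>t. t \<in> {0..1} \<Longrightarrow> h (u t) = k t" for u k
    unfolding lifts_to_def
  proof (intro conjI ballI)
    fix t :: real assume t: "t \<in> {0..1}"
    then have "u t \<in> ?S" using u(2) by blast
    then show "orbit_rep (H (u t)) = k t" using H(3) k[OF t] by simp
  qed (use side[OF u] in auto)
  have left: "lifts_to f (\<lambda>t. H (0, t))" by (rule edge) (auto intro!: continuous_intros simp: h)
  have right: "lifts_to f' (\<lambda>t. H (1, t))" by (rule edge) (auto intro!: continuous_intros simp: h)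
  have bottom: "lifts_to (\<lambda>_. base) (\<lambda>s. H (s, 0))" by (rule edge) (auto intro!: continuous_intros simp: h)
  have top: "lifts_to (\<lambda>_. base) (\<lambda>s. H (s, 1))" by (rule edge) (auto intro!: continuous_intros simp: h)
  have const: "lifts_to (\<lambda>_. base) (\<lambda>_. z)" if "z \<in> upper_half_plane" "orbit_rep z = base" for z
    using that by (auto simp: lifts_to_def)
  have "H (1, 0) = \<i>"
    using lifts_to_unique[OF bottom const[of \<i>]] H(4) i_upper by simp
  have "H (0, 1) \<in> upper_half_plane" "orbit_rep (H (0, 1)) = base" using H(2,3) h(4)[of 0] by auto
  then have "H (1, 1) = H (0, 1)"
    using lifts_to_unique[OF top const[of "H (0, 1)"]] by simp
  moreover obtain F where "lifts_to f F" "F 0 = \<i>" "F 1 = \<alpha> g \<i>" using e unfolding ends_at_def by blast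
  then have "H (0, 1) = \<alpha> g \<i>" using lifts_to_unique[OF left] H(4) by simp
  ultimately show ?thesis using right \<open>H (1, 0) = \<i>\<close> unfolding ends_at_def by metis
qed

text \<open>The second lift is translated by \<open>g\<close> so that it starts where the first one ends.\<close>

lemma ends_at_concat:
  assumes f: "ends_at f g" and f': "ends_at f' h" and g: "g \<in> carrier \<Gamma>" and h: "h \<in> carrier \<Gamma>"
  shows "loop_concat f f' \<in> loops \<and> ends_at (loop_concat f f') (g \<otimes> h)"
proof -
  obtain F where F: "lifts_to f F" "F 0 = \<i>" "F 1 = \<alpha> g \<i>" using f unfolding ends_at_def by blast
  obtain F' where F': "lifts_to f' F'" "F' 0 = \<i>" "F' 1 = \<alpha> h \<i>" using f' unfolding ends_at_def by blast
  define H where "H = (\<lambda>t. if t \<le> 1/2 then F (2 * t) else \<alpha> g (F' (2 * t - 1)))"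
  have FU: "F t \<in> upper_half_plane" "F' t \<in> upper_half_plane" if "t \<in> {0..1}" for t
    using F(1) F'(1) that unfolding lifts_to_def by auto
  have cont_act: "continuous_on upper_half_plane (\<alpha> g)"
    unfolding continuous_on_iff
  proof (intro ballI allI impI)
    fix x and e :: real assume x: "x \<in> upper_half_plane" and e: "e > 0"
    obtain r where r: "r > 0" "\<And>w. w \<in> upper_half_plane \<Longrightarrow> hyp_dist (\<alpha> g x) w < r \<Longrightarrow> dist (\<alpha> g x) w < e"
      using hyp_dist_controls_dist[OF act_closed[OF g x] e] by metis
    have "continuous_on upper_half_plane (hyp_dist x)"
      using x by (intro continuous_on_hyp_dist) auto
    then obtain d where d: "d > 0"
        "\<And>y. y \<in> upper_half_plane \<Longrightarrow> dist y x < d \<Longrightarrow> dist (hyp_dist x y) (hyp_dist x x) < r"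
      using x r(1) unfolding continuous_on_iff by metis
    have "dist (\<alpha> g y) (\<alpha> g x) < e" if y: "y \<in> upper_half_plane" "dist y x < d" for y
    proof -
      have "hyp_dist x y < r" using d(2)[OF y] hyp_dist_eq_0_iff[of x x] x by (simp add: dist_real_def)
      then show ?thesis using r(2)[of "\<alpha> g y"] act_isometry[OF g x y(1)] act_closed g y by (simp add: dist_commute)
    qed
    then show "\<exists>d>0. \<forall>x'\<in>upper_half_plane. dist x' x < d \<longrightarrow> dist (\<alpha> g x') (\<alpha> g x) < e"
      using d(1) by blast
  qed
  have "continuous_on ({0..1/2} \<union> {1/2..1}) (\<lambda>t::real. if t \<le> 1/2 then F (2 * t) else \<alpha> g (F' (2 * t - 1)))"
  proof (rule continuous_on_If)
    show "continuous_on {0..1/2} (\<lambda>t::real. F (2 * t))"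
      using F(1) unfolding lifts_to_def
      by (intro continuous_on_compose2[of "{0..1}" F _ "\<lambda>t. 2 * t"] continuous_intros) auto
    have "continuous_on {1/2..1} (\<lambda>t::real. F' (2 * t - 1))"
      using F'(1) unfolding lifts_to_def
      by (intro continuous_on_compose2[of "{0..1}" F' _ "\<lambda>t. 2 * t - 1"] continuous_intros) auto
    then show "continuous_on {1/2..1} (\<lambda>t::real. \<alpha> g (F' (2 * t - 1)))"
      by (rule continuous_on_compose2[OF cont_act]) (auto intro!: FU(2))
    fix t :: real
    show "F (2 * t) = \<alpha> g (F' (2 * t - 1))" if "t \<in> {1/2..1}" "t \<le> 1/2"
    proof -
      have "2 * t = 1" using that by simp
      then show ?thesis using F(3) F'(2) by (simp only: cancel_comm_monoid_add_class.diff_cancel)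
    qed
    show "F (2 * t) = \<alpha> g (F' (2 * t - 1))" if "t \<in> {0..1/2}" "\<not> t \<le> 1/2"
      using that by simp
  qed auto
  moreover have "{0..1/2} \<union> {1/2..1::real} = {0..1}" by auto
  ultimately have "continuous_on {0..1} H" by (simp add: H_def)
  moreover have "H ` {0..1} \<subseteq> upper_half_plane"
    using FU act_closed[OF g] by (auto simp: H_def)
  moreover have "orbit_rep (H t) = loop_concat f f' t" if "t \<in> {0..1}" for t
    using F(1) F'(1) that orbit_rep_act[OF g FU(2)[of "2 * t - 1"]]
    by (auto simp: H_def loop_concat_def lifts_to_def)
  ultimately have "lifts_to (loop_concat f f') H" by (simp add: lifts_to_def)
  moreover have "H 0 = \<i>" "H 1 = \<alpha> (g \<otimes> h) \<i>"
    using F F' act_mult[OF g h i_upper] by (simp_all add: H_def)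
  ultimately show ?thesis using lifts_to_loop[of "loop_concat f f'" H "g \<otimes> h"] g h unfolding ends_at_def by blast
qed

definition deck_class :: "'g \<Rightarrow> (real \<Rightarrow> complex) set" where
  "deck_class g = {f \<in> loops. ends_at f g}"

lemma homotopy_class:
  assumes f: "f \<in> loops" "ends_at f g" and g: "g \<in> carrier \<Gamma>"
  shows "homotopy `` {f} = deck_class g"
proof
  show "homotopy `` {f} \<subseteq> deck_class g"
    using homotopic_ends_at f by (auto simp: deck_class_def loop_homotopy_def)
  show "deck_class g \<subseteq> homotopy `` {f}"
    using ends_at_homotopic f g by (auto simp: deck_class_def)
qed

lemma deck_class_iso: "deck_class \<in> iso \<Gamma> (fundamental_group quotient.mtopology base)"
proof (rule isoI)
  have nonempty: "\<exists>f. f \<in> deck_class g" if "g \<in> carrier \<Gamma>" for g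
    using ends_at_loop_exists that by (auto simp: deck_class_def)
  have mem: "deck_class g \<in> loops // homotopy" if g: "g \<in> carrier \<Gamma>" for g
  proof -
    obtain f where f: "f \<in> loops" "ends_at f g" using ends_at_loop_exists g by blast
    then show ?thesis using homotopy_class[OF f g] quotientI by metis
  qed
  show "deck_class \<in> hom \<Gamma> (fundamental_group quotient.mtopology base)"
  proof (rule homI)
    fix g assume "g \<in> carrier \<Gamma>"
    then show "deck_class g \<in> carrier (fundamental_group quotient.mtopology base)"
      using mem by (simp add: fundamental_group_def)
  next
    fix g h assume g: "g \<in> carrier \<Gamma>" and h: "h \<in> carrier \<Gamma>"
    have "homotopy `` {loop_concat p q} = deck_class (g \<otimes> h)"
      if "p \<in> deck_class g" "q \<in> deck_class h" for p q
      using ends_at_concat[of p g q h] that g h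
      by (intro homotopy_class) (auto simp: deck_class_def)
    then have "(\<Union>p\<in>deck_class g. \<Union>q\<in>deck_class h. homotopy `` {loop_concat p q}) = deck_class (g \<otimes> h)"
      using nonempty[OF g] nonempty[OF h] by blast
    then show "deck_class (g \<otimes> h) =
        deck_class g \<otimes>\<^bsub>fundamental_group quotient.mtopology base\<^esub> deck_class h"
      by (simp add: fundamental_group_def)
  qed
  show "bij_betw deck_class (carrier \<Gamma>) (carrier (fundamental_group quotient.mtopology base))"
    unfolding bij_betw_def
  proof
    show "inj_on deck_class (carrier \<Gamma>)"
    proof (rule inj_onI)
      fix g h assume g: "g \<in> carrier \<Gamma>" and h: "h \<in> carrier \<Gamma>" and eq: "deck_class g = deck_class h"
      obtain f where "f \<in> deck_class g" using nonempty g by blast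
      then show "g = h" using eq g h ends_at_unique by (auto simp: deck_class_def)
    qed
    have "X \<in> deck_class ` carrier \<Gamma>" if X: "X \<in> loops // homotopy" for X
    proof -
      obtain f where f: "f \<in> loops" "X = homotopy `` {f}" using X by (blast elim: quotientE)
      obtain g where "g \<in> carrier \<Gamma>" "ends_at f g" using ends_at_exists f by blast
      then show ?thesis using homotopy_class f by blast
    qed
    then show "deck_class ` carrier \<Gamma> = carrier (fundamental_group quotient.mtopology base)"
      using mem by (auto simp: fundamental_group_def)
  qed
qed

theorem is_surface_group: "surface_group \<Gamma>"
  unfolding surface_group_def
  using is_group closed_hyperbolic_surface_quotient deck_class_iso is_isoI orbit_rep_mem[OF i_upper] by blast

end

section \<open>The tiling by right-angled polygons\<close>

text \<open>The bounds on the indices belong to the relation, so that adjacent letters are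
letters of the cycle.\<close>

definition cyc_adj :: "nat \<Rightarrow> nat \<Rightarrow> nat \<Rightarrow> bool" where
  "cyc_adj n i j \<longleftrightarrow> i < n \<and> j < n \<and> (j = Suc i mod n \<or> i = Suc j mod n)"

lemma cyc_adj_cases:
  "n \<ge> 3 \<Longrightarrow> cyc_adj n i j \<longleftrightarrow> i < n \<and> j < n \<and> (j = Suc i \<or> i = Suc j \<or> (i = 0 \<and> Suc j = n) \<or> (j = 0 \<and> Suc i = n))"
  by (auto simp: cyc_adj_def mod_Suc)

locale right_angled_polygon =
  fixes n :: nat
  assumes n_ge: "n \<ge> 5"
begin

sublocale commutation_graph "{..<n}" "cyc_adj n"
  using n_ge by unfold_locales (auto simp: cyc_adj_cases)

lemma no_triangle: "cyc_adj n i j \<Longrightarrow> cyc_adj n j k \<Longrightarrow> \<not> cyc_adj n i k"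
  using n_ge by (auto simp: cyc_adj_cases)

text \<open>The outer normals of the sides of a regular polygon centred at the lowest point of the hyperboloid. The lengths \<open>rad\<close> and \<open>ht\<close> of
their horizontal and vertical parts are determined by having norm 1 and by the right angle between neighbouring sides; they exist since
the cosine of \<open>2 \<pi> / n\<close> is positive for \<open>n \<ge> 5\<close>.\<close>

definition cosn :: real where "cosn = cos (2 * pi / n)"
definition rad :: real where "rad = 1 / sqrt (1 - cosn)"
definition ht :: real where "ht = sqrt (cosn / (1 - cosn))"
definition wall :: "nat \<Rightarrow> real \<times> real \<times> real" where
  "wall i = (rad * cos (2 * pi * i / n), rad * sin (2 * pi * i / n), ht)"

lemma cosn_bounds: "0 < cosn" "cosn < 1"
proof -
  have "2 * pi / n \<le> 2 * pi / 5" using n_ge by (intro divide_left_mono) auto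
  also have "\<dots> < pi / 2" by simp
  finally have "2 * pi / n < pi / 2" .
  moreover have "0 < 2 * pi / n" using n_ge by simp
  ultimately show "0 < cosn" unfolding cosn_def by (intro cos_gt_zero) auto
  have "cos (2 * pi / n) < cos 0"
    using \<open>0 < 2 * pi / n\<close> \<open>2 * pi / n < pi / 2\<close> by (intro cos_monotone_0_pi) auto
  then show "cosn < 1" by (simp add: cosn_def)
qed

lemma rad_ht_squares: "rad * rad = 1 / (1 - cosn)" "ht * ht = cosn / (1 - cosn)" "rad > 0" "ht > 0"
  using cosn_bounds by (auto simp: rad_def ht_def)

lemma mink_wall: "mink (wall i) (wall j) = (cos (2 * pi * (real i - real j) / n) - cosn) / (1 - cosn)"
proof -
  have "mink (wall i) (wall j) = rad * rad * cos (2 * pi * i / n - 2 * pi * j / n) - ht * ht"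
    by (simp add: mink_def wall_def cos_diff algebra_simps)
  also have "2 * pi * i / n - 2 * pi * j / n = 2 * pi * (real i - real j) / n"
    by (simp add: diff_divide_distrib algebra_simps)
  finally show ?thesis by (simp add: rad_ht_squares diff_divide_distrib)
qed

lemma mink_wall_self: "mink (wall i) (wall i) = 1"
  using cosn_bounds by (simp add: mink_wall)

lemma cos_wrap: "k \<le> n \<Longrightarrow> cos (2 * pi * real (n - k) / n) = cos (2 * pi * real k / n)"
proof -
  assume "k \<le> n"
  then have "2 * pi * real (n - k) / n = 2 * pi - 2 * pi * real k / n"
    using n_ge by (simp add: of_nat_diff field_simps)
  then show ?thesis by (simp add: cos_diff)
qed

lemma cos_abs_diff: "cos (2 * pi * (real i - real j) / n) = cos (2 * pi * real (nat \<bar>int i - int j\<bar>) / n)"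
proof -
  have "\<bar>2 * pi * (real i - real j) / n\<bar> = 2 * pi * real (nat \<bar>int i - int j\<bar>) / n"
    by (simp add: abs_mult)
  then show ?thesis by (metis cos_abs_real)
qed

lemma mink_wall_adj: "cyc_adj n i j \<Longrightarrow> mink (wall i) (wall j) = 0"
proof -
  assume "cyc_adj n i j"
  then have "nat \<bar>int i - int j\<bar> = 1 \<or> nat \<bar>int i - int j\<bar> = n - 1"
    using n_ge by (auto simp: cyc_adj_cases)
  moreover have "cos (2 * pi * real 1 / n) = cosn" "cos (2 * pi * real (n - 1) / n) = cosn"
    using cos_wrap[of 1] n_ge by (auto simp: cosn_def)
  ultimately have "cos (2 * pi * (real i - real j) / n) = cosn"
    unfolding cos_abs_diff by metis
  then show ?thesis by (simp add: mink_wall)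
qed

text \<open>For sides that are not neighbours the angle between the horizontal parts is at least \<open>4 \<pi> / n\<close>, and the cosine of that
is given by the double angle formula. A product below \<open>-1\<close> means that the two lines are ultraparallel.\<close>

lemma mink_wall_opposed:
  assumes ij: "i < n" "j < n" "opposed i j"
  shows "mink (wall i) (wall j) \<le> - (1 + 2 * cosn)"
proof -
  have le: "cos (2 * pi * real k / n) \<le> cos (2 * (2 * pi / n))" if k: "2 \<le> k" "2 * k \<le> n" for k
  proof (rule cos_monotone_0_pi_le)
    show "2 * (2 * pi / n) \<le> 2 * pi * real k / n"
      using k by (simp add: divide_right_mono)
    have "2 * pi * real k / n \<le> pi * n / n"
      using k by (intro divide_right_mono) (auto simp: algebra_simps simp flip: of_nat_mult)
    then show "2 * pi * real k / n \<le> pi" using n_ge by simp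
  qed simp
  define k where "k = nat \<bar>int i - int j\<bar>"
  have k: "2 \<le> k" "k \<le> n - 2"
    using ij n_ge by (auto simp: k_def opposed_def cyc_adj_cases)
  have "cos (2 * pi * real k / n) \<le> cos (2 * (2 * pi / n))"
  proof (cases "2 * k \<le> n")
    case False
    then show ?thesis using le[of "n - k"] cos_wrap[of k] k n_ge by simp
  qed (use le k in auto)
  also have "\<dots> = 2 * cosn\<^sup>2 - 1" unfolding cosn_def by (rule cos_double_cos)
  finally have "cos (2 * pi * (real i - real j) / n) - cosn \<le> - (1 + 2 * cosn) * (1 - cosn)"
    unfolding cos_abs_diff k_def[symmetric] by (simp add: power2_eq_square algebra_simps)
  then show ?thesis unfolding mink_wall using cosn_bounds by (simp add: divide_le_eq)
qed

definition wall_bound :: real where "wall_bound = (1 + cosn) / (1 - cosn)"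

lemma mink_wall_ge: "mink (wall i) (wall j) \<ge> - wall_bound"
proof -
  have "- (1 + cosn) / (1 - cosn) \<le> (cos (2 * pi * (real i - real j) / n) - cosn) / (1 - cosn)"
    using cosn_bounds cos_ge_minus_one[of "2 * pi * (real i - real j) / n"] by (intro divide_right_mono) auto
  then show ?thesis by (simp only: mink_wall wall_bound_def minus_divide_left)
qed

definition \<eta> :: real where "\<eta> = 2 * sqrt cosn"

lemma \<eta>_pos: "\<eta> > 0" using cosn_bounds by (simp add: \<eta>_def)

text \<open>The sum of two ultraparallel normals is a timelike vector pointing upwards, and the product of such a vector with any point is negative.\<close>

lemma disjoint_half_planes:
  assumes x: "x \<in> hyperboloid" and ij: "i < n" "j < n" "opposed i j"
  shows "mink x (wall i) + mink x (wall j) \<le> - \<eta>"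
proof -
  let ?t = "wall i + wall j"
  have tt: "mink ?t ?t \<le> - (4 * cosn)"
    using mink_wall_opposed[OF ij] mink_wall_self mink_commute[of "wall j" "wall i"] by simp
  have "height ?t > 0" using rad_ht_squares by (simp add: height_def wall_def)
  then have "mink x ?t \<le> - sqrt (- mink ?t ?t)"
    using mink_timelike_bound[OF x, of ?t] tt cosn_bounds by simp
  also have "\<dots> \<le> - sqrt (4 * cosn)" using tt by simp
  also have "sqrt (4 * cosn) = \<eta>" by (simp add: \<eta>_def real_sqrt_mult)
  finally show ?thesis by simp
qed

abbreviation mirror :: "nat \<Rightarrow> real \<times> real \<times> real \<Rightarrow> real \<times> real \<times> real" where
  "mirror i \<equiv> reflection (wall i)"

lemma mink_mirror_adj: "cyc_adj n i j \<Longrightarrow> mink (mirror j x) (wall i) = mink x (wall i)"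
  using mink_wall_adj[of j i] adj_sym[of i j] by (simp add: mink_reflection_left)

lemma mink_mirror_self: "mink (mirror i x) (wall i) = - mink x (wall i)"
  by (simp add: mink_reflection_left mink_wall_self)

sublocale walls: rigid_ping_pong "{..<n}" "cyc_adj n" mirror hyperboloid "\<lambda>i x. mink x (wall i)" 0 "- \<eta>" 0 0
proof
  fix i j z assume "cyc_adj n i j"
  then show "mirror i (mirror j z) = mirror j (mirror i z)" by (intro reflection_commute mink_wall_adj)
next
  fix i j :: nat and z assume "i \<in> {..<n}" "j \<in> {..<n}" "opposed i j" "z \<in> hyperboloid" "0 \<le> mink z (wall i)"
  then show "mink z (wall j) \<le> - \<eta>" using disjoint_half_planes[of z i j] by simp
qed (use \<eta>_pos in \<open>auto simp: reflection_hyperboloid mink_wall_self reflection_involution mink_mirror_adj mink_mirror_self\<close>)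

lemma mink_act:
  "mink (foldr mirror w x) (foldr mirror w y) = mink x y"
  by (induction w) (auto simp: mink_reflection mink_wall_self)

text \<open>The polygon. Its translates tile the plane: \<open>chamber_reached\<close> says that they cover, and \<open>displacement_chamber\<close> is a
quantitative form of disjointness for translates by even words.\<close>

definition chamber :: "(real \<times> real \<times> real) set" where
  "chamber = {x \<in> hyperboloid. \<forall>i<n. mink x (wall i) \<le> 0}"

definition even_words :: "nat list set" where
  "even_words = {w. set w \<subseteq> {..<n} \<and> (\<forall>i. even (count_list w i))}"

text \<open>Let \<open>i\<close> be the first letter of \<open>w\<close>. It occurs again, and being reduced the word contains a letter opposed to \<open>i\<close> as well. So \<open>w\<close>
takes the chamber to a definite depth beyond the \<open>i\<close>-th side, and a point at depth \<open>\<eta>\<close> has distance at least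
\<open>arsinh \<eta>\<close> from every point on the other side.\<close>

lemma displacement_chamber:
  assumes x: "x \<in> chamber" and w: "w \<in> even_words" "reduced (cyc_adj n) w" "w \<noteq> []"
  shows "- mink x (foldr mirror w x) \<ge> sqrt (1 + \<eta>\<^sup>2)"
proof -
  obtain i y where iy: "w = i # y" using w by (meson neq_Nil_conv)
  have I: "i < n" "set y \<subseteq> {..<n}" using w iy by (auto simp: even_words_def)
  have "even (count_list w i)" using w(1) by (auto simp: even_words_def)
  then have "odd (count_list y i)" using iy by simp
  then have "i \<in> set y" by (metis count_list_0_iff even_zero)
  then obtain j where "j \<in> set y" "opposed i j"
    using not_front_ex_blocking[of i y "cyc_adj n"] w iy by (auto simp: opposed_def)
  then have "mink (foldr mirror y x) (wall i) \<le> - \<eta>"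
    using w iy I x by (intro walls.deep_after_word) (auto simp: chamber_def)
  then have far: "mink (foldr mirror w x) (wall i) \<ge> \<eta>" using iy by (simp add: mink_mirror_self)
  have near: "mink x (wall i) \<le> 0" using x I by (simp add: chamber_def)
  have xH: "x \<in> hyperboloid" using x by (simp add: chamber_def)
  have wH: "foldr mirror w x \<in> hyperboloid" using walls.act_closed[of w x] xH w by (simp add: even_words_def)
  define \<alpha> u v where "\<alpha> = - mink x (foldr mirror w x)" and "u = mink (foldr mirror w x) (wall i)" and "v = mink x (wall i)"
  have "1 + u\<^sup>2 + v\<^sup>2 \<le> \<alpha>\<^sup>2 + 2 * \<alpha> * u * v"
    using gram_nonpos[of x "foldr mirror w x" "wall i"] xH wH mink_wall_self[of i]
    by (simp add: hyperboloid_def \<alpha>_def u_def v_def algebra_simps)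
  moreover have "\<alpha> * u * v \<le> 0"
  proof -
    have "\<alpha> \<ge> 1" using mink_hyperboloid_le[OF xH wH] by (simp add: \<alpha>_def)
    then show ?thesis using far near \<eta>_pos by (simp add: u_def v_def mult_nonneg_nonpos)
  qed
  moreover have "\<eta>\<^sup>2 \<le> u\<^sup>2" using far \<eta>_pos by (intro power_mono) (auto simp: u_def)
  ultimately have "1 + \<eta>\<^sup>2 \<le> \<alpha>\<^sup>2" using zero_le_power2[of v] by linarith
  moreover have "\<alpha> \<ge> 0" using mink_hyperboloid_le[OF xH wH] by (simp add: \<alpha>_def)
  ultimately show ?thesis unfolding \<alpha>_def[symmetric] by (intro real_le_lsqrt) auto
qed

text \<open>Call \<open>mink x (wall i)\<close> the excess of \<open>x\<close> over the \<open>i\<close>-th side.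
If all excesses are small, reflecting in a side with positive excess makes that excess negative and keeps the excess of the neighbours. Those of the
opposed sides are negative by a definite amount and cannot become positive. So the number of positive excesses drops.\<close>

lemma chamber_nearby:
  assumes \<epsilon>: "\<epsilon> > 0" "2 * \<epsilon> * wall_bound \<le> \<eta>"
  shows "x \<in> hyperboloid \<Longrightarrow> (\<And>i. i < n \<Longrightarrow> mink x (wall i) \<le> \<epsilon>) \<Longrightarrow> \<exists>u. set u \<subseteq> {..<n} \<and> foldr mirror u x \<in> chamber"
proof (induction "card {i. i < n \<and> mink x (wall i) > 0}" arbitrary: x rule: less_induct)
  case less
  show ?case
  proof (cases "\<exists>i<n. mink x (wall i) > 0")
    case False
    then have "\<forall>i<n. mink x (wall i) \<le> 0" by (meson not_less)
    then show ?thesis using less.prems by (intro exI[of _ "[]"]) (simp add: chamber_def)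
  next
    case True
    then obtain i where i: "i < n" "mink x (wall i) > 0" by blast
    have step: "mink (mirror i x) (wall j) \<le> max 0 (mink x (wall j)) \<and> (mink (mirror i x) (wall j) > 0 \<longrightarrow> mink x (wall j) > 0 \<and> j \<noteq> i)"
      if j: "j < n" for j
    proof -
      consider "j = i" | "cyc_adj n j i" | "opposed i j"
        using adj_sym by (auto simp: opposed_def)
      then show ?thesis
      proof cases
        case 1
        then show ?thesis using i mink_mirror_self[of i x] by simp
      next
        case 2
        then show ?thesis using mink_mirror_adj[OF 2, of x] adj_irrefl[of i] by auto
      next
        case 3
        have "mink (mirror i x) (wall j) = mink x (wall j) + 2 * mink x (wall i) * (- mink (wall i) (wall j))"
          by (simp add: mink_reflection_left)
        also have "\<dots> \<le> - \<eta> + 2 * mink x (wall i) * wall_bound"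
          using disjoint_half_planes[OF less.prems(1) i(1) j 3] i mink_wall_ge[of i j]
          by (intro add_mono mult_left_mono) auto
        also have "\<dots> \<le> - \<eta> + 2 * \<epsilon> * wall_bound"
          using less.prems(2)[OF i(1)] cosn_bounds by (intro add_mono mult_right_mono) (auto simp: wall_bound_def)
        finally show ?thesis using \<epsilon> by simp
      qed
    qed
    let ?y = "mirror i x"
    have "{j. j < n \<and> mink ?y (wall j) > 0} \<subset> {j. j < n \<and> mink x (wall j) > 0}"
      using step i by blast
    then have "card {j. j < n \<and> mink ?y (wall j) > 0} < card {j. j < n \<and> mink x (wall j) > 0}"
      by (intro psubset_card_mono) auto
    moreover have "?y \<in> hyperboloid" using less.prems reflection_hyperboloid mink_wall_self by blast
    moreover have "mink ?y (wall j) \<le> \<epsilon>" if "j < n" for j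
      by (rule order_trans[OF conjunct1[OF step[OF that]]]) (use less.prems(2)[OF that] \<epsilon>(1) in simp)
    ultimately obtain u where "set u \<subseteq> {..<n}" "foldr mirror u ?y \<in> chamber"
      using less.hyps[of ?y] by blast
    then show ?thesis using i by (intro exI[of _ "u @ [i]"]) auto
  qed
qed

text \<open>While some excess over a side is at least \<open>\<epsilon>\<close>, reflecting in that side lowers the point by a definite amount; afterwards
\<open>chamber_nearby\<close> applies.\<close>

lemma chamber_reached:
  assumes x: "x \<in> hyperboloid"
  shows "\<exists>u. set u \<subseteq> {..<n} \<and> foldr mirror u x \<in> chamber"
proof -
  define \<epsilon> where "\<epsilon> = \<eta> / (2 * wall_bound)"
  have wall_bound: "wall_bound > 0" using cosn_bounds by (simp add: wall_bound_def)
  have \<epsilon>: "\<epsilon> > 0" "2 * \<epsilon> * wall_bound \<le> \<eta>" using \<eta>_pos wall_bound by (auto simp: \<epsilon>_def)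
  define q where "q = 2 * \<epsilon> * ht"
  have q: "q > 0" using \<epsilon> rad_ht_squares by (simp add: q_def)
  obtain k :: nat where "height x / q \<le> k" using real_arch_simple by blast
  then have "height x \<le> real k * q" using q by (simp add: divide_le_eq)
  then show ?thesis using x
  proof (induction k arbitrary: x)
    case 0
    then show ?case by (simp add: hyperboloid_def)
  next
    case (Suc k)
    show ?case
    proof (cases "\<forall>i<n. mink x (wall i) \<le> \<epsilon>")
      case True
      then show ?thesis using chamber_nearby[OF \<epsilon>] Suc.prems by blast
    next
      case False
      then obtain i where i: "i < n" "mink x (wall i) > \<epsilon>" by auto
      have "height (mirror i x) = height x - 2 * mink x (wall i) * ht"
        by (simp add: reflection_def height_def wall_def)
      also have "\<dots> \<le> height x - q" using i rad_ht_squares by (simp add: q_def)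
      also have "\<dots> \<le> real k * q" using Suc.prems by (simp add: algebra_simps)
      finally obtain u where "set u \<subseteq> {..<n}" "foldr mirror u (mirror i x) \<in> chamber"
        using Suc.IH[of "mirror i x"] Suc.prems reflection_hyperboloid mink_wall_self by blast
      then show ?thesis using i by (intro exI[of _ "u @ [i]"]) auto
    qed
  qed
qed

text \<open>Every point is a translate of a point of the chamber, and conjugation preserves even words.\<close>

lemma displacement:
  assumes x: "x \<in> hyperboloid" and w: "w \<in> even_words" "reduced (cyc_adj n) w" "w \<noteq> []"
  shows "- mink x (foldr mirror w x) \<ge> sqrt (1 + \<eta>\<^sup>2)"
proof -
  obtain u where u: "set u \<subseteq> {..<n}" "foldr mirror u x \<in> chamber" using chamber_reached[OF x] by blast
  define p where "p = foldr mirror u x"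
  have pH: "p \<in> hyperboloid" using u by (simp add: p_def chamber_def)
  have wI: "set w \<subseteq> {..<n}" using w by (simp add: even_words_def)
  let ?v = "u @ w @ rev u"
  have vE: "?v \<in> even_words" using w u by (auto simp: even_words_def count_list_append count_list_rev)
  obtain v where v: "(cancels (cyc_adj n))\<^sup>*\<^sup>* ?v v" "reduced (cyc_adj n) v"
    using cancels_to_reduced by blast
  have vE': "v \<in> even_words"
    using vE cancels_parity[OF v(1)] cancels_set[OF v(1)] by (auto simp: even_words_def)
  have act_v: "foldr mirror v y = foldr mirror u (foldr mirror w (foldr mirror (rev u) y))" if "y \<in> hyperboloid" for y
    using walls.act_cancels_star[OF v(1) _ that] vE by (simp add: even_words_def)
  have "v \<noteq> []"
  proof
    assume "v = []"
    \<comment> \<open>The conjugate word would act trivially, so \<open>w\<close> would fix the point \<open>p\<close> of the chamber.\<close>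
    have "foldr mirror w p = p"
    proof -
      let ?y = "foldr mirror u p"
      have yH: "?y \<in> hyperboloid" using walls.act_closed u pH by blast
      have "foldr mirror u (foldr mirror w p) = foldr mirror u p"
        using act_v[OF yH] \<open>v = []\<close> walls.act_rev[OF u(1) pH] by simp
      then show ?thesis
        using walls.act_rev[OF u(1), of "foldr mirror w p"] walls.act_rev[OF u(1) pH]
          walls.act_closed[OF wI pH] by simp
    qed
    then have "sqrt (1 + \<eta>\<^sup>2) \<le> 1"
      using displacement_chamber[of p w] w u pH by (simp add: p_def hyperboloid_def)
    then show False using \<eta>_pos by (simp add: not_le)
  qed
  then have "- mink p (foldr mirror v p) \<ge> sqrt (1 + \<eta>\<^sup>2)"
    using displacement_chamber[of p v] v vE' u by (simp add: p_def)
  moreover have "foldr mirror v p = foldr mirror u (foldr mirror w x)"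
    using act_v[OF pH] walls.act_rev[OF u(1) x] by (simp add: p_def)
  ultimately show ?thesis by (simp add: p_def mink_act)
qed

text \<open>The horizontal part of \<open>x\<close> makes an angle of at most \<open>\<pi> / n\<close> with one of the normals. The inequality for that side bounds it, since
\<open>rad\<close> times the cosine of \<open>\<pi> / n\<close> exceeds \<open>ht\<close>.\<close>

lemma chamber_bounded:
  assumes x: "x \<in> chamber"
  shows "height x \<le> sqrt (1 + 2 * (ht * ht))"
proof -
  obtain p q h where xe: "x = (p, q, h)" by (cases x) auto
  have h: "h * h = 1 + p * p + q * q" "h > 0"
    using x by (auto simp: chamber_def hyperboloid_def mink_def height_def xe)
  obtain r \<phi> where r: "r \<ge> 0" "p = r * cos \<phi>" "q = r * sin \<phi>"
  proof -
    let ?z = "Complex p q"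
    have z: "?z = rcis (cmod ?z) (Arg ?z)" by (rule rcis_cmod_Arg[symmetric])
    have "p = cmod ?z * cos (Arg ?z)" using arg_cong[OF z, of Re] unfolding Re_rcis by simp
    moreover have "q = cmod ?z * sin (Arg ?z)" using arg_cong[OF z, of Im] unfolding Im_rcis by simp
    ultimately show ?thesis using that[of "cmod ?z" "Arg ?z"] by simp
  qed
  \<comment> \<open>The index of the normal closest in direction to \<open>x\<close>.\<close>
  define m where "m = round (\<phi> * n / (2 * pi))"
  define i where "i = nat (m mod int n)"
  have i: "i < n" using n_ge by (simp add: i_def nat_less_iff)
  define \<psi> where "\<psi> = \<phi> - 2 * pi * m / n"
  have "\<bar>\<phi> * n / (2 * pi) - m\<bar> \<le> 1 / 2"
    unfolding m_def using of_int_round_abs_le[of "\<phi> * n / (2 * pi)"] by (simp add: abs_minus_commute)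
  then have "\<bar>\<phi> * n / (2 * pi) - m\<bar> * (2 * pi / n) \<le> 1 / 2 * (2 * pi / n)"
    by (intro mult_right_mono) auto
  moreover have "\<psi> = (\<phi> * n / (2 * pi) - m) * (2 * pi / n)" using n_ge by (simp add: \<psi>_def field_simps)
  then have "\<bar>\<psi>\<bar> = \<bar>\<phi> * n / (2 * pi) - m\<bar> * (2 * pi / n)" by (simp only: abs_mult) simp
  ultimately have \<psi>: "\<bar>\<psi>\<bar> \<le> pi / n" by simp
  have "pi / n \<le> pi" using n_ge by (simp add: divide_le_eq)
  then have "cos (pi / n) \<le> cos \<bar>\<psi>\<bar>" using \<psi> by (intro cos_monotone_0_pi_le) auto
  then have cos_ge: "cos (pi / n) \<le> cos \<psi>" by simp
  have "pi / n \<le> pi / 2" using n_ge by (intro divide_left_mono) auto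
  then have cos_pos: "cos (pi / n) \<ge> 0" using pi_ge_zero n_ge by (intro cos_ge_zero) (auto intro: order_trans[of _ 0])
  have half: "2 * (cos (pi / n))\<^sup>2 = 1 + cosn"
    using cos_double_cos[of "pi / n"] by (simp add: cosn_def)
  have cos_eq: "cos (\<phi> - 2 * pi * i / n) = cos \<psi>"
  proof -
    have "real_of_int m = real_of_int (m mod int n + int n * (m div int n))" by simp
    also have "\<dots> = real_of_int (m mod int n) + real n * real_of_int (m div int n)"
      by (simp only: of_int_add of_int_mult of_int_of_nat_eq)
    also have "real_of_int (m mod int n) = real i" using n_ge by (simp add: i_def)
    finally have "real_of_int m = real i + real n * real_of_int (m div int n)" .
    then have "\<phi> - 2 * pi * i / n = \<psi> + 2 * pi * real_of_int (m div int n)"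
      using n_ge by (simp add: \<psi>_def field_simps)
    then show ?thesis by (simp only: cos_add cos_int_2pin sin_int_2pin mult_1_right mult_zero_right diff_zero)
  qed
  have "mink x (wall i) \<le> 0" using x i by (simp add: chamber_def)
  then have "rad * (r * cos (\<phi> - 2 * pi * i / n)) \<le> ht * h"
    by (simp add: mink_def wall_def xe r cos_diff algebra_simps)
  then have "rad * (r * cos \<psi>) \<le> ht * h" using cos_eq by simp
  moreover have "rad * (r * cos (pi / n)) \<le> rad * (r * cos \<psi>)"
    using cos_ge r rad_ht_squares by (intro mult_left_mono) auto
  ultimately have "rad * (r * cos (pi / n)) \<le> ht * h" by simp
  then have "(rad * (r * cos (pi / n)))\<^sup>2 \<le> (ht * h)\<^sup>2"
    using rad_ht_squares r cos_pos by (intro power_mono) auto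
  then have *: "(rad * rad) * (r * r) * (cos (pi / n))\<^sup>2 \<le> (ht * ht) * (h * h)"
    by (simp add: power2_eq_square algebra_simps)
  have rr: "p * p + q * q = r * r"
  proof -
    have "p * p + q * q = r * r * ((sin \<phi>)\<^sup>2 + (cos \<phi>)\<^sup>2)"
      unfolding r(2,3) by algebra
    then show ?thesis by simp
  qed
  have ab: "rad * rad * (1 - cosn) = 1" "ht * ht * (1 - cosn) = cosn" using cosn_bounds by (simp_all add: rad_ht_squares)
  have "(rad * rad) * (r * r) * (1 + cosn) = 2 * ((rad * rad) * (r * r) * (cos (pi / n))\<^sup>2)"
    by (simp add: half[symmetric])
  also have "\<dots> \<le> 2 * ((ht * ht) * (h * h))" using * by simp
  also have "h * h = 1 + r * r" using h(1) rr by simp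
  finally have "(rad * rad) * (r * r) * (1 + cosn) * (1 - cosn) \<le> 2 * ((ht * ht) * (1 + r * r)) * (1 - cosn)"
    using cosn_bounds by (intro mult_right_mono) auto
  then have "(rad * rad * (1 - cosn)) * ((r * r) * (1 + cosn)) \<le> (ht * ht * (1 - cosn)) * (2 * (1 + r * r))"
    by (simp add: algebra_simps)
  then have "(r * r) * (1 + cosn) \<le> 2 * cosn * (1 + r * r)" unfolding ab by (simp add: algebra_simps)
  then have "(r * r) * (1 - cosn) \<le> 2 * cosn" by (simp add: algebra_simps)
  then have "r * r \<le> 2 * (ht * ht)" using cosn_bounds by (simp add: rad_ht_squares pos_le_divide_eq)
  then have "h\<^sup>2 \<le> 1 + 2 * (ht * ht)" using h(1) rr by (simp add: power2_eq_square)
  then show ?thesis by (simp add: xe height_def real_le_rsqrt)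
qed

text \<open>A factor by which a reflection in a side can raise a point of the hyperboloid.\<close>

definition \<kappa> :: real where "\<kappa> = 1 + 2 * ht * (2 * rad + ht)"

lemma height_mirror:
  assumes x: "x \<in> hyperboloid"
  shows "height (mirror i x) \<le> \<kappa> * height x"
proof -
  obtain p q h where xe: "x = (p, q, h)" by (cases x) auto
  have h: "h\<^sup>2 = 1 + p\<^sup>2 + q\<^sup>2" "h > 0"
    using x by (auto simp: hyperboloid_def mink_def height_def xe power2_eq_square)
  have "p\<^sup>2 \<le> h\<^sup>2" "q\<^sup>2 \<le> h\<^sup>2" using h(1) by auto
  then have "\<bar>p\<bar> \<le> h" "\<bar>q\<bar> \<le> h" using h(2) unfolding abs_le_square_iff[symmetric] by auto
  have 1: "\<bar>p * cos t\<bar> \<le> h" "\<bar>q * sin t\<bar> \<le> h" for t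
    using \<open>\<bar>p\<bar> \<le> h\<close> \<open>\<bar>q\<bar> \<le> h\<close> mult_mono[of "\<bar>p\<bar>" h "\<bar>cos t\<bar>" 1] mult_mono[of "\<bar>q\<bar>" h "\<bar>sin t\<bar>" 1] h
    by (auto simp: abs_mult)
  let ?t = "2 * pi * i / n"
  have "- mink x (wall i) = - rad * (p * cos ?t) - rad * (q * sin ?t) + ht * h"
    by (simp add: mink_def wall_def xe algebra_simps)
  also have "\<dots> \<le> rad * h + rad * h + ht * h"
  proof -
    have "rad * (- (p * cos ?t)) \<le> rad * h" "rad * (- (q * sin ?t)) \<le> rad * h"
      using 1[of ?t] rad_ht_squares by (intro mult_left_mono; simp add: abs_le_iff)+
    then show ?thesis by (simp add: algebra_simps)
  qed
  finally have "2 * ht * (- mink x (wall i)) \<le> 2 * ht * ((2 * rad + ht) * h)"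
    using rad_ht_squares by (intro mult_left_mono) (auto simp: algebra_simps)
  moreover have "height (mirror i x) = h + 2 * ht * (- mink x (wall i))"
    by (simp add: reflection_def height_def wall_def xe)
  ultimately show ?thesis by (simp add: \<kappa>_def height_def xe algebra_simps)
qed

lemma \<kappa>_ge_1: "\<kappa> \<ge> 1"
  using rad_ht_squares by (simp add: \<kappa>_def)

lemma height_act:
  assumes x: "x \<in> hyperboloid" and w: "set w \<subseteq> {..<n}"
  shows "height (foldr mirror w x) \<le> \<kappa> ^ length w * height x"
  using w
proof (induction w)
  case (Cons i w)
  have "height (foldr mirror (i # w) x) \<le> \<kappa> * height (foldr mirror w x)"
    using height_mirror walls.act_closed x Cons.prems by simp
  also have "\<dots> \<le> \<kappa> * (\<kappa> ^ length w * height x)"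
    using Cons \<kappa>_ge_1 by (intro mult_left_mono) auto
  finally show ?case by simp
qed simp

text \<open>The representative of the coset of \<open>w\<close> modulo the even words; these have index \<open>2\<^sup>n\<close>.\<close>

definition odd_letters :: "nat list \<Rightarrow> nat list" where
  "odd_letters w = filter (\<lambda>i. odd (count_list w i)) [0..<n]"

lemma count_filter_upt: "count_list (filter P [0..<n]) i = (if i < n \<and> P i then 1 else 0)"
proof -
  have "count_list (filter P [0..<m]) i = (if i < m \<and> P i then 1 else 0)" for m
    by (induction m) (auto simp: count_list_append less_Suc_eq)
  then show ?thesis .
qed

lemma odd_letters_even: "set w \<subseteq> {..<n} \<Longrightarrow> even (count_list (odd_letters w) i + count_list w i)"
  using count_list_0_iff[of w i] by (auto simp: odd_letters_def count_filter_upt)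

lemma odd_letters_set: "set (odd_letters w) \<subseteq> {..<n}" "length (odd_letters w) \<le> n"
  using length_filter_le[of _ "[0..<n]"] by (auto simp: odd_letters_def)

definition tile_height :: real where "tile_height = \<kappa> ^ n * sqrt (1 + 2 * (ht * ht))"

text \<open>A word that leads to the chamber becomes even when its odd letters are repeated, and these at most \<open>n\<close> letters raise the point by
a bounded factor.\<close>

lemma cocompact:
  assumes x: "x \<in> hyperboloid"
  shows "\<exists>w\<in>even_words. height (foldr mirror w x) \<le> tile_height"
proof -
  obtain u where u: "set u \<subseteq> {..<n}" "foldr mirror u x \<in> chamber" using chamber_reached[OF x] by blast
  let ?v = "odd_letters u"
  let ?p = "foldr mirror u x"
  have pH: "?p \<in> hyperboloid" using u by (simp add: chamber_def)
  have even: "?v @ u \<in> even_words"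
    using odd_letters_even[OF u(1)] odd_letters_set u by (auto simp: even_words_def count_list_append)
  have "height (foldr mirror (?v @ u) x) \<le> \<kappa> ^ length ?v * height ?p"
    using height_act[OF pH odd_letters_set(1)] by simp
  also have "\<dots> \<le> \<kappa> ^ n * height ?p"
    using odd_letters_set(2) \<kappa>_ge_1 pH by (intro mult_right_mono power_increasing) (auto simp: hyperboloid_def)
  also have "\<dots> \<le> tile_height"
    unfolding tile_height_def using chamber_bounded[OF u(2)] \<kappa>_ge_1 by (intro mult_left_mono) auto
  finally show ?thesis using even by blast
qed

end

section \<open>Word lengths and undistorted subgroups\<close>

context group begin

lemma generating_set_closed: "finite_generating_set G A \<Longrightarrow> A \<union> m_inv G ` A \<subseteq> carrier G"
  by (auto simp: finite_generating_set_def)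

lemma word_length_mult:
  assumes A: "finite_generating_set G A" and x: "x \<in> carrier G" and y: "y \<in> carrier G"
  shows "word_length G A (x \<otimes> y) \<le> word_length G A x + word_length G A y"
proof -
  obtain us where us: "set us \<subseteq> A \<union> m_inv G ` A" "foldr (\<otimes>) us \<one> = x" "length us = word_length G A x"
    using word_length_attained[OF A x] .
  obtain vs where vs: "set vs \<subseteq> A \<union> m_inv G ` A" "foldr (\<otimes>) vs \<one> = y" "length vs = word_length G A y"
    using word_length_attained[OF A y] .
  have "foldr (\<otimes>) (us @ vs) \<one> = x \<otimes> y"
    using foldr_mult_append[of us vs] us vs generating_set_closed[OF A] by (metis order_trans)
  then show ?thesis
    using word_length_le[of "us @ vs" A "x \<otimes> y"] us vs by simp
qed

lemma word_length_product:
  assumes A: "finite_generating_set G A" and "set fs \<subseteq> carrier G" "\<And>f. f \<in> set fs \<Longrightarrow> word_length G A f \<le> k"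
  shows "word_length G A (foldr (\<otimes>) fs \<one>) \<le> k * length fs"
  using assms(2,3)
proof (induction fs)
  case Nil
  then show ?case using word_length_le[of "[]" A \<one>] by simp
next
  case (Cons f fs)
  have "word_length G A (foldr (\<otimes>) (f # fs) \<one>) \<le> word_length G A f + word_length G A (foldr (\<otimes>) fs \<one>)"
    using Cons.prems foldr_mult_closed[of fs] by (simp add: word_length_mult[OF A])
  also have "\<dots> \<le> k + k * length fs" using Cons by (intro add_mono) auto
  finally show ?case by simp
qed

text \<open>Comparing lengths with respect to \<open>A\<close> and to another finite set only involves the largest length of the finitely many letters.\<close>

lemma word_length_comparison:
  assumes A: "finite_generating_set G A" and B: "finite B" "B \<subseteq> carrier G"
  shows "\<exists>k. \<forall>ws. set ws \<subseteq> B \<longrightarrow> word_length G A (foldr (\<otimes>) ws \<one>) \<le> k * length ws"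
proof -
  define k where "k = Max (insert 0 (word_length G A ` B))"
  have "word_length G A f \<le> k" if "f \<in> B" for f
    unfolding k_def using B that by (intro Max_ge) auto
  then have "word_length G A (foldr (\<otimes>) ws \<one>) \<le> k * length ws" if "set ws \<subseteq> B" for ws
    using that B by (intro word_length_product[OF A]) auto
  then show ?thesis by blast
qed

lemma word_length_change:
  assumes A: "finite_generating_set G A" and B: "finite_generating_set G B"
  shows "\<exists>k. \<forall>g\<in>carrier G. word_length G A g \<le> k * word_length G B g"
proof -
  have "finite (B \<union> m_inv G ` B)" using B by (simp add: finite_generating_set_def)
  then obtain k where k: "\<And>ws. set ws \<subseteq> B \<union> m_inv G ` B \<Longrightarrow> word_length G A (foldr (\<otimes>) ws \<one>) \<le> k * length ws"
    using word_length_comparison[OF A _ generating_set_closed[OF B]] by blast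
  show ?thesis
  proof (intro exI ballI)
    fix g assume "g \<in> carrier G"
    then obtain ws where "set ws \<subseteq> B \<union> m_inv G ` B" "foldr (\<otimes>) ws \<one> = g" "length ws = word_length G B g"
      using word_length_attained[OF B] by blast
    then show "word_length G A g \<le> k * word_length G B g" using k[of ws] by simp
  qed
qed

text \<open>One pair of generating sets suffices, as word metrics for different finite generating sets are bilipschitz equivalent. The upper
bound of a quasi-isometric embedding holds for every finitely generated subgroup.\<close>

lemma undistortedI:
  assumes H: "subgroup H G" and A: "finite_generating_set G A" and B: "finite_generating_set (G\<lparr>carrier := H\<rparr>) B"
    and bound: "\<And>h. h \<in> H \<Longrightarrow> word_length (G\<lparr>carrier := H\<rparr>) B h \<le> k * word_length G A h"
  shows "undistorted G H"
proof -
  let ?H = "G\<lparr>carrier := H\<rparr>"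
  interpret H: group ?H using subgroup.subgroup_is_group[OF H] by simp
  have HG: "H \<subseteq> carrier G" using subgroup.subset[OF H] .
  have "qi_embedding H (word_dist ?H B') (carrier G) (word_dist G A') (\<lambda>h. h)"
    if A': "finite_generating_set G A'" and B': "finite_generating_set ?H B'" for A' B'
  proof -
    obtain k1 where k1: "\<And>h. h \<in> H \<Longrightarrow> word_length ?H B' h \<le> k1 * word_length ?H B h"
      using H.word_length_change[OF B' B] by auto
    obtain k2 where k2: "\<And>g. g \<in> carrier G \<Longrightarrow> word_length G A g \<le> k2 * word_length G A' g"
      using word_length_change[OF A A'] by auto
    have fin: "finite (B' \<union> m_inv ?H ` B')" using B' by (simp add: finite_generating_set_def)
    have sub: "B' \<union> m_inv ?H ` B' \<subseteq> H" using H.generating_set_closed[OF B'] by simp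
    obtain k3 where k3: "\<And>ws. set ws \<subseteq> B' \<union> m_inv ?H ` B' \<Longrightarrow> word_length G A' (foldr (\<otimes>) ws \<one>) \<le> k3 * length ws"
      using word_length_comparison[OF A' fin order_trans[OF sub HG]] by blast
    define K :: real where "K = 1 + k1 * (k * k2) + k3"
    have lower: "word_length ?H B' h \<le> k1 * (k * k2) * word_length G A' h" if h: "h \<in> H" for h
    proof -
      have "word_length ?H B' h \<le> k1 * (k * word_length G A h)"
        using k1[OF h] bound[OF h] by (meson mult_le_mono2 order_trans)
      also have "\<dots> \<le> k1 * (k * (k2 * word_length G A' h))"
        using k2[of h] h HG by (intro mult_le_mono2) auto
      finally show ?thesis by (simp add: mult.assoc)
    qed
    have upper: "word_length G A' h \<le> k3 * word_length ?H B' h" if h: "h \<in> H" for h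
    proof -
      obtain ws where "set ws \<subseteq> B' \<union> m_inv ?H ` B'" "foldr (\<otimes>) ws \<one> = h" "length ws = word_length ?H B' h"
        using H.word_length_attained[OF B', of h] h by auto
      then show ?thesis using k3[of ws] by simp
    qed
    have K: "K \<ge> 1" "k1 * (k * k2) \<le> K" "k3 \<le> K" by (simp_all add: K_def)
    have "qi_embedding_with K 0 H (word_dist ?H B') (carrier G) (word_dist G A') (\<lambda>h. h)"
      unfolding qi_embedding_with_def
    proof (intro conjI ballI)
      show "(\<lambda>h. h) \<in> H \<rightarrow> carrier G" using HG by auto
      fix x y assume x: "x \<in> H" and y: "y \<in> H"
      define h where "h = inv x \<otimes> y"
      have h: "h \<in> H" using x y H by (simp add: h_def subgroup.m_closed subgroup.m_inv_closed)
      have dH: "word_dist ?H B' x y = word_length ?H B' h"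
        using x y m_inv_consistent[OF H x] by (simp add: word_dist_def h_def)
      have dG: "word_dist G A' x y = word_length G A' h"
        using x y HG by (auto simp: word_dist_def h_def)
      have "real (word_length ?H B' h) \<le> real (k1 * (k * k2)) * real (word_length G A' h)"
        using lower[OF h] by (simp only: of_nat_le_iff flip: of_nat_mult)
      also have "\<dots> \<le> K * real (word_length G A' h)" using K by (intro mult_right_mono) auto
      finally show "word_dist ?H B' x y / K - 0 \<le> word_dist G A' x y"
        unfolding dH dG using K(1) by (simp add: divide_le_eq mult.commute)
      have "real (word_length G A' h) \<le> real k3 * real (word_length ?H B' h)"
        using upper[OF h] by (simp only: of_nat_le_iff flip: of_nat_mult)
      also have "\<dots> \<le> K * real (word_length ?H B' h)" using K by (intro mult_right_mono) auto
      finally show "word_dist G A' x y \<le> K * word_dist ?H B' x y + 0" unfolding dH dG by simp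
    qed
    then show ?thesis unfolding qi_embedding_def using K(1) by (intro exI[of _ K] exI[of _ 0]) simp
  qed
  then show ?thesis
    unfolding undistorted_def finitely_generated_def using A B by blast
qed

lemma commute_inv:
  assumes "x \<in> carrier G" "y \<in> carrier G" "x \<otimes> y = y \<otimes> x"
  shows "inv x \<otimes> y = y \<otimes> inv x"
proof -
  have "x \<otimes> (y \<otimes> inv x) = y \<otimes> x \<otimes> inv x" using assms by (simp flip: m_assoc)
  also have "\<dots> = y" using assms by (simp add: m_assoc)
  finally show ?thesis using assms by (metis inv_solve_left' m_closed inv_closed)
qed

end

section \<open>Surface subgroups from ping-pong\<close>

text \<open>The input from geometry. The generators satisfy the relations of the right-angled Artin group of the cycle, and \<open>gap i\<close> plays the role of the
distance to a wall.\<close>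

locale group_ping_pong = group G + right_angled_polygon n
  for G :: "('g, 'b) monoid_scheme" (structure) and n :: nat +
  fixes gen :: "nat \<Rightarrow> 'g" and gap :: "nat \<Rightarrow> 'g \<Rightarrow> real" and D Q T :: real
  assumes gen_closed: "i < n \<Longrightarrow> gen i \<in> carrier G"
    and gen_commute: "cyc_adj n i j \<Longrightarrow> gen i \<otimes> gen j = gen j \<otimes> gen i"
    and gap_adj: "cyc_adj n i j \<Longrightarrow> x \<in> carrier G \<Longrightarrow> \<bar>gap i (gen j \<otimes> x) - gap i x\<bar> \<le> Q"
    and gap_self: "i < n \<Longrightarrow> x \<in> carrier G \<Longrightarrow> gap i (gen i \<otimes> x) \<ge> T - gap i x"
    and gap_opposed: "i < n \<Longrightarrow> j < n \<Longrightarrow> opposed i j \<Longrightarrow> x \<in> carrier G \<Longrightarrow> gap i x > D \<Longrightarrow> gap j x \<le> D"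
    and gap_one: "i < n \<Longrightarrow> gap i \<one> \<le> D"
    and Q_nonneg: "Q \<ge> 0" and T_large: "T \<ge> 2 * D + Q + 1"
begin

definition letter :: "bool \<Rightarrow> nat \<Rightarrow> 'g" where
  "letter s i = (if s then gen i else inv gen i)"

text \<open>The signs turn the generators, which have infinite order, into involutions: the second application undoes the first one.\<close>

definition turn :: "nat \<Rightarrow> 'g \<times> (nat \<Rightarrow> bool) \<Rightarrow> 'g \<times> (nat \<Rightarrow> bool)" where
  "turn i p = (letter (snd p i) i \<otimes> fst p, (snd p)(i := \<not> snd p i))"

abbreviation states :: "('g \<times> (nat \<Rightarrow> bool)) set" where
  "states \<equiv> carrier G \<times> UNIV"

lemma letter_closed: "i < n \<Longrightarrow> letter s i \<in> carrier G"
  by (simp add: letter_def gen_closed)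

lemma letter_cancel: "i < n \<Longrightarrow> letter (\<not> s) i \<otimes> letter s i = \<one>"
  by (simp add: letter_def gen_closed)

lemma letter_commute:
  assumes "cyc_adj n i j"
  shows "letter s i \<otimes> letter s' j = letter s' j \<otimes> letter s i"
proof -
  have c: "gen i \<in> carrier G" "gen j \<in> carrier G"
    using assms gen_closed by (auto simp: cyc_adj_def)
  have 1: "letter s i \<otimes> gen j = gen j \<otimes> letter s i"
    using commute_inv[OF c gen_commute[OF assms]] gen_commute[OF assms] by (simp add: letter_def)
  have l: "letter s i \<in> carrier G" using c by (simp add: letter_def)
  show ?thesis
  proof (cases s')
    case True
    then show ?thesis using 1 by (simp add: letter_def[of True])
  next
    case False
    then show ?thesis using commute_inv[OF c(2) l 1[symmetric]] by (simp add: letter_def[of False])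
  qed
qed

lemma gap_letter_adj: "cyc_adj n i j \<Longrightarrow> x \<in> carrier G \<Longrightarrow> \<bar>gap i (letter s j \<otimes> x) - gap i x\<bar> \<le> Q"
proof (cases s)
  case False
  assume ij: "cyc_adj n i j" and x: "x \<in> carrier G"
  have j: "gen j \<in> carrier G" using ij gen_closed by (simp add: cyc_adj_def)
  have "gen j \<otimes> (inv gen j \<otimes> x) = x" using x j by (simp flip: m_assoc)
  then show ?thesis using gap_adj[OF ij, of "inv gen j \<otimes> x"] x j False by (simp add: letter_def)
qed (simp add: letter_def gap_adj)

lemma gap_letter_self: "i < n \<Longrightarrow> x \<in> carrier G \<Longrightarrow> gap i (letter s i \<otimes> x) \<ge> T - gap i x"
proof (cases s)
  case False
  assume i: "i < n" and x: "x \<in> carrier G"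
  have gi: "gen i \<in> carrier G" using i gen_closed by simp
  have "gen i \<otimes> (inv gen i \<otimes> x) = x" using x gi by (simp flip: m_assoc)
  then show ?thesis using gap_self[OF i, of "inv gen i \<otimes> x"] x gi False by (simp add: letter_def)
qed (simp add: letter_def gap_self)

sublocale signed: ping_pong "{..<n}" "cyc_adj n" turn states "\<lambda>i p. gap i (fst p)" D D Q T "D + 1"
proof
  fix i j p assume i: "i \<in> {..<n}" and p: "p \<in> states"
  show "turn i p \<in> states" using i p letter_closed by (auto simp: turn_def)
  have "letter (\<not> snd p i) i \<otimes> (letter (snd p i) i \<otimes> fst p) = fst p"
    using i p letter_closed letter_cancel by (auto simp flip: m_assoc)
  then show "turn i (turn i p) = p" by (simp add: turn_def)
  show "gap i (fst (turn i p)) \<ge> T - gap i (fst p)"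
    using i p gap_letter_self by (auto simp: turn_def)
  assume j: "j \<in> {..<n}"
  show "gap j (fst p) \<le> D" if "opposed i j" "D + 1 \<le> gap i (fst p)"
    using gap_opposed[of i j "fst p"] i j p that by auto
  assume adj: "cyc_adj n i j"
  then have "i \<noteq> j" using adj_irrefl by blast
  have "letter (snd p i) i \<otimes> (letter (snd p j) j \<otimes> fst p) = letter (snd p j) j \<otimes> (letter (snd p i) i \<otimes> fst p)"
    using i j p letter_closed letter_commute[OF adj] by (auto simp flip: m_assoc)
  then show "turn i (turn j p) = turn j (turn i p)"
    using \<open>i \<noteq> j\<close> by (simp add: turn_def fun_upd_twist)
  show "\<bar>gap i (fst (turn j p)) - gap i (fst p)\<bar> \<le> Q"
    using gap_letter_adj[OF adj] p by (auto simp: turn_def)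
qed (use Q_nonneg T_large in auto)

text \<open>The group element by which a word multiplies, when the signs at the start are \<open>\<sigma>\<close> and the last letter of the word acts first.\<close>

definition val :: "(nat \<Rightarrow> bool) \<Rightarrow> nat list \<Rightarrow> 'g" where
  "val \<sigma> w = fst (foldr turn w (\<one>, \<sigma>))"

abbreviation plus :: "nat \<Rightarrow> bool" where "plus \<equiv> \<lambda>_. True"

lemma val_closed: "set w \<subseteq> {..<n} \<Longrightarrow> val \<sigma> w \<in> carrier G"
  using signed.act_closed[of w "(\<one>, \<sigma>)"] by (auto simp: val_def)

lemma act_turn:
  "set w \<subseteq> {..<n} \<Longrightarrow> x \<in> carrier G \<Longrightarrow>
    foldr turn w (x, \<sigma>) = (val \<sigma> w \<otimes> x, \<lambda>i. \<sigma> i \<noteq> odd (count_list w i))"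
proof (induction w arbitrary: x)
  case (Cons i w)
  have 1: "foldr turn w (x, \<sigma>) = (val \<sigma> w \<otimes> x, \<lambda>i. \<sigma> i \<noteq> odd (count_list w i))"
    and 2: "snd (foldr turn w (\<one>, \<sigma>)) = (\<lambda>i. \<sigma> i \<noteq> odd (count_list w i))"
    using Cons.IH[of x] Cons.IH[of \<one>] Cons.prems by simp_all
  have v: "val \<sigma> w \<in> carrier G" using Cons.prems val_closed by simp
  have "val \<sigma> (i # w) = letter (\<sigma> i \<noteq> odd (count_list w i)) i \<otimes> val \<sigma> w"
    by (simp add: val_def turn_def[of i] 2)
  moreover have "foldr turn (i # w) (x, \<sigma>) = turn i (val \<sigma> w \<otimes> x, \<lambda>i. \<sigma> i \<noteq> odd (count_list w i))"
    by (simp add: 1)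
  ultimately show ?case using Cons.prems v letter_closed[of i]
    by (auto simp: turn_def[of i] m_assoc fun_eq_iff simp del: foldr.simps)
qed (simp add: val_def)

lemma act_turn_even:
  "w \<in> even_words \<Longrightarrow> x \<in> carrier G \<Longrightarrow> foldr turn w (x, \<sigma>) = (val \<sigma> w \<otimes> x, \<sigma>)"
  using act_turn[of w x \<sigma>] by (auto simp: even_words_def)

lemma val_append:
  "u \<in> even_words \<Longrightarrow> v \<in> even_words \<Longrightarrow> val plus (u @ v) = val plus u \<otimes> val plus v"
  using act_turn_even[of v \<one> plus] act_turn_even[of u "val plus v" plus] val_closed[of v plus]
  by (simp add: val_def[of plus "u @ v"] even_words_def)

lemma even_words_append: "u \<in> even_words \<Longrightarrow> v \<in> even_words \<Longrightarrow> u @ v \<in> even_words"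
  by (simp add: even_words_def count_list_append)

lemma even_words_rev: "w \<in> even_words \<Longrightarrow> rev w \<in> even_words"
  by (simp add: even_words_def count_list_rev)

lemma val_rev: "w \<in> even_words \<Longrightarrow> val plus (rev w) \<otimes> val plus w = \<one>"
  using signed.act_rev[of w "(\<one>, plus)"] val_append[OF even_words_rev, of w w]
  by (simp add: even_words_def val_def)

text \<open>A nonempty reduced word would take the identity far beyond some wall.\<close>

lemma val_trivial:
  assumes w: "w \<in> even_words" and v: "val plus w = \<one>"
  shows "(cancels (cyc_adj n))\<^sup>*\<^sup>* w []"
proof -
  obtain w' where w': "(cancels (cyc_adj n))\<^sup>*\<^sup>* w w'" "reduced (cyc_adj n) w'"
    using cancels_to_reduced by blast
  have wI: "set w \<subseteq> {..<n}" using w by (simp add: even_words_def)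
  have "foldr turn w' (\<one>, plus) = (\<one>, plus)"
    using signed.act_cancels_star[OF w'(1) wI, of "(\<one>, plus)"] act_turn_even[OF w, of \<one> plus] v by simp
  moreover have "\<exists>e. front (cyc_adj n) e w' \<and> T - D - Q \<le> gap e (fst (foldr turn w' (\<one>, plus)))" if "w' \<noteq> []"
    using that w' cancels_set[OF w'(1)] wI no_triangle gap_one
    by (intro signed.reduced_word_far) auto
  moreover have "gap e \<one> \<le> D" if "front (cyc_adj n) e w'" for e
    using gap_one front_in_set[OF that] cancels_set[OF w'(1)] wI by auto
  ultimately have "w' = []" using T_large by force
  then show ?thesis using w' by simp
qed

definition image_group :: "'g set" where
  "image_group = val plus ` even_words"

lemma subgroup_image: "subgroup image_group G"
proof
  show "image_group \<subseteq> carrier G" using val_closed by (auto simp: image_group_def even_words_def)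
  have "[] \<in> even_words" by (simp add: even_words_def)
  then show "\<one> \<in> image_group" unfolding image_group_def by (rule rev_image_eqI) (simp add: val_def)
  fix x assume "x \<in> image_group"
  then obtain u where u: "u \<in> even_words" "x = val plus u" by (auto simp: image_group_def)
  have "inv x = val plus (rev u)"
    using val_rev[OF u(1)] val_closed[of u plus] val_closed[of "rev u" plus] u
    by (intro inv_equality) (auto simp: even_words_def)
  then show "inv x \<in> image_group" using even_words_rev u by (auto simp: image_group_def)
  fix y assume "y \<in> image_group"
  then obtain v where "v \<in> even_words" "y = val plus v" by (auto simp: image_group_def)
  then show "x \<otimes> y \<in> image_group"
    using u val_append even_words_append unfolding image_group_def by (metis image_eqI)
qed

text \<open>If two even words have the same value, the product of one with the inverse of the other cancels to the empty word, and
cancellation is valid for the isometries as well. So the subgroup acts on the plane.\<close>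

lemma val_determines_isometry:
  assumes u: "u \<in> even_words" and v: "v \<in> even_words" and eq: "val plus u = val plus v" and x: "x \<in> hyperboloid"
  shows "foldr mirror u x = foldr mirror v x"
proof -
  have uI: "set u \<subseteq> {..<n}" and vI: "set v \<subseteq> {..<n}" using u v by (auto simp: even_words_def)
  have "val plus (rev v @ u) = \<one>" using val_append[OF even_words_rev[OF v] u] eq val_rev[OF v] by simp
  then have "(cancels (cyc_adj n))\<^sup>*\<^sup>* (rev v @ u) []"
    using val_trivial even_words_append even_words_rev u v by blast
  then have "foldr mirror (rev v) (foldr mirror u x) = x"
    using walls.act_cancels_star[of "rev v @ u" "[]" x] uI vI x by simp
  then show ?thesis
    using walls.act_rev'[OF vI walls.act_closed[OF uI x]] by simp
qed

definition word_of :: "'g \<Rightarrow> nat list" where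
  "word_of h = (SOME w. w \<in> even_words \<and> val plus w = h)"

lemma word_of: "h \<in> image_group \<Longrightarrow> word_of h \<in> even_words \<and> val plus (word_of h) = h"
  unfolding word_of_def image_group_def by (rule someI_ex) blast

definition plane_act :: "'g \<Rightarrow> complex \<Rightarrow> complex" where
  "plane_act h z = of_hyperboloid (foldr mirror (word_of h) (to_hyperboloid z))"

lemma plane_act_val:
  assumes "w \<in> even_words" "z \<in> upper_half_plane"
  shows "plane_act (val plus w) z = of_hyperboloid (foldr mirror w (to_hyperboloid z))"
  unfolding plane_act_def
  using val_determines_isometry[of "word_of (val plus w)" w "to_hyperboloid z"] word_of[of "val plus w"] assms
    to_hyperboloid_mem by (simp add: image_group_def)

lemma act_hyperboloid: "w \<in> even_words \<Longrightarrow> z \<in> upper_half_plane \<Longrightarrow> foldr mirror w (to_hyperboloid z) \<in> hyperboloid"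
  using walls.act_closed[of w "to_hyperboloid z"] to_hyperboloid_mem by (simp add: even_words_def)

lemma surface_group_image: "surface_group (G\<lparr>carrier := image_group\<rparr>)"
proof -
  let ?H = "G\<lparr>carrier := image_group\<rparr>"
  define \<epsilon> where "\<epsilon> = arcosh (sqrt (1 + \<eta>\<^sup>2))"
  \<comment> \<open>The points whose image on the hyperboloid has height at most \<open>tile_height\<close>. A bound on the height is a
  bound on the distance from \<open>\<i>\<close>.\<close>
  define C where "C = {z. (cmod z)\<^sup>2 + 1 \<le> 2 * tile_height * Im z}"
  have tile: "tile_height > 0"
    unfolding tile_height_def using \<kappa>_ge_1 by (intro mult_pos_pos zero_less_power) (auto simp: add_pos_nonneg)
  have CU: "C \<subseteq> upper_half_plane"
  proof
    fix z assume "z \<in> C"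
    then have "0 < 2 * tile_height * Im z" using zero_le_power2[of "cmod z"] unfolding C_def by (smt (verit) mem_Collect_eq)
    then show "z \<in> upper_half_plane" using tile by (simp add: upper_half_plane_def zero_less_mult_iff)
  qed
  have "closed C"
    unfolding C_def by (intro closed_Collect_le continuous_intros)
  moreover have "bounded C"
  proof (rule boundedI)
    fix z assume "z \<in> C"
    then have "(cmod z)\<^sup>2 \<le> 2 * tile_height * Im z" by (simp add: C_def)
    also have "\<dots> \<le> 2 * tile_height * cmod z"
      using tile abs_Im_le_cmod[of z] by (intro mult_left_mono) auto
    finally show "cmod z \<le> 2 * tile_height"
      using tile by (cases "cmod z = 0") (auto simp: power2_eq_square)
  qed
  ultimately have C: "compact C" by (simp add: compact_eq_bounded_closed)
  interpret H: group ?H using subgroup.subgroup_is_group[OF subgroup_image is_group] .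
  interpret free_cocompact_action ?H plane_act \<epsilon> C
  proof
    fix g z w assume g: "g \<in> carrier ?H" and z: "z \<in> upper_half_plane"
    then obtain u where u: "u \<in> even_words" "g = val plus u" by (auto simp: image_group_def)
    note U = act_hyperboloid[OF u(1)]
    show "plane_act g z \<in> upper_half_plane"
      using U[OF z] of_hyperboloid_mem by (simp add: u plane_act_val[OF u(1) z])
    show "hyp_dist (plane_act g z) (plane_act g w) = hyp_dist z w" if w: "w \<in> upper_half_plane"
      using U[OF z] U[OF w] z w of_hyperboloid_mem
      by (simp add: u plane_act_val[OF u(1)] hyp_dist_arcosh to_of_hyperboloid mink_act)
    show "plane_act (g \<otimes>\<^bsub>?H\<^esub> h) z = plane_act g (plane_act h z)" if h: "h \<in> carrier ?H" for h
    proof -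
      obtain v where v: "v \<in> even_words" "h = val plus v" using h by (auto simp: image_group_def)
      note V = act_hyperboloid[OF v(1) z]
      have "plane_act (g \<otimes> h) z = of_hyperboloid (foldr mirror u (foldr mirror v (to_hyperboloid z)))"
        using plane_act_val[OF even_words_append[OF u(1) v(1)] z] val_append[OF u(1) v(1)] u v by simp
      also have "\<dots> = plane_act g (plane_act h z)"
        using plane_act_val[OF u(1), of "plane_act h z"] plane_act_val[OF v(1) z] V u v
        by (simp add: of_hyperboloid_mem to_of_hyperboloid)
      finally show ?thesis by simp
    qed
    show "\<epsilon> \<le> hyp_dist z (plane_act g z)" if "g \<noteq> \<one>\<^bsub>?H\<^esub>"
    proof -
      obtain u' where u': "(cancels (cyc_adj n))\<^sup>*\<^sup>* u u'" "reduced (cyc_adj n) u'"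
        using cancels_to_reduced by blast
      have uI: "set u \<subseteq> {..<n}" using u by (simp add: even_words_def)
      have u'E: "u' \<in> even_words"
        using u(1) cancels_parity[OF u'(1)] cancels_set[OF u'(1)] by (auto simp: even_words_def)
      have "val plus u' = g"
        using signed.act_cancels_star[OF u'(1) uI, of "(\<one>, plus)"] u by (simp add: val_def)
      with that have "u' \<noteq> []" by (auto simp: val_def)
      let ?x = "to_hyperboloid z"
      have "- mink ?x (foldr mirror u ?x) \<ge> sqrt (1 + \<eta>\<^sup>2)"
        using displacement[OF to_hyperboloid_mem[OF z] u'E u'(2) \<open>u' \<noteq> []\<close>]
          walls.act_cancels_star[OF u'(1) uI to_hyperboloid_mem[OF z]] by simp
      moreover have "hyp_dist z (plane_act g z) = arcosh (- mink ?x (foldr mirror u ?x))"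
        using U[OF z] z by (simp add: u plane_act_val[OF u(1)] hyp_dist_arcosh of_hyperboloid_mem to_of_hyperboloid)
      moreover have "sqrt (1 + \<eta>\<^sup>2) \<ge> 1" by simp
      ultimately show ?thesis
        using arcosh_less_iff_real[of "- mink ?x (foldr mirror u ?x)" "sqrt (1 + \<eta>\<^sup>2)"]
        unfolding \<epsilon>_def by linarith
    qed
  next
    fix z assume z: "z \<in> upper_half_plane"
    have nil: "[] \<in> even_words" by (simp add: even_words_def)
    show "plane_act \<one>\<^bsub>?H\<^esub> z = z"
      using plane_act_val[OF nil z] z by (simp add: val_def of_to_hyperboloid)
    obtain w where w: "w \<in> even_words" "height (foldr mirror w (to_hyperboloid z)) \<le> tile_height"
      using cocompact[OF to_hyperboloid_mem[OF z]] by blast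
    let ?y = "plane_act (val plus w) z"
    have yU: "?y \<in> upper_half_plane" and y: "to_hyperboloid ?y = foldr mirror w (to_hyperboloid z)"
      using act_hyperboloid[OF w(1) z] by (simp_all add: plane_act_val[OF w(1) z] of_hyperboloid_mem to_of_hyperboloid)
    have "((cmod ?y)\<^sup>2 + 1) / (2 * Im ?y) \<le> tile_height"
      using w(2) unfolding y[symmetric] by (simp add: to_hyperboloid_def height_def)
    then have "?y \<in> C" using yU by (simp add: C_def upper_half_plane_def divide_le_eq mult.commute mult.left_commute)
    then show "\<exists>g\<in>carrier ?H. plane_act g z \<in> C" using w by (auto simp: image_group_def)
  next
    have "1 + \<eta>\<^sup>2 > 1" using \<eta>_pos by simp
    then show "\<epsilon> > 0" unfolding \<epsilon>_def by (subst arcosh_real_gt_1_iff) auto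
  qed (use C CU in auto)
  show ?thesis by (rule is_surface_group)
qed

theorem surface_subgroup_image: "surface_subgroup image_group G"
  unfolding surface_subgroup_def using subgroup_image surface_group_image by blast

text \<open>These contain the Schreier generators of the even words for the representatives \<open>odd_letters\<close>: two
representatives and one letter.\<close>

definition schreier :: "'g set" where
  "schreier = val plus ` {w \<in> even_words. length w \<le> 2 * n + 1}"

lemma finite_schreier: "finite schreier"
proof -
  have "finite {w. set w \<subseteq> {..<n} \<and> length w \<le> 2 * n + 1}" by (rule finite_lists_length_le) simp
  then have "finite {w \<in> even_words. length w \<le> 2 * n + 1}"
    by (rule finite_subset[rotated]) (auto simp: even_words_def)
  then show ?thesis by (simp add: schreier_def)
qed

text \<open>Between consecutive letters of the word, insert the inverse of the coset representative of the prefix and that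
representative itself.\<close>

lemma schreier_rewriting:
  "set w \<subseteq> {..<n} \<Longrightarrow>
    \<exists>fs. length fs = length w \<and> set fs \<subseteq> schreier \<and> val plus (w @ rev (odd_letters w)) = foldr (\<otimes>) fs \<one>"
proof (induction w rule: rev_induct)
  case Nil
  then show ?case by (auto simp: val_def odd_letters_def)
next
  case (snoc i w)
  then obtain fs where fs: "length fs = length w" "set fs \<subseteq> schreier"
      "val plus (w @ rev (odd_letters w)) = foldr (\<otimes>) fs \<one>" by auto
  let ?s = "odd_letters w" and ?s' = "odd_letters (w @ [i])"
  have I: "set w \<subseteq> {..<n}" "i < n" using snoc.prems by auto
  have 1: "w @ rev ?s \<in> even_words"
    using I odd_letters_set odd_letters_even[OF I(1)] by (auto simp: even_words_def count_list_append count_list_rev)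
  have "even (count_list ?s j + count_list [i] j + count_list ?s' j)" for j
    using odd_letters_even[OF I(1), of j] odd_letters_even[OF snoc.prems, of j]
    by (simp add: count_list_append)
  then have 2: "?s @ [i] @ rev ?s' \<in> even_words"
    using I odd_letters_set by (auto simp: even_words_def count_list_append count_list_rev add.assoc)
  have "length (?s @ [i] @ rev ?s') \<le> 2 * n + 1"
    using odd_letters_set(2)[of w] odd_letters_set(2)[of "w @ [i]"] by simp
  then have mem: "val plus (?s @ [i] @ rev ?s') \<in> schreier" using 2 by (auto simp: schreier_def)
  have "val plus ((w @ [i]) @ rev ?s') = val plus ((w @ rev ?s) @ (?s @ [i] @ rev ?s'))"
  proof -
    let ?p = "foldr turn [i] (foldr turn (rev ?s') (\<one>, plus))"
    have "foldr turn (rev ?s') (\<one>, plus) \<in> states"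
      using odd_letters_set by (intro signed.act_closed) auto
    then have "?p \<in> states" using I signed.t_closed[of i] by simp
    then have "foldr turn (rev ?s) (foldr turn ?s ?p) = ?p"
      using odd_letters_set by (intro signed.act_rev) auto
    then show ?thesis by (simp add: val_def)
  qed
  also have "\<dots> = foldr (\<otimes>) fs \<one> \<otimes> val plus (?s @ [i] @ rev ?s')"
    using val_append[OF 1 2] fs by simp
  also have "\<dots> = foldr (\<otimes>) (fs @ [val plus (?s @ [i] @ rev ?s')]) \<one>"
  proof -
    have "schreier \<subseteq> carrier G" using val_closed by (auto simp: schreier_def even_words_def)
    then have "set fs \<subseteq> carrier G" "val plus (?s @ [i] @ rev ?s') \<in> carrier G" using fs(2) mem by blast+
    then show ?thesis
      using foldr_mult_append[of fs "[val plus (?s @ [i] @ rev ?s')]"] by (simp del: foldr_append)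
  qed
  finally show ?case
    using fs mem by (intro exI[of _ "fs @ [val plus (?s @ [i] @ rev ?s')]"]) auto
qed

lemma schreier_factors:
  assumes w: "w \<in> even_words"
  shows "\<exists>fs. length fs = length w \<and> set fs \<subseteq> schreier \<and> val plus w = foldr (\<otimes>) fs \<one>"
proof -
  have "odd_letters w = []" using w by (auto simp: odd_letters_def even_words_def)
  then show ?thesis using schreier_rewriting[of w] w by (auto simp: even_words_def)
qed

lemma schreier_generates: "finite_generating_set (G\<lparr>carrier := image_group\<rparr>) schreier"
proof -
  let ?H = "G\<lparr>carrier := image_group\<rparr>"
  interpret H: group ?H using subgroup.subgroup_is_group[OF subgroup_image is_group] .
  have sub: "schreier \<subseteq> carrier ?H" by (auto simp: schreier_def image_group_def)
  have "foldr (\<otimes>) fs \<one> \<in> generate ?H schreier" if "set fs \<subseteq> schreier" for fs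
    using that
  proof (induction fs)
    case Nil
    then show ?case using generate.one[of ?H schreier] by simp
  next
    case (Cons f fs)
    then show ?case
      using generate.eng[of f ?H schreier "foldr (\<otimes>) fs \<one>"] generate.incl[of f schreier ?H] by simp
  qed
  then have "carrier ?H \<subseteq> generate ?H schreier"
    using schreier_factors by (fastforce simp: image_group_def)
  then show ?thesis
    using H.generate_incl[OF sub] finite_schreier sub unfolding finite_generating_set_def by blast
qed

end

locale rigid_group_ping_pong = group_ping_pong G n gen gap D 0 T
  for G :: "('g, 'b) monoid_scheme" (structure) and n gen gap D T +
  fixes A :: "'g set" and L :: real
  assumes A_generates: "finite_generating_set G A"
    and gap_lipschitz: "i < n \<Longrightarrow> x \<in> carrier G \<Longrightarrow> s \<in> A \<union> m_inv G ` A \<Longrightarrow> gap i (x \<otimes> s) \<le> gap i x + L"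
    and L_nonneg: "L \<ge> 0" and T_larger: "T \<ge> 2 * D + L + 1"
begin

sublocale rigid: rigid_ping_pong "{..<n}" "cyc_adj n" turn states "\<lambda>i p. gap i (fst p)" D D T "D + 1" ..

text \<open>For an occurrence of the letter \<open>i\<close> after the prefix \<open>u\<close> of \<open>w\<close>, consider \<open>gap i\<close> of \<open>u\<^sup>-\<^sup>1 x\<close>
while \<open>x\<close> runs along a path from the identity to the value of \<open>w\<close>. It starts near and ends far, so there is a step at which it
exceeds the threshold \<open>\<tau>\<close>. At a step where this happens for one occurrence, \<open>x\<close> is still far
from the other end of the corresponding translation by \<open>a\<^sub>i\<close>, hence near for all later occurrences of \<open>i\<close>, and one step does not suffice
to exceed the threshold for those.\<close>

lemma crossings:
  assumes w: "reduced (cyc_adj n) w" "set w \<subseteq> {..<n}" and i: "i < n"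
    and ws: "set ws \<subseteq> A \<union> m_inv G ` A" "foldr (\<otimes>) ws \<one> = val plus w"
  shows "card {j. j < length w \<and> w ! j = i} \<le> length ws"
proof -
  define x where "x t = foldr (\<otimes>) (take t ws) \<one>" for t
  define \<sigma> where "\<sigma> = snd (foldr turn w (\<one>, plus))"
  \<comment> \<open>The signs \<open>\<sigma>\<close> are those at the end of \<open>w\<close>, so that the reversed prefix undoes the prefix.\<close>
  define f where "f j y = gap i (fst (foldr turn (rev (take j w)) (y, \<sigma>)))" for j y
  have wsG: "set ws \<subseteq> carrier G" using ws generating_set_closed[OF A_generates] by blast
  have x_closed: "x t \<in> carrier G" for t
    unfolding x_def using wsG by (intro foldr_mult_closed) (meson in_set_takeD subset_iff)
  have x_step: "x (Suc t) = x t \<otimes> ws ! t" if "t < length ws" for t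
  proof -
    have c: "set (take t ws) \<subseteq> carrier G" "ws ! t \<in> carrier G"
      using wsG that by (meson in_set_takeD subset_iff, meson nth_mem subset_iff)
    have "foldr (\<otimes>) (take t ws @ [ws ! t]) \<one> = foldr (\<otimes>) (take t ws) \<one> \<otimes> foldr (\<otimes>) [ws ! t] \<one>"
      using c by (intro foldr_mult_append) auto
    then show ?thesis using that c unfolding x_def by (simp add: take_Suc_conv_app_nth)
  qed
  have x0: "x 0 = \<one>" and xL: "x (length ws) = val plus w" using ws by (simp_all add: x_def)
  have end_state: "foldr turn w (\<one>, plus) = (val plus w, \<sigma>)"
    using act_turn[OF w(2), of \<one> plus] val_closed[OF w(2)] by (simp add: \<sigma>_def)
  have base: "gap b (fst (\<one>, \<tau>)) \<le> D" if "b \<in> {..<n}" for b and \<tau> :: "nat \<Rightarrow> bool"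
    using gap_one that by simp
  have split: "w = take j w @ i # drop (Suc j) w" if "j < length w" "w ! j = i" for j
    using that by (metis id_take_nth_drop)
  have f_eq: "f j y = gap i (val \<sigma> (rev (take j w)) \<otimes> y)" if "y \<in> carrier G" for j y
  proof -
    have "set (rev (take j w)) \<subseteq> {..<n}" using w(2) set_take_subset by fastforce
    then show ?thesis using act_turn that by (simp add: f_def)
  qed
  have f_step: "f j (x (Suc t)) \<le> f j (x t) + L" if t: "t < length ws" for j t
  proof -
    let ?g = "val \<sigma> (rev (take j w))"
    have g: "?g \<in> carrier G" using w(2) set_take_subset by (intro val_closed) fastforce
    have s: "ws ! t \<in> A \<union> m_inv G ` A" "ws ! t \<in> carrier G" using ws(1) wsG t nth_mem by blast+
    have "gap i (?g \<otimes> x t \<otimes> ws ! t) \<le> gap i (?g \<otimes> x t) + L"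
      using gap_lipschitz[OF i _ s(1)] g x_closed by simp
    then show ?thesis using f_eq x_closed x_step[OF t] g s by (simp add: m_assoc)
  qed
  have f_start: "f j (x 0) \<le> D" if j: "j < length w" "w ! j = i" for j
  proof -
    have s: "w = take j w @ i # drop (Suc j) w" by (rule split[OF j])
    then have "reduced (cyc_adj n) ((take j w @ [i]) @ drop (Suc j) w)" using w(1) by simp
    then have "reduced (cyc_adj n) (take j w @ [i])" using reduced_append by blast
    then have "reduced (cyc_adj n) (rev (take j w @ [i]))" by (simp only: reduced_rev)
    then have "reduced (cyc_adj n) (i # rev (take j w))" by simp
    moreover have "set (i # rev (take j w)) \<subseteq> {..<n}" using w(2) i set_take_subset by fastforce
    ultimately show ?thesis
      unfolding f_def x0 using base by (intro rigid.near_base_after_word) auto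
  qed
  have f_end: "f j (x (length ws)) \<ge> T - D" if j: "j < length w" "w ! j = i" for j
  proof -
    let ?u = "take j w" and ?v = "drop (Suc j) w"
    have s: "w = ?u @ i # ?v" by (rule split[OF j])
    have sub: "set ?u \<subseteq> {..<n}" "set ?v \<subseteq> {..<n}" using w(2) set_take_subset set_drop_subset by fastforce+
    let ?p = "foldr turn ?v (\<one>, plus)"
    have pZ: "?p \<in> states" using sub by (intro signed.act_closed) auto
    have "reduced (cyc_adj n) (i # ?v)" using w(1) s reduced_append by metis
    then have "gap i (fst ?p) \<le> D"
      using sub i base by (intro rigid.near_base_after_word) auto
    then have big: "gap i (fst (turn i ?p)) \<ge> T - D"
      using signed.N_self[of i ?p] i pZ by simp
    have tZ: "turn i ?p \<in> states" using signed.t_closed[of i ?p] i pZ by simp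
    have "(val plus w, \<sigma>) = foldr turn ?u (turn i ?p)"
      using end_state arg_cong[OF s, of "\<lambda>v. foldr turn v (\<one>, plus)"] by simp
    then have "foldr turn (rev ?u) (val plus w, \<sigma>) = turn i ?p"
      using signed.act_rev[OF sub(1) tZ] by simp
    then show ?thesis using big by (simp add: f_def xL)
  qed
  define \<tau> where "\<tau> = D + L"
  have crossing: "\<exists>t<length ws. f j (x t) \<le> \<tau> \<and> f j (x (Suc t)) > \<tau>" if j: "j < length w" "w ! j = i" for j
  proof -
    define t where "t = (LEAST t. f j (x t) > \<tau>)"
    have big: "f j (x (length ws)) > \<tau>" using f_end[OF j] T_larger by (simp add: \<tau>_def)
    have t: "f j (x t) > \<tau>" unfolding t_def using big by (rule LeastI)
    have "t \<le> length ws" unfolding t_def using big by (rule Least_le)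
    have "t \<noteq> 0"
    proof
      assume "t = 0"
      then have "f j (x 0) > \<tau>" using t by simp
      then show False using f_start[OF j] L_nonneg by (simp add: \<tau>_def)
    qed
    then obtain t' where t': "t = Suc t'" by (cases t) auto
    have "\<not> f j (x t') > \<tau>" using not_less_Least[of t' "\<lambda>t. f j (x t) > \<tau>"] t' by (simp add: t_def)
    then show ?thesis using t t' \<open>t \<le> length ws\<close> by (intro exI[of _ t']) auto
  qed
  then obtain time where time: "\<And>j. j < length w \<Longrightarrow> w ! j = i \<Longrightarrow>
      time j < length ws \<and> f j (x (time j)) \<le> \<tau> \<and> f j (x (Suc (time j))) > \<tau>" by metis
  have distinct_times: "time j \<noteq> time l" if jl: "j < l" "l < length w" "w ! j = i" "w ! l = i" for j l
  proof
    assume eq: "time j = time l"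
    define y where "y = x (time j)"
    have j: "j < length w" using jl by simp
    have fj: "f j y \<le> \<tau>" using time[OF j jl(3)] by (simp add: y_def)
    have "f l (x (Suc (time l))) \<le> f l y + L"
      using f_step time[OF jl(2,4)] eq by (simp add: y_def)
    then have fl: "f l y > D" using time[OF jl(2,4)] by (simp add: \<tau>_def)
    let ?u = "take j w" and ?m = "drop (Suc j) (take l w)" and ?v = "drop (Suc l) w"
    have tl: "take l w = ?u @ i # ?m"
    proof -
      have "take l w = take j (take l w) @ take l w ! j # drop (Suc j) (take l w)"
        using jl by (intro id_take_nth_drop) simp
      then show ?thesis using jl by (simp add: min_def)
    qed
    have "w = (?u @ i # ?m) @ i # ?v" using split[OF jl(2,4)] tl by simp
    then have "w = ?u @ (i # ?m @ [i]) @ ?v" by simp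
    then have red: "reduced (cyc_adj n) (i # ?m @ [i])" using w(1) reduced_append by metis
    have sub: "set ?u \<subseteq> {..<n}" "set ?m \<subseteq> {..<n}"
      using w(2) set_take_subset[of j w] set_take_subset[of l w] set_drop_subset[of "Suc j" "take l w"] by blast+
    let ?p = "foldr turn (rev ?u) (y, \<sigma>)"
    have pZ: "?p \<in> states" using sub x_closed by (intro signed.act_closed) (auto simp: y_def)
    have "gap i (fst (turn i ?p)) \<ge> T - f j y"
      using signed.N_self[of i ?p] pZ i by (simp add: f_def)
    then have "gap i (fst (turn i ?p)) \<ge> D + 1" using fj T_larger by (simp add: \<tau>_def)
    moreover have "turn i ?p \<in> states" using signed.t_closed[of i ?p] i pZ by simp
    ultimately have "gap i (fst (foldr turn (rev ?m) (turn i ?p))) \<le> D"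
      using red sub i by (intro rigid.far_then_near) auto
    moreover have "rev (take l w) = rev ?m @ [i] @ rev ?u"
      using arg_cong[OF tl, of rev] by (simp only: rev_append rev.simps append_assoc)
    ultimately have "f l y \<le> D" by (simp add: f_def)
    with fl show False by simp
  qed
  have "inj_on time {j. j < length w \<and> w ! j = i}"
    by (rule linorder_inj_onI) (use distinct_times in auto)
  moreover have "time ` {j. j < length w \<and> w ! j = i} \<subseteq> {..<length ws}" using time by auto
  ultimately show ?thesis using card_inj_on_le[of time _ "{..<length ws}"] by simp
qed

lemma length_reduced_le:
  assumes w: "reduced (cyc_adj n) w" "set w \<subseteq> {..<n}"
  shows "length w \<le> n * word_length G A (val plus w)"
proof -
  obtain ws where ws: "set ws \<subseteq> A \<union> m_inv G ` A" "foldr (\<otimes>) ws \<one> = val plus w"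
      "length ws = word_length G A (val plus w)"
    using word_length_attained[OF A_generates val_closed[OF w(2)]] .
  have "{..<length w} = (\<Union>i<n. {j. j < length w \<and> w ! j = i})" using w(2) nth_mem by fastforce
  then have "length w = card (\<Union>i<n. {j. j < length w \<and> w ! j = i})" by (metis card_lessThan)
  also have "\<dots> \<le> (\<Sum>i<n. card {j. j < length w \<and> w ! j = i})" by (rule card_UN_le) simp
  also have "\<dots> \<le> (\<Sum>i<n. length ws)" by (intro sum_mono crossings[OF w _ ws(1,2)]) simp
  finally show ?thesis using ws(3) by simp
qed

theorem undistorted_image: "undistorted G image_group"
proof -
  let ?H = "G\<lparr>carrier := image_group\<rparr>"
  interpret H: group ?H using subgroup.subgroup_is_group[OF subgroup_image is_group] .
  have sub: "schreier \<subseteq> carrier ?H" using schreier_generates by (simp add: finite_generating_set_def)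
  obtain k where k: "\<And>fs. set fs \<subseteq> schreier \<Longrightarrow> word_length ?H schreier (foldr (\<otimes>) fs \<one>) \<le> k * length fs"
    using H.word_length_comparison[OF schreier_generates finite_schreier sub] by auto
  have "word_length ?H schreier h \<le> k * n * word_length G A h" if h_mem: "h \<in> image_group" for h
  proof -
    obtain w where w: "w \<in> even_words" "h = val plus w" using h_mem by (auto simp: image_group_def)
    have wI: "set w \<subseteq> {..<n}" using w by (simp add: even_words_def)
    obtain w' where w': "(cancels (cyc_adj n))\<^sup>*\<^sup>* w w'" "reduced (cyc_adj n) w'" using cancels_to_reduced by blast
    have w'E: "w' \<in> even_words"
      using w(1) cancels_parity[OF w'(1)] cancels_set[OF w'(1)] by (auto simp: even_words_def)
    have h: "val plus w' = h"
      using signed.act_cancels_star[OF w'(1) wI, of "(\<one>, plus)"] w by (simp add: val_def)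
    obtain fs where fs: "length fs = length w'" "set fs \<subseteq> schreier" "val plus w' = foldr (\<otimes>) fs \<one>"
      using schreier_factors[OF w'E] by blast
    have "word_length ?H schreier h \<le> k * length w'" using k[OF fs(2)] fs h by simp
    also have "\<dots> \<le> k * (n * word_length G A h)"
      using length_reduced_le[OF w'(2)] w'E h by (intro mult_le_mono2) (auto simp: even_words_def)
    finally show ?thesis by (simp add: mult.assoc)
  qed
  then show ?thesis
    by (rule undistortedI[OF subgroup_image A_generates schreier_generates])
qed

end

section \<open>Projections in hierarchically hyperbolic groups\<close>

lemma set_dist_le: "(\<And>a b. 0 \<le> d a b) \<Longrightarrow> a \<in> A \<Longrightarrow> b \<in> B \<Longrightarrow> set_dist d A B \<le> d a b"
  unfolding set_dist_def by (intro cInf_lower bdd_belowI[of _ 0]) auto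

lemma set_dist_ge:
  "A \<noteq> {} \<Longrightarrow> B \<noteq> {} \<Longrightarrow> (\<And>a b. a \<in> A \<Longrightarrow> b \<in> B \<Longrightarrow> r \<le> d a b) \<Longrightarrow> r \<le> set_dist d A B"
  unfolding set_dist_def by (intro cInf_greatest) auto

lemma set_dist_attained:
  assumes "A \<noteq> {}" "B \<noteq> {}" "set_dist d A B < r"
  obtains a b where "a \<in> A" "b \<in> B" "d a b < r"
proof -
  have "\<exists>a\<in>A. \<exists>b\<in>B. d a b < r"
  proof (rule ccontr)
    assume "\<not> ?thesis"
    then have "r \<le> set_dist d A B" using assms(1,2) by (intro set_dist_ge) (auto simp: not_less)
    with assms(3) show False by simp
  qed
  then show ?thesis using that by blast
qed

lemma set_dist_isometry:
  assumes f: "isometry M d N e f" and "A \<subseteq> M" "B \<subseteq> M"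
  shows "set_dist e (f ` A) (f ` B) = set_dist d A B"
proof -
  have "{e a b | a b. a \<in> f ` A \<and> b \<in> f ` B} = {e (f a) (f b) | a b. a \<in> A \<and> b \<in> B}" by blast
  also have "\<dots> = {d a b | a b. a \<in> A \<and> b \<in> B}"
    using assms unfolding isometry_def by (metis (no_types, opaque_lifting) subset_iff)
  finally show ?thesis by (simp add: set_dist_def)
qed

text \<open>The constants hidden in the definition of a hierarchically hyperbolic group, the generating set and \<open>E\<close>, are
fixed here.\<close>

locale hhg = group G for G :: "('g, 'b) monoid_scheme" (structure) +
  fixes S :: "('g, 'u, 'p, 'z) hhg_structure_scheme" and A :: "'g set" and E :: real
  assumes generators: "finite_generating_set G A"
    and hhs: "hhs (carrier G) (word_dist G A) S E"
    and automorphism: "g \<in> carrier G \<Longrightarrow>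
      hhs_automorphism (carrier G) (word_dist G A) S (\<lambda>x. g \<otimes> x) (dom_act S g) (iso_act S g)"
    and action: "group_action G (domains S) (dom_act S)"
    and iso_act_one: "U \<in> domains S \<Longrightarrow> p \<in> cspace S U \<Longrightarrow> iso_act S \<one> U p = p"
    and iso_act_mult: "g \<in> carrier G \<Longrightarrow> h \<in> carrier G \<Longrightarrow> U \<in> domains S \<Longrightarrow> p \<in> cspace S U \<Longrightarrow>
      iso_act S (g \<otimes> h) U p = iso_act S g (dom_act S h U) (iso_act S h U p)"
    and cofinite: "finite (orbits G (domains S) (dom_act S))"
    and proj_equivariant: "g \<in> carrier G \<Longrightarrow> h \<in> carrier G \<Longrightarrow> U \<in> domains S \<Longrightarrow>
      iso_act S g U ` cproj S U h = cproj S (dom_act S g U) (g \<otimes> h)"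
    and rho_equivariant: "g \<in> carrier G \<Longrightarrow> U \<in> domains S \<Longrightarrow> V \<in> domains S \<Longrightarrow>
      transverse S U V \<or> pnested S V U \<Longrightarrow>
      iso_act S g U ` rho S V U = rho S (dom_act S g V) (dom_act S g U)"

lemma hierarchically_hyperbolic_groupD:
  assumes "hierarchically_hyperbolic_group G S"
  shows "\<exists>A E. hhg G S A E"
proof -
  note H = assms[unfolded hierarchically_hyperbolic_group_def hierarchically_hyperbolic_space_def]
  from H obtain A E where "finite_generating_set G A" "hhs (carrier G) (word_dist G A) S E"
      "\<forall>g\<in>carrier G. hhs_automorphism (carrier G) (word_dist G A) S (\<lambda>x. g \<otimes>\<^bsub>G\<^esub> x) (dom_act S g) (iso_act S g)"
    by (elim conjE exE) (rule that)
  with H have "hhg G S A E"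
    unfolding hhg_def hhg_axioms_def by (intro conjI allI impI; ((simp; fail) | blast))
  then show ?thesis by blast
qed

context hhg begin

sublocale X: hhs "carrier G" "word_dist G A" S E by (rule hhs)
interpretation act: group_action G "domains S" "dom_act S" by (rule action)

lemma metric: "U \<in> domains S \<Longrightarrow> Metric_space (cspace S U) (cdist S U)"
  using X.hyperbolic unfolding hyperbolic_geodesic_space_def geodesic_space_def by blast

lemma cdist_nonneg: "U \<in> domains S \<Longrightarrow> 0 \<le> cdist S U a b"
  by (rule Metric_space.nonneg[OF metric])

lemma cdist_commute: "U \<in> domains S \<Longrightarrow> cdist S U a b = cdist S U b a"
  by (rule Metric_space.commute[OF metric])

lemma cdist_triangle: "U \<in> domains S \<Longrightarrow> a \<in> cspace S U \<Longrightarrow> b \<in> cspace S U \<Longrightarrow> c \<in> cspace S U \<Longrightarrow>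
    cdist S U a c \<le> cdist S U a b + cdist S U b c"
  by (rule Metric_space.triangle[OF metric])

lemma cdist_self: "U \<in> domains S \<Longrightarrow> a \<in> cspace S U \<Longrightarrow> cdist S U a a = 0"
  by (simp add: Metric_space.zero[OF metric])

lemma iso_isometry:
  assumes g: "g \<in> carrier G" and U: "U \<in> domains S"
  shows "isometry (cspace S U) (cdist S U) (cspace S (dom_act S g U)) (cdist S (dom_act S g U)) (iso_act S g U)"
proof -
  have "\<forall>U\<in>domains S.
      isometry (cspace S U) (cdist S U) (cspace S (dom_act S g U)) (cdist S (dom_act S g U)) (iso_act S g U)"
    using automorphism[OF g] unfolding hhs_automorphism_def by (elim conjE)
  then show ?thesis using U by (rule bspec)
qed

lemma dom_act_closed: "g \<in> carrier G \<Longrightarrow> U \<in> domains S \<Longrightarrow> dom_act S g U \<in> domains S"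
  using act.element_image by blast

lemma dom_act_mult: "g \<in> carrier G \<Longrightarrow> h \<in> carrier G \<Longrightarrow> U \<in> domains S \<Longrightarrow>
    dom_act S (g \<otimes> h) U = dom_act S g (dom_act S h U)"
  using act.composition_rule by blast

lemma dom_act_one: "U \<in> domains S \<Longrightarrow> dom_act S \<one> U = U"
  using act.id_eq_one by (metis restrict_apply')

lemma dom_act_inv: "g \<in> carrier G \<Longrightarrow> U \<in> domains S \<Longrightarrow> dom_act S g (dom_act S (inv g) U) = U"
  using dom_act_mult[of g "inv g" U] dom_act_one by simp

lemma dom_act_relations:
  assumes "g \<in> carrier G" "U \<in> domains S" "V \<in> domains S"
  shows "orth S (dom_act S g U) (dom_act S g V) \<longleftrightarrow> orth S U V"
    and "nested S (dom_act S g U) (dom_act S g V) \<longleftrightarrow> nested S U V"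
    and "transverse S (dom_act S g U) (dom_act S g V) \<longleftrightarrow> transverse S U V"
proof -
  have "\<forall>U\<in>domains S. \<forall>V\<in>domains S.
      (nested S (dom_act S g U) (dom_act S g V) \<longleftrightarrow> nested S U V) \<and>
      (orth S (dom_act S g U) (dom_act S g V) \<longleftrightarrow> orth S U V) \<and>
      (transverse S (dom_act S g U) (dom_act S g V) \<longleftrightarrow> transverse S U V)"
    using automorphism[OF assms(1)] unfolding hhs_automorphism_def by (elim conjE)
  then show "orth S (dom_act S g U) (dom_act S g V) \<longleftrightarrow> orth S U V"
    "nested S (dom_act S g U) (dom_act S g V) \<longleftrightarrow> nested S U V"
    "transverse S (dom_act S g U) (dom_act S g V) \<longleftrightarrow> transverse S U V"
    using assms(2,3) by simp_all
qed

lemma dom_act_bounded: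
  assumes g: "g \<in> carrier G" and U: "U \<in> domains S"
  shows "diam_le (cdist S (dom_act S g U)) (cspace S (dom_act S g U)) r \<longleftrightarrow> diam_le (cdist S U) (cspace S U) r"
proof -
  note I = iso_isometry[OF g U, unfolded isometry_def]
  have image: "iso_act S g U ` cspace S U = cspace S (dom_act S g U)" using I by (rule conjunct1)
  have dist: "\<forall>a\<in>cspace S U. \<forall>b\<in>cspace S U.
      cdist S (dom_act S g U) (iso_act S g U a) (iso_act S g U b) = cdist S U a b"
    using I by (rule conjunct2)
  show ?thesis unfolding diam_le_def image[symmetric] by (simp add: dist)
qed

lemma dom_act_unbounded:
  "g \<in> carrier G \<Longrightarrow> U \<in> domains S \<Longrightarrow> dom_act S g U \<in> unbounded_domains S \<longleftrightarrow> U \<in> unbounded_domains S"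
  using dom_act_bounded dom_act_closed by (simp add: unbounded_domains_def)

lemma unbounded_domain: "U \<in> unbounded_domains S \<Longrightarrow> U \<in> domains S"
  by (simp add: unbounded_domains_def)

lemma proj_closed: "U \<in> domains S \<Longrightarrow> x \<in> carrier G \<Longrightarrow> b \<in> cproj S U x \<Longrightarrow> b \<in> cspace S U"
  using X.proj_subset by blast

lemma proj_nonempty: "U \<in> domains S \<Longrightarrow> x \<in> carrier G \<Longrightarrow> cproj S U x \<noteq> {}"
  using X.proj_subset by blast

lemma proj_diam: "U \<in> domains S \<Longrightarrow> x \<in> carrier G \<Longrightarrow> a \<in> cproj S U x \<Longrightarrow> b \<in> cproj S U x \<Longrightarrow> cdist S U a b \<le> E"
  using X.proj_subset unfolding diam_le_def by blast

lemma pow_stable: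
  assumes g: "g \<in> carrier G" and U: "U \<in> domains S" and st: "dom_act S g U = U"
  shows "dom_act S (g [^] (k::nat)) U = U"
proof (induction k)
  case 0
  then show ?case using dom_act_one[OF U] by simp
next
  case (Suc k)
  then show ?case using dom_act_mult[of "g [^] k" g U] g U st by simp
qed

lemma pow_trivial:
  assumes g: "g \<in> carrier G" and U: "U \<in> domains S" and st: "dom_act S g U = U"
    and tr: "\<And>p. p \<in> cspace S U \<Longrightarrow> iso_act S g U p = p" and p: "p \<in> cspace S U"
  shows "iso_act S (g [^] (k::nat)) U p = p"
proof (induction k)
  case 0
  then show ?case using iso_act_one[OF U p] by simp
next
  case (Suc k)
  then show ?case using iso_act_mult[of "g [^] k" g U p] g U st tr p by simp
qed

subsection \<open>Distance to a base point of a domain\<close>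

definition gap :: "'u \<Rightarrow> 'p \<Rightarrow> 'g \<Rightarrow> real" where
  "gap U p x = set_dist (cdist S U) {p} (cproj S U x)"

lemma gap_le: "U \<in> domains S \<Longrightarrow> b \<in> cproj S U x \<Longrightarrow> gap U p x \<le> cdist S U p b"
  unfolding gap_def using cdist_nonneg by (intro set_dist_le) auto

lemma gap_ge: "U \<in> domains S \<Longrightarrow> x \<in> carrier G \<Longrightarrow> (\<And>b. b \<in> cproj S U x \<Longrightarrow> r \<le> cdist S U p b) \<Longrightarrow> r \<le> gap U p x"
  unfolding gap_def using proj_nonempty by (intro set_dist_ge) auto

lemma gap_upper:
  assumes U: "U \<in> domains S" and x: "x \<in> carrier G" and p: "p \<in> cspace S U" and b: "b \<in> cproj S U x"
  shows "cdist S U p b \<le> gap U p x + E"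
proof -
  have "cdist S U p b - E \<le> gap U p x"
  proof (rule gap_ge[OF U x])
    fix b' assume b': "b' \<in> cproj S U x"
    have "cdist S U p b \<le> cdist S U p b' + cdist S U b' b"
      using p proj_closed[OF U x] b b' by (intro cdist_triangle[OF U]) auto
    then show "cdist S U p b - E \<le> cdist S U p b'" using proj_diam[OF U x b' b] by linarith
  qed
  then show ?thesis by simp
qed

lemma stable_proj:
  assumes "h \<in> carrier G" "x \<in> carrier G" "U \<in> domains S" "dom_act S h U = U"
  shows "cproj S U (h \<otimes> x) = iso_act S h U ` cproj S U x"
  using proj_equivariant[of h x U] assms by simp

lemma stable_iso:
  assumes "h \<in> carrier G" "U \<in> domains S" "dom_act S h U = U"
  shows "a \<in> cspace S U \<Longrightarrow> iso_act S h U a \<in> cspace S U"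
    and "a \<in> cspace S U \<Longrightarrow> b \<in> cspace S U \<Longrightarrow> cdist S U (iso_act S h U a) (iso_act S h U b) = cdist S U a b"
  using iso_isometry[OF assms(1,2)] unfolding assms(3) isometry_def by (metis imageI, metis)

lemma gap_small_move:
  assumes h: "h \<in> carrier G" and x: "x \<in> carrier G" and U: "U \<in> domains S" and st: "dom_act S h U = U"
    and p: "p \<in> cspace S U"
  shows "\<bar>gap U p (h \<otimes> x) - gap U p x\<bar> \<le> cdist S U p (iso_act S h U p)"
proof -
  let ?h = "iso_act S h U"
  note I = stable_iso[OF h U st]
  have "gap U p (h \<otimes> x) - cdist S U p (?h p) \<le> gap U p x"
  proof (rule gap_ge[OF U x])
    fix b assume b: "b \<in> cproj S U x"
    then have "b \<in> cspace S U" using proj_closed[OF U x] by blast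
    have "gap U p (h \<otimes> x) \<le> cdist S U p (?h b)"
      using b stable_proj[OF h x U st] by (intro gap_le[OF U]) auto
    also have "\<dots> \<le> cdist S U p (?h p) + cdist S U (?h p) (?h b)"
      using I p \<open>b \<in> cspace S U\<close> by (intro cdist_triangle[OF U]) auto
    finally show "gap U p (h \<otimes> x) - cdist S U p (?h p) \<le> cdist S U p b"
      using I p \<open>b \<in> cspace S U\<close> by simp
  qed
  moreover have "gap U p x - cdist S U p (?h p) \<le> gap U p (h \<otimes> x)"
  proof (rule gap_ge[OF U])
    fix b assume "b \<in> cproj S U (h \<otimes> x)"
    then obtain b' where b': "b' \<in> cproj S U x" "b = ?h b'" using stable_proj[OF h x U st] by auto
    then have c: "b' \<in> cspace S U" using proj_closed[OF U x] by blast
    have "gap U p x \<le> cdist S U p b'" using b' by (intro gap_le[OF U])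
    also have "\<dots> = cdist S U (?h p) b" using I p c b' by simp
    also have "\<dots> \<le> cdist S U (?h p) p + cdist S U p b"
      using I p c b' by (intro cdist_triangle[OF U]) auto
    finally show "gap U p x - cdist S U p (?h p) \<le> cdist S U p b" using cdist_commute[OF U, of p "?h p"] by simp
  qed (use h x in simp)
  ultimately show ?thesis by linarith
qed

text \<open>A point near the base point is moved along with it; the error \<open>E\<close> is the diameter of a projection.\<close>

lemma gap_large_move:
  assumes h: "h \<in> carrier G" and x: "x \<in> carrier G" and U: "U \<in> domains S" and st: "dom_act S h U = U"
    and p: "p \<in> cspace S U"
  shows "gap U p (h \<otimes> x) \<ge> cdist S U p (iso_act S h U p) - E - gap U p x"
proof (rule gap_ge[OF U])
  let ?h = "iso_act S h U"
  note I = stable_iso[OF h U st]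
  fix b assume "b \<in> cproj S U (h \<otimes> x)"
  then obtain b' where b': "b' \<in> cproj S U x" "b = ?h b'" using stable_proj[OF h x U st] by auto
  then have c: "b' \<in> cspace S U" using proj_closed[OF U x] by blast
  have "cdist S U p (?h p) \<le> cdist S U p b + cdist S U b (?h p)"
    using I p c b' by (intro cdist_triangle[OF U]) auto
  also have "cdist S U b (?h p) = cdist S U p b'" using I p c b' cdist_commute[OF U] by simp
  also have "\<dots> \<le> gap U p x + E" using gap_upper[OF U x p b'(1)] .
  finally show "cdist S U p (?h p) - E - gap U p x \<le> cdist S U p b" by simp
qed (use h x in simp)

lemma gap_lipschitz:
  assumes x: "x \<in> carrier G" and s: "s \<in> A \<union> m_inv G ` A" and U: "U \<in> domains S" and p: "p \<in> cspace S U"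
  shows "gap U p (x \<otimes> s) \<le> gap U p x + (3 * E + 1)"
proof -
  have sG: "s \<in> carrier G" using s generating_set_closed[OF generators] by blast
  have xs: "x \<otimes> s \<in> carrier G" using x sG by simp
  have "inv x \<otimes> (x \<otimes> s) = s" using x sG by (simp flip: m_assoc)
  moreover have "word_length G A s \<le> length [s]"
    using s sG by (intro word_length_le) auto
  ultimately have "word_dist G A x (x \<otimes> s) \<le> 1" using x xs by (simp add: word_dist_def)
  then have "E * word_dist G A x (x \<otimes> s) + E \<le> 2 * E" using X.E_pos by simp
  then have "dom_dist S U x (x \<otimes> s) < 2 * E + 1"
    using X.proj_lipschitz[OF U x xs] by linarith
  then obtain b b' where b: "b \<in> cproj S U x" "b' \<in> cproj S U (x \<otimes> s)" "cdist S U b b' < 2 * E + 1"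
    using set_dist_attained[OF proj_nonempty[OF U x] proj_nonempty[OF U xs]] by metis
  have "gap U p (x \<otimes> s) \<le> cdist S U p b'" using b by (intro gap_le[OF U])
  also have "\<dots> \<le> cdist S U p b + cdist S U b b'"
    using p b proj_closed[OF U x] proj_closed[OF U xs] by (intro cdist_triangle[OF U]) auto
  finally show ?thesis using b(3) gap_upper[OF U x p b(1)] by linarith
qed

text \<open>The consistency inequality for transverse domains, with base points in place of the sets \<open>rho\<close>, which have
bounded diameter.\<close>

lemma transverse_domains:
  assumes U: "U \<in> domains S" and V: "V \<in> domains S" and tr: "transverse S U V"
    and p: "p \<in> cspace S U" and q: "q \<in> cspace S V"
  obtains r where "\<And>x. x \<in> carrier G \<Longrightarrow> gap U p x > r \<Longrightarrow> gap V q x \<le> r"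
proof -
  have tr': "transverse S V U" using tr X.orth_sym[OF V U] by (auto simp: transverse_def)
  have bound: "\<exists>r. \<forall>x\<in>carrier G. set_dist (cdist S W) (cproj S W x) (rho S W' W) \<le> E \<longrightarrow> gap W o' x \<le> r"
    if W: "W \<in> domains S" "W' \<in> domains S" "transverse S W' W" "o' \<in> cspace S W" for W W' o'
  proof -
    have rho: "rho S W' W \<subseteq> cspace S W" "rho S W' W \<noteq> {}" "diam_le (cdist S W) (rho S W' W) E"
      using X.rho_transverse W by auto
    then obtain c where c: "c \<in> rho S W' W" by blast
    have "gap W o' x \<le> cdist S W o' c + 2 * E + 1"
      if x: "x \<in> carrier G" "set_dist (cdist S W) (cproj S W x) (rho S W' W) \<le> E" for x
    proof -
      have "set_dist (cdist S W) (cproj S W x) (rho S W' W) < E + 1" using x by simp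
      then obtain b c' where b: "b \<in> cproj S W x" "c' \<in> rho S W' W" "cdist S W b c' < E + 1"
        using set_dist_attained[OF proj_nonempty[OF W(1) x(1)] rho(2)] by metis
      have cs: "b \<in> cspace S W" "c' \<in> cspace S W" "c \<in> cspace S W"
        using proj_closed[OF W(1) x(1)] b c rho by auto
      have "gap W o' x \<le> cdist S W o' b" using b by (intro gap_le[OF W(1)])
      also have "\<dots> \<le> cdist S W o' c + cdist S W c b" using cs W by (intro cdist_triangle[OF W(1)])
      also have "cdist S W c b \<le> cdist S W c c' + cdist S W c' b" using cs W by (intro cdist_triangle[OF W(1)])
      also have "cdist S W c c' \<le> E" using rho(3) c b by (auto simp: diam_le_def)
      finally show ?thesis using b(3) cdist_commute[OF W(1), of b c'] by linarith
    qed
    then show ?thesis by blast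
  qed
  obtain r1 where r1: "\<And>x. x \<in> carrier G \<Longrightarrow> set_dist (cdist S V) (cproj S V x) (rho S U V) \<le> E \<Longrightarrow> gap V q x \<le> r1"
    using bound[OF V U tr q] by blast
  obtain r2 where r2: "\<And>x. x \<in> carrier G \<Longrightarrow> set_dist (cdist S U) (cproj S U x) (rho S V U) \<le> E \<Longrightarrow> gap U p x \<le> r2"
    using bound[OF U V tr' p] by blast
  show ?thesis
  proof (rule that[of "max r1 r2"])
    fix x assume x: "x \<in> carrier G" "gap U p x > max r1 r2"
    then show "gap V q x \<le> max r1 r2"
      using X.consistency_transverse[OF U V tr x(1)] r1[OF x(1)] r2[OF x(1)] by fastforce
  qed
qed

subsection \<open>Rigidly supported elements commute up to powers\<close>

text \<open>There are finitely many orbits of domains, and the diameter is constant on an orbit.\<close>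

lemma bounded_domains_uniform:
  obtains r where "r \<ge> 0" "\<And>W. W \<in> domains S \<Longrightarrow> W \<notin> unbounded_domains S \<Longrightarrow> diam_le (cdist S W) (cspace S W) r"
proof -
  have "\<exists>r. \<forall>W\<in>Or. W \<notin> unbounded_domains S \<longrightarrow> diam_le (cdist S W) (cspace S W) r"
    if Or: "Or \<in> orbits G (domains S) (dom_act S)" for Or
  proof -
    obtain V where V: "V \<in> domains S" "Or = orbit G (dom_act S) V" using Or by (auto simp: orbits_def)
    show ?thesis
    proof (cases "\<exists>r. diam_le (cdist S V) (cspace S V) r")
      case True
      then obtain r where "diam_le (cdist S V) (cspace S V) r" by blast
      then have "\<forall>W\<in>Or. diam_le (cdist S W) (cspace S W) r"
        using dom_act_bounded[OF _ V(1)] by (auto simp: V(2) orbit_def)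
      then show ?thesis by blast
    next
      case False
      then have "V \<in> unbounded_domains S" using V by (simp add: unbounded_domains_def)
      then have "\<forall>W\<in>Or. W \<in> unbounded_domains S"
        using dom_act_unbounded[OF _ V(1)] by (auto simp: V(2) orbit_def)
      then show ?thesis by blast
    qed
  qed
  then obtain R where R: "\<And>Or. Or \<in> orbits G (domains S) (dom_act S) \<Longrightarrow>
      \<forall>W\<in>Or. W \<notin> unbounded_domains S \<longrightarrow> diam_le (cdist S W) (cspace S W) (R Or)"
    by metis
  define r where "r = Max (insert 0 (R ` orbits G (domains S) (dom_act S)))"
  show ?thesis
  proof (rule that[of r])
    show "r \<ge> 0" unfolding r_def using cofinite by (intro Max_ge) auto
    fix W assume W: "W \<in> domains S" "W \<notin> unbounded_domains S"
    let ?O = "orbit G (dom_act S) W"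
    have O: "?O \<in> orbits G (domains S) (dom_act S)" using W by (auto simp: orbits_def)
    then have "R ?O \<le> r" unfolding r_def using cofinite by (intro Max_ge) auto
    moreover have "diam_le (cdist S W) (cspace S W) (R ?O)"
      using R[OF O] act.orbit_refl[OF W(1)] W(2) by blast
    ultimately show "diam_le (cdist S W) (cspace S W) r" unfolding diam_le_def by (meson order_trans)
  qed
qed

text \<open>An element that acts trivially on everything orthogonal to \<open>U\<close> does not see, in a domain \<open>W\<close> orthogonal to
\<open>U\<close>, the order in which it is multiplied with an element that preserves \<open>U\<close>: that element takes \<open>W\<close> from another domain orthogonal to \<open>U\<close>.\<close>

lemma trivial_on_orthogonal:
  assumes k: "k \<in> carrier G" and l: "l \<in> carrier G" and z: "z \<in> carrier G"
    and U: "U \<in> domains S" and lU: "dom_act S l U = U"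
    and st: "\<And>W. W \<in> unbounded_domains S \<Longrightarrow> orth S W U \<Longrightarrow> dom_act S k W = W"
    and tr: "\<And>W p. W \<in> unbounded_domains S \<Longrightarrow> orth S W U \<Longrightarrow> p \<in> cspace S W \<Longrightarrow> iso_act S k W p = p"
    and W: "W \<in> unbounded_domains S" "orth S W U"
  shows "cproj S W (k \<otimes> (l \<otimes> z)) = cproj S W (l \<otimes> (k \<otimes> z))"
proof -
  have fixed: "cproj S V (k \<otimes> x) = cproj S V x" if V: "V \<in> unbounded_domains S" "orth S V U" and x: "x \<in> carrier G" for V x
  proof -
    have VD: "V \<in> domains S" using V unbounded_domain by blast
    have "cproj S V (k \<otimes> x) = iso_act S k V ` cproj S V x" using stable_proj[OF k x VD st[OF V]] .
    also have "\<dots> = cproj S V x" using tr[OF V] proj_closed[OF VD x] by (simp add: image_def)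
    finally show ?thesis .
  qed
  have WD: "W \<in> domains S" using W unbounded_domain by blast
  define V where "V = dom_act S (inv l) W"
  have VD: "V \<in> domains S" using dom_act_closed l WD by (simp add: V_def)
  have lV: "dom_act S l V = W" using dom_act_inv[OF l WD] by (simp add: V_def)
  have V: "V \<in> unbounded_domains S" "orth S V U"
    using dom_act_unbounded[OF l VD] dom_act_relations(1)[OF l VD U] lV lU W by auto
  have "cproj S W (l \<otimes> (k \<otimes> z)) = iso_act S l V ` cproj S V (k \<otimes> z)"
    using proj_equivariant[OF l _ VD, of "k \<otimes> z"] lV k z by simp
  also have "\<dots> = iso_act S l V ` cproj S V z" using fixed[OF V z] by simp
  also have "\<dots> = cproj S W (l \<otimes> z)" using proj_equivariant[OF l z VD] lV by simp
  also have "\<dots> = cproj S W (k \<otimes> (l \<otimes> z))" using fixed[OF W] l z by simp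
  finally show ?thesis by simp
qed

text \<open>The condition on \<open>z\<close> says that \<open>z\<close> lies near the product region of \<open>U\<close>, which is preserved by the stabilizer of \<open>U\<close>.\<close>

lemma near_product_region:
  assumes U: "U \<in> domains S" and z: "z \<in> carrier G"
    and near: "\<And>W. W \<in> domains S \<Longrightarrow> pnested S U W \<or> transverse S U W \<Longrightarrow>
      set_dist (cdist S W) (cproj S W z) (rho S U W) \<le> E"
    and l: "l \<in> carrier G" and lU: "dom_act S l U = U"
    and W: "W \<in> domains S" and rel: "pnested S U W \<or> transverse S U W"
  shows "set_dist (cdist S W) (cproj S W (l \<otimes> z)) (rho S U W) \<le> E"
proof -
  define V where "V = dom_act S (inv l) W"
  have VD: "V \<in> domains S" using dom_act_closed l W by (simp add: V_def)
  have lV: "dom_act S l V = W" using dom_act_inv[OF l W] by (simp add: V_def)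
  have relV: "pnested S U V \<or> transverse S U V"
    using rel dom_act_relations(2,3)[OF l U VD] lV lU unfolding pnested_def by auto
  have "transverse S V U \<or> pnested S U V"
    using relV X.orth_sym[OF VD U] by (auto simp: transverse_def)
  then have rho: "iso_act S l V ` rho S U V = rho S U W"
    using rho_equivariant[OF l VD U] lV lU by simp
  have "rho S U V \<subseteq> cspace S V" using relV X.rho_nested[OF U VD] X.rho_transverse[OF U VD] by blast
  moreover have "cproj S V z \<subseteq> cspace S V" using proj_closed[OF VD z] by blast
  ultimately have "set_dist (cdist S W) (iso_act S l V ` cproj S V z) (iso_act S l V ` rho S U V)
      = set_dist (cdist S V) (cproj S V z) (rho S U V)"
    using set_dist_isometry[OF iso_isometry[OF l VD]] lV by simp
  moreover have "iso_act S l V ` cproj S V z = cproj S W (l \<otimes> z)" using proj_equivariant[OF l z VD] lV by simp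
  ultimately show ?thesis using near[OF VD relV] rho by simp
qed

lemma commute_of_equal_conjugates:
  assumes P: "P \<in> carrier G" and R: "R \<in> carrier G" and h: "h \<in> carrier G" and PR: "P \<otimes> R = R \<otimes> P"
    and eq: "inv P \<otimes> h \<otimes> P = inv (P \<otimes> R) \<otimes> h \<otimes> (P \<otimes> R)"
  shows "R \<otimes> h = h \<otimes> R"
proof -
  define Y where "Y = inv P \<otimes> h \<otimes> P"
  have Y: "Y \<in> carrier G" using P h by (simp add: Y_def)
  have "inv (P \<otimes> R) \<otimes> h \<otimes> (P \<otimes> R) = inv R \<otimes> Y \<otimes> R"
    using P R h by (simp add: Y_def inv_mult_group m_assoc)
  then have "Y = inv R \<otimes> Y \<otimes> R" using eq by (simp add: Y_def)
  then have "R \<otimes> Y = R \<otimes> (inv R \<otimes> (Y \<otimes> R))" using Y R by (simp add: m_assoc)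
  also have "\<dots> = Y \<otimes> R" using Y R by (simp flip: m_assoc)
  finally have RY: "R \<otimes> Y = Y \<otimes> R" .
  have hY: "h = P \<otimes> Y \<otimes> inv P"
  proof -
    have "P \<otimes> Y = h \<otimes> P" using P h unfolding Y_def by (simp flip: m_assoc)
    then show ?thesis using P h by (simp add: m_assoc)
  qed
  have RP': "inv P \<otimes> R = R \<otimes> inv P" using commute_inv[OF P R PR] .
  have "R \<otimes> h = (R \<otimes> P) \<otimes> Y \<otimes> inv P" using hY P R Y by (simp add: m_assoc)
  also have "\<dots> = P \<otimes> (R \<otimes> Y) \<otimes> inv P" using P R Y by (simp add: PR[symmetric] m_assoc)
  also have "\<dots> = P \<otimes> Y \<otimes> (R \<otimes> inv P)" using P R Y by (simp add: RY m_assoc)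
  also have "\<dots> = h \<otimes> R" using P R Y hY by (simp add: RP'[symmetric] m_assoc)
  finally show ?thesis .
qed

lemma finite_ball: "finite {x \<in> carrier G. word_length G A x \<le> k}"
proof -
  have fin: "finite (A \<union> m_inv G ` A)" using generators by (simp add: finite_generating_set_def)
  have "{x \<in> carrier G. word_length G A x \<le> k}
      \<subseteq> (\<lambda>ws. foldr (\<otimes>) ws \<one>) ` {ws. set ws \<subseteq> A \<union> m_inv G ` A \<and> length ws \<le> k}"
  proof
    fix x assume "x \<in> {x \<in> carrier G. word_length G A x \<le> k}"
    then show "x \<in> (\<lambda>ws. foldr (\<otimes>) ws \<one>) ` {ws. set ws \<subseteq> A \<union> m_inv G ` A \<and> length ws \<le> k}"
      using word_length_attained[OF generators, of x] by (metis (mono_tags, lifting) image_eqI mem_Collect_eq)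
  qed
  then show ?thesis using finite_lists_length_le[OF fin] finite_surj by blast
qed

text \<open>For a point \<open>z\<close> near the product region of \<open>U\<close>, the points \<open>g\<^sup>a h z\<close> and \<open>h g\<^sup>a z\<close> have the same projection to each unbounded domain
orthogonal to \<open>U\<close> or to \<open>V\<close>. In every other unbounded domain \<open>W\<close> both project close to \<open>rho U W\<close>, as \<open>g\<close> and \<open>h\<close> preserve \<open>U\<close>, and
\<open>W\<close> is not nested in \<open>U\<close> because it would be orthogonal to \<open>V\<close>. By uniqueness the two points are at
bounded distance, so the conjugates of \<open>h\<close> by powers of \<open>g\<close> take finitely many values.\<close>

lemma rigid_commute:
  assumes UV: "orth S U V" and g: "rigidly_fully_supported G S g U" and h: "rigidly_fully_supported G S h V"
  shows "\<exists>N::nat. N > 0 \<and> g [^] N \<otimes> h = h \<otimes> g [^] N"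
proof -
  have gG: "g \<in> carrier G" and hG: "h \<in> carrier G"
    using g h by (auto simp: rigidly_fully_supported_def fully_supported_def axial_def)
  have Uu: "U \<in> unbounded_domains S" and Vu: "V \<in> unbounded_domains S"
    using g h by (auto simp: rigidly_fully_supported_def fully_supported_def)
  have U: "U \<in> domains S" and V: "V \<in> domains S" using Uu Vu unbounded_domain by auto
  have VU: "orth S V U" using UV X.orth_sym U V by blast
  have gU: "dom_act S g U = U" and gW: "\<And>W. W \<in> unbounded_domains S \<Longrightarrow> orth S W U \<Longrightarrow> dom_act S g W = W"
    and gtr: "\<And>W p. W \<in> unbounded_domains S \<Longrightarrow> orth S W U \<Longrightarrow> p \<in> cspace S W \<Longrightarrow> iso_act S g W p = p"
    using g by (auto simp: rigidly_fully_supported_def fully_supported_def)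
  have hW: "\<And>W. W \<in> unbounded_domains S \<Longrightarrow> orth S W V \<Longrightarrow> dom_act S h W = W"
    and htr: "\<And>W p. W \<in> unbounded_domains S \<Longrightarrow> orth S W V \<Longrightarrow> p \<in> cspace S W \<Longrightarrow> iso_act S h W p = p"
    using h by (auto simp: rigidly_fully_supported_def fully_supported_def)
  have "cspace S U \<noteq> {}" using Uu by (auto simp: unbounded_domains_def diam_le_def)
  then obtain c where c: "c \<in> cspace S U" by blast
  have "\<exists>x\<in>carrier G. \<forall>U'\<in>{U}. set_dist (cdist S U') (cproj S U' x) {c} \<le> E \<and>
      (\<forall>W\<in>domains S. pnested S U' W \<or> transverse S U' W \<longrightarrow> set_dist (cdist S W) (cproj S W x) (rho S U' W) \<le> E)"
    using U c by (intro X.partial_realization) auto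
  then obtain z where z: "z \<in> carrier G"
      "\<And>W. W \<in> domains S \<Longrightarrow> pnested S U W \<or> transverse S U W \<Longrightarrow> set_dist (cdist S W) (cproj S W z) (rho S U W) \<le> E"
    by auto
  obtain r where r: "r \<ge> 0" "\<And>W. W \<in> domains S \<Longrightarrow> W \<notin> unbounded_domains S \<Longrightarrow> diam_le (cdist S W) (cspace S W) r"
    using bounded_domains_uniform by blast
  define \<kappa> where "\<kappa> = max r (3 * E + 2)"
  have bound: "dom_dist S W (g [^] a \<otimes> (h \<otimes> z)) (h \<otimes> (g [^] a \<otimes> z)) \<le> \<kappa>" if W: "W \<in> domains S" for W and a :: nat
  proof -
    let ?k = "g [^] a" and ?x = "g [^] a \<otimes> (h \<otimes> z)" and ?y = "h \<otimes> (g [^] a \<otimes> z)"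
    have k: "?k \<in> carrier G" using gG by simp
    have x: "?x \<in> carrier G" "?y \<in> carrier G" using k hG z by auto
    obtain p where p: "p \<in> cproj S W ?x" using proj_nonempty[OF W x(1)] by blast
    have kst: "\<And>W. W \<in> unbounded_domains S \<Longrightarrow> orth S W U \<Longrightarrow> dom_act S ?k W = W"
      using pow_stable[OF gG _ gW] unbounded_domain by blast
    have ktr: "\<And>W p. W \<in> unbounded_domains S \<Longrightarrow> orth S W U \<Longrightarrow> p \<in> cspace S W \<Longrightarrow> iso_act S ?k W p = p"
      using pow_trivial[OF gG _ gW gtr] unbounded_domain by blast
    have kU: "dom_act S ?k U = U" using pow_stable[OF gG U gU] .
    have hU: "dom_act S h U = U" using hW[OF Uu UV] .
    have kV: "dom_act S ?k V = V" using kst[OF Vu VU] .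
    consider "W \<notin> unbounded_domains S" | "W \<in> unbounded_domains S" "orth S W U \<or> orth S W V"
      | "W \<in> unbounded_domains S" "\<not> orth S W U" "\<not> orth S W V" by blast
    then show ?thesis
    proof cases
      case 1
      obtain q where q: "q \<in> cproj S W ?y" using proj_nonempty[OF W x(2)] by blast
      have "dom_dist S W ?x ?y \<le> cdist S W p q" using p q cdist_nonneg[OF W] by (intro set_dist_le) auto
      also have "\<dots> \<le> r"
        using r(2)[OF W 1] p q proj_closed[OF W x(1)] proj_closed[OF W x(2)] by (auto simp: diam_le_def)
      finally show ?thesis by (simp add: \<kappa>_def)
    next
      case 2
      have "cproj S W ?x = cproj S W ?y"
      proof (cases "orth S W U")
        case True
        show ?thesis by (rule trivial_on_orthogonal[OF k hG z(1) U hU kst ktr 2(1) True])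
      next
        case False
        then have oV: "orth S W V" using 2 by blast
        show ?thesis by (rule trivial_on_orthogonal[OF hG k z(1) V kV hW htr 2(1) oV, symmetric])
      qed
      then have "dom_dist S W ?x ?y \<le> cdist S W p p" using p cdist_nonneg[OF W] by (intro set_dist_le) auto
      also have "\<dots> = 0" using cdist_self[OF W] proj_closed[OF W x(1) p] by simp
      finally show ?thesis using r by (simp add: \<kappa>_def)
    next
      case 3
      have "\<not> nested S W U" using X.orth_nested[OF W U V] 3 UV by blast
      moreover have "W \<noteq> U" using 3 UV by blast
      moreover have "\<not> orth S U W" using 3 X.orth_sym[OF U W] by blast
      ultimately have rel: "pnested S U W \<or> transverse S U W" by (auto simp: pnested_def transverse_def)
      have rho: "rho S U W \<noteq> {}" "rho S U W \<subseteq> cspace S W" "diam_le (cdist S W) (rho S U W) E"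
        using rel X.rho_nested[OF U W] X.rho_transverse[OF U W] by blast+
      have close: "\<exists>b\<in>cproj S W (l \<otimes> z). \<exists>c\<in>rho S U W. cdist S W b c < E + 1"
        if l: "l \<in> carrier G" "dom_act S l U = U" for l
      proof -
        have "set_dist (cdist S W) (cproj S W (l \<otimes> z)) (rho S U W) < E + 1"
          using near_product_region[OF U z l W rel] by simp
        then show ?thesis
          using set_dist_attained[OF proj_nonempty[OF W] rho(1), of "l \<otimes> z"] l z by (metis m_closed)
      qed
      have "dom_act S (?k \<otimes> h) U = U" "dom_act S (h \<otimes> ?k) U = U"
        using dom_act_mult k hG U kU hU by auto
      then obtain b1 c1 b2 c2 where b: "b1 \<in> cproj S W ?x" "c1 \<in> rho S U W" "cdist S W b1 c1 < E + 1"
          "b2 \<in> cproj S W ?y" "c2 \<in> rho S U W" "cdist S W b2 c2 < E + 1"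
        using close[of "?k \<otimes> h"] close[of "h \<otimes> ?k"] k hG z(1) by (auto simp: m_assoc)
      have cs: "b1 \<in> cspace S W" "b2 \<in> cspace S W" "c1 \<in> cspace S W" "c2 \<in> cspace S W"
        using b rho proj_closed[OF W x(1)] proj_closed[OF W x(2)] by auto
      have "dom_dist S W ?x ?y \<le> cdist S W b1 b2" using b cdist_nonneg[OF W] by (intro set_dist_le) auto
      also have "\<dots> \<le> cdist S W b1 c1 + cdist S W c1 b2" using cs by (intro cdist_triangle[OF W])
      also have "cdist S W c1 b2 \<le> cdist S W c1 c2 + cdist S W c2 b2" using cs by (intro cdist_triangle[OF W])
      also have "cdist S W c1 c2 \<le> E" using rho b by (auto simp: diam_le_def)
      finally have "dom_dist S W ?x ?y \<le> 3 * E + 2"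
        using b(3,6) cdist_commute[OF W, of b2 c2] by linarith
      then show ?thesis by (simp add: \<kappa>_def)
    qed
  qed
  have "\<kappa> + 1 \<ge> 0" using r by (simp add: \<kappa>_def)
  then obtain \<theta> where \<theta>: "\<And>x y. x \<in> carrier G \<Longrightarrow> y \<in> carrier G \<Longrightarrow> word_dist G A x y \<ge> \<theta> \<Longrightarrow>
      \<exists>W\<in>domains S. dom_dist S W x y \<ge> \<kappa> + 1"
    using X.uniqueness[of "\<kappa> + 1"] by blast
  define F where "F a = inv (g [^] a \<otimes> (h \<otimes> z)) \<otimes> (h \<otimes> (g [^] a \<otimes> z))" for a :: nat
  have FG: "F a \<in> carrier G" for a using gG hG z by (simp add: F_def)
  have "word_length G A (F a) \<le> nat \<lceil>\<theta>\<rceil>" for a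
  proof -
    let ?x = "g [^] a \<otimes> (h \<otimes> z)" and ?y = "h \<otimes> (g [^] a \<otimes> z)"
    have x: "?x \<in> carrier G" "?y \<in> carrier G" using gG hG z by auto
    have "\<not> word_dist G A ?x ?y \<ge> \<theta>"
    proof
      assume "word_dist G A ?x ?y \<ge> \<theta>"
      then obtain W where "W \<in> domains S" "dom_dist S W ?x ?y \<ge> \<kappa> + 1" using \<theta>[OF x] by blast
      then show False using bound[of W a] by simp
    qed
    then have "real (word_length G A (F a)) < \<theta>" using x by (simp add: word_dist_def F_def)
    then show ?thesis by linarith
  qed
  then have "range F \<subseteq> {x \<in> carrier G. word_length G A x \<le> nat \<lceil>\<theta>\<rceil>}" using FG by blast
  then have "finite (range F)" using finite_ball finite_subset by blast
  then have "\<not> inj F" using finite_imageD[of F UNIV] by auto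
  then obtain a b where ab: "a < b" "F a = F b" unfolding inj_def by (metis linorder_neqE_nat)
  define N where "N = b - a"
  let ?P = "g [^] a" and ?R = "g [^] N"
  have N: "N > 0" "b = a + N" using ab by (auto simp: N_def)
  have PRb: "?P \<otimes> ?R = g [^] b" "?R \<otimes> ?P = g [^] b"
    using gG N by (simp_all add: nat_pow_mult add.commute)
  have PR: "?P \<in> carrier G" "?R \<in> carrier G" using gG by auto
  have Fa: "F k = inv (h \<otimes> z) \<otimes> (inv (g [^] k) \<otimes> h \<otimes> g [^] k) \<otimes> z" for k
    using gG hG z(1) unfolding F_def by (simp add: inv_mult_group[of "g [^] k"] m_assoc)
  have "inv ?P \<otimes> h \<otimes> ?P = inv (g [^] b) \<otimes> h \<otimes> g [^] b"
    using ab(2) unfolding Fa using gG hG z(1) by simp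
  then have "?R \<otimes> h = h \<otimes> ?R"
    using commute_of_equal_conjugates[OF PR hG] PRb by simp
  then show ?thesis using N by blast
qed

subsection \<open>Surface subgroups from induced cycles of orthogonal domains\<close>

lemma orthogonality_adj_iff:
  "U \<in> unbounded_domains S \<Longrightarrow> V \<in> unbounded_domains S \<Longrightarrow> orthogonality_adj S U V \<longleftrightarrow> orth S U V"
  using X.orth_irrefl unbounded_domain by (auto simp: orthogonality_adj_def)

text \<open>A domain nested in \<open>U\<^sub>l\<close> is orthogonal to both neighbours of \<open>U\<^sub>l\<close>. In a cycle of length other than 4 no
vertex except \<open>l\<close> is adjacent to both.\<close>

lemma opposed_transverse:
  assumes xs: "induced_cycle (unbounded_domains S) (orthogonality_adj S) xs" "length xs \<ge> 5"
    and ij: "i < length xs" "j < length xs" "i \<noteq> j" "\<not> cyc_adj (length xs) i j"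
  shows "transverse S (xs ! i) (xs ! j)"
proof -
  let ?n = "length xs"
  have unb: "xs ! k \<in> unbounded_domains S" if "k < ?n" for k
    using xs(1) nth_mem[OF that] unfolding induced_cycle_def by blast
  have orth_iff: "orth S (xs ! k) (xs ! l) \<longleftrightarrow> cyc_adj ?n k l" if "k < ?n" "l < ?n" for k l
  proof -
    have "orthogonality_adj S (xs ! k) (xs ! l) \<longleftrightarrow> l = Suc k mod ?n \<or> k = Suc l mod ?n"
      using xs(1) that unfolding induced_cycle_def by blast
    then show ?thesis using orthogonality_adj_iff[OF unb unb, OF that] that by (simp add: cyc_adj_def)
  qed
  have not_nested: "\<not> nested S (xs ! k) (xs ! l)"
    if kl: "k < ?n" "l < ?n" "k \<noteq> l" "\<not> cyc_adj ?n k l" for k l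
  proof
    assume nst: "nested S (xs ! k) (xs ! l)"
    have inherit: "cyc_adj ?n k m" if "cyc_adj ?n l m" for m
    proof -
      have m: "m < ?n" using that by (simp add: cyc_adj_def)
      show ?thesis
        using X.orth_nested[of "xs ! k" "xs ! l" "xs ! m"] nst orth_iff[OF kl(2) m] orth_iff[OF kl(1) m] that
          unb[OF kl(1)] unb[OF kl(2)] unb[OF m] unbounded_domain by blast
    qed
    define s where "s = (if Suc l = ?n then 0 else Suc l)"
    define p where "p = (if l = 0 then ?n - 1 else l - 1)"
    have "cyc_adj ?n l s" "cyc_adj ?n l p"
      using kl xs(2) by (auto simp: cyc_adj_cases s_def p_def)
    then have "cyc_adj ?n k s" "cyc_adj ?n k p" using inherit by auto
    then show False using kl xs(2)
      by (auto simp: cyc_adj_cases s_def p_def split: if_splits)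
  qed
  have "\<not> orth S (xs ! i) (xs ! j)" using orth_iff ij by blast
  moreover have "\<not> cyc_adj ?n j i" using ij by (auto simp: cyc_adj_def)
  ultimately show ?thesis using not_nested[of i j] not_nested[of j i] ij by (auto simp: transverse_def)
qed

end

lemma uniform_bound:
  fixes P :: "'a \<Rightarrow> real \<Rightarrow> bool"
  assumes "finite J" "\<And>i. i \<in> J \<Longrightarrow> \<exists>r. \<forall>r'\<ge>r. P i r'"
  shows "\<exists>R\<ge>0. \<forall>i\<in>J. P i R"
proof -
  obtain f where f: "\<And>i r. i \<in> J \<Longrightarrow> r \<ge> f i \<Longrightarrow> P i r" using assms(2) by metis
  let ?R = "\<Sum>i\<in>J. \<bar>f i\<bar>"
  have "f i \<le> ?R" if "i \<in> J" for i
    using member_le_sum[of i J "\<lambda>i. \<bar>f i\<bar>"] that assms(1) by fastforce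
  then show ?thesis using f by (intro exI[of _ ?R]) (auto intro: sum_nonneg)
qed

lemma (in group) commute_pow:
  assumes "x \<in> carrier G" "y \<in> carrier G" "x \<otimes> y = y \<otimes> x"
  shows "x [^] (a::nat) \<otimes> y [^] (b::nat) = y [^] b \<otimes> x [^] a"
proof -
  have one: "u [^] (a::nat) \<otimes> v = v \<otimes> u [^] a"
    if "u \<in> carrier G" "v \<in> carrier G" "u \<otimes> v = v \<otimes> u" for u v a
  proof (induction a)
    case (Suc a)
    have "u [^] Suc a \<otimes> v = u [^] a \<otimes> (v \<otimes> u)" using that by (simp add: m_assoc)
    also have "\<dots> = v \<otimes> u [^] Suc a" using Suc that by (simp flip: m_assoc)
    finally show ?case .
  qed (use that in simp)
  have "y [^] b \<otimes> x = x \<otimes> y [^] b" using one[of y x b] assms by simp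
  then show ?thesis using one[of x "y [^] b" a] assms by simp
qed

lemma (in group) common_commuting_power:
  assumes g: "\<And>i. i < n \<Longrightarrow> g i \<in> carrier G"
    and "\<And>i j. cyc_adj n i j \<Longrightarrow> \<exists>N::nat. N > 0 \<and> g i [^] N \<otimes> g j [^] N = g j [^] N \<otimes> g i [^] N"
  shows "\<exists>M::nat. M > 0 \<and> (\<forall>i j. cyc_adj n i j \<longrightarrow> g i [^] M \<otimes> g j [^] M = g j [^] M \<otimes> g i [^] M)"
proof -
  have "\<forall>i j. \<exists>N::nat. N > 0 \<and> (cyc_adj n i j \<longrightarrow> g i [^] N \<otimes> g j [^] N = g j [^] N \<otimes> g i [^] N)"
    using assms(2) by (metis zero_less_one)
  then obtain N :: "nat \<Rightarrow> nat \<Rightarrow> nat" where N: "\<And>i j. N i j > 0"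
      "\<And>i j. cyc_adj n i j \<Longrightarrow> g i [^] N i j \<otimes> g j [^] N i j = g j [^] N i j \<otimes> g i [^] N i j"
    by metis
  define M where "M = (\<Prod>p\<in>{..<n} \<times> {..<n}. N (fst p) (snd p))"
  have "g i [^] M \<otimes> g j [^] M = g j [^] M \<otimes> g i [^] M" if ij: "cyc_adj n i j" for i j
  proof -
    have I: "i < n" "j < n" using ij by (auto simp: cyc_adj_def)
    have "N (fst (i, j)) (snd (i, j)) dvd M" unfolding M_def using I by (intro dvd_prodI) auto
    then obtain c where c: "M = N i j * c" by (auto elim: dvdE)
    show ?thesis
      using commute_pow[OF _ _ N(2)[OF ij], of c c] g I by (simp add: c nat_pow_pow)
  qed
  moreover have "M > 0" unfolding M_def using N(1) by (intro prod_pos) auto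
  ultimately show ?thesis by blast
qed

context hhg begin

text \<open>The constants are chosen in this order: the base points \<open>p i\<close> on the loxodromic orbits; the bound \<open>Q\<close> for the orbits of the neighbours, which holds
for all powers at once and is 0 in the rigid case; \<open>D\<close> from consistency; and
at the end the exponent \<open>N\<close>, a multiple of \<open>M\<close> so that neighbours commute, and large enough to beat the other constants.\<close>

theorem surface_subgroup_of_cycle:
  assumes xs: "induced_cycle (unbounded_domains S) (orthogonality_adj S) xs" "length xs \<ge> 5"
    and fs: "\<And>i. i < length xs \<Longrightarrow> fully_supported G S (g i) (xs ! i)"
    and M: "M > (0::nat)"
    and comm: "\<And>i j. cyc_adj (length xs) i j \<Longrightarrow> g i [^] M \<otimes> g j [^] M = g j [^] M \<otimes> g i [^] M"
  shows "\<exists>H. surface_subgroup H G \<and>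
    ((\<forall>i<length xs. rigidly_fully_supported G S (g i) (xs ! i)) \<longrightarrow> undistorted G H)"
proof -
  define n where "n = length xs"
  define U where "U i = xs ! i" for i
  let ?rigid = "\<forall>i<n. rigidly_fully_supported G S (g i) (U i)"
  interpret right_angled_polygon n using xs(2) by unfold_locales (simp add: n_def)
  have gG: "g i \<in> carrier G" if "i < n" for i
    using fs[of i] that by (simp add: n_def fully_supported_def axial_def)
  have Uu: "U i \<in> unbounded_domains S" if "i < n" for i
    using fs[of i] that by (simp add: n_def U_def fully_supported_def)
  have UD: "U i \<in> domains S" if "i < n" for i using Uu[OF that] unbounded_domain by blast
  have self: "dom_act S (g i) (U i) = U i" if "i < n" for i
    using fs[of i] that by (simp add: n_def U_def fully_supported_def)
  have orth: "orth S (U i) (U j)" if ij: "cyc_adj n i j" for i j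
  proof -
    have "orthogonality_adj S (xs ! i) (xs ! j)"
      using xs(1) ij unfolding induced_cycle_def cyc_adj_def n_def by blast
    then show ?thesis by (simp add: orthogonality_adj_def U_def)
  qed
  have neighbour: "dom_act S (g j) (U i) = U i" if ij: "cyc_adj n i j" for i j
  proof -
    have "i < n" "j < n" using ij by (auto simp: cyc_adj_def)
    then show ?thesis using fs[of j] Uu[of i] orth[OF ij] by (simp add: n_def U_def fully_supported_def)
  qed
  have "\<exists>p\<in>cspace S (U i). \<exists>K C. K \<ge> 1 \<and>
      (\<forall>k::nat. real k / K - C \<le> cdist S (U i) p (iso_act S (g i [^] k) (U i) p))" if i: "i < n" for i
  proof -
    obtain p K C where p: "p \<in> cspace S (U i)" "K \<ge> 1" and
        qi: "qi_embedding_with K C UNIV int_dist (cspace S (U i)) (cdist S (U i)) (\<lambda>k. iso_act S (g i [^] k) (U i) p)"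
      using fs[of i] i unfolding n_def U_def fully_supported_def loxodromic_on_def qi_embedding_def by blast
    have "real k / K - C \<le> cdist S (U i) p (iso_act S (g i [^] k) (U i) p)" for k :: nat
    proof -
      have "int_dist 0 (int k) / K - C
          \<le> cdist S (U i) (iso_act S (g i [^] (0::int)) (U i) p) (iso_act S (g i [^] (int k)) (U i) p)"
        using qi unfolding qi_embedding_with_def by blast
      then show ?thesis using iso_act_one[OF UD[OF i] p(1)] by (simp add: int_pow_int)
    qed
    then show ?thesis using p by blast
  qed
  then obtain p K C where p: "\<And>i. i < n \<Longrightarrow> p i \<in> cspace S (U i)" and K: "\<And>i. i < n \<Longrightarrow> K i \<ge> (1::real)"
      and lox: "\<And>i k. i < n \<Longrightarrow> real k / K i - C i \<le> cdist S (U i) (p i) (iso_act S (g i [^] k) (U i) (p i))"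
    by metis
  have "\<exists>Q\<ge>0. (\<forall>i j k. cyc_adj n i j \<longrightarrow> cdist S (U i) (p i) (iso_act S (g j [^] (k::nat)) (U i) (p i)) \<le> Q) \<and> (?rigid \<longrightarrow> Q = 0)"
  proof (cases ?rigid)
    case True
    have "cdist S (U i) (p i) (iso_act S (g j [^] k) (U i) (p i)) = 0" if ij: "cyc_adj n i j" for i j and k :: nat
    proof -
      have I: "i < n" "j < n" using ij by (auto simp: cyc_adj_def)
      have "rigidly_fully_supported G S (g j) (U j)" using True I by blast
      then have tr: "iso_act S (g j) (U i) q = q" if "q \<in> cspace S (U i)" for q
        using that Uu[OF I(1)] orth[OF ij] unfolding rigidly_fully_supported_def by blast
      have "iso_act S (g j [^] k) (U i) (p i) = p i"
        by (rule pow_trivial[OF gG[OF I(2)] UD[OF I(1)] neighbour[OF ij] tr p[OF I(1)]])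
      then show ?thesis using cdist_self[OF UD[OF I(1)] p[OF I(1)]] by simp
    qed
    then show ?thesis by (intro exI[of _ 0]) auto
  next
    case False
    have "\<exists>Q\<ge>0. \<forall>ij\<in>{..<n} \<times> {..<n}. \<forall>k::nat. cyc_adj n (fst ij) (snd ij) \<longrightarrow>
        cdist S (U (fst ij)) (p (fst ij)) (iso_act S (g (snd ij) [^] k) (U (fst ij)) (p (fst ij))) \<le> Q"
    proof (rule uniform_bound)
      fix ij
      assume "ij \<in> {..<n} \<times> {..<n}"
      then obtain i j where ij: "ij = (i, j)" "i < n" "j < n" by auto
      show "\<exists>r. \<forall>r'\<ge>r. \<forall>k::nat. cyc_adj n (fst ij) (snd ij) \<longrightarrow>
          cdist S (U (fst ij)) (p (fst ij)) (iso_act S (g (snd ij) [^] k) (U (fst ij)) (p (fst ij))) \<le> r'"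
      proof (cases "cyc_adj n i j")
        case True
        obtain Q where Q: "\<forall>q\<in>cspace S (U i). diam_le (cdist S (U i)) (range (\<lambda>k::int. iso_act S (g j [^] k) (U i) q)) Q"
          using fs[of j] ij Uu[of i] orth[OF True] unfolding n_def U_def fully_supported_def by blast
        have "cdist S (U i) (p i) (iso_act S (g j [^] k) (U i) (p i)) \<le> Q" for k :: nat
        proof -
          have "cdist S (U i) (iso_act S (g j [^] (0::int)) (U i) (p i)) (iso_act S (g j [^] (int k)) (U i) (p i)) \<le> Q"
            using Q p[OF ij(2)] unfolding diam_le_def by blast
          then show ?thesis using iso_act_one[OF UD p] ij by (simp add: int_pow_int)
        qed
        then show ?thesis using ij by (intro exI[of _ Q]) (auto intro: order_trans)
      qed (use ij in auto)
    qed simp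
    then obtain Q where Q: "Q \<ge> 0" "\<forall>ij\<in>{..<n} \<times> {..<n}. \<forall>k::nat. cyc_adj n (fst ij) (snd ij) \<longrightarrow>
        cdist S (U (fst ij)) (p (fst ij)) (iso_act S (g (snd ij) [^] k) (U (fst ij)) (p (fst ij))) \<le> Q" by blast
    have "cdist S (U i) (p i) (iso_act S (g j [^] k) (U i) (p i)) \<le> Q" if ij: "cyc_adj n i j" for i j and k :: nat
    proof -
      have "(i, j) \<in> {..<n} \<times> {..<n}" using ij by (simp add: cyc_adj_def)
      from bspec[OF Q(2) this] ij show ?thesis by simp
    qed
    then show ?thesis using False Q(1) by blast
  qed
  then obtain Q where Q: "Q \<ge> 0" "\<And>i j k. cyc_adj n i j \<Longrightarrow> cdist S (U i) (p i) (iso_act S (g j [^] (k::nat)) (U i) (p i)) \<le> Q"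
      "?rigid \<Longrightarrow> Q = 0" by blast
  have "\<exists>D1\<ge>0. \<forall>ij\<in>{..<n} \<times> {..<n}. opposed (fst ij) (snd ij) \<longrightarrow> (\<forall>x\<in>carrier G.
      gap (U (fst ij)) (p (fst ij)) x > D1 \<longrightarrow> gap (U (snd ij)) (p (snd ij)) x \<le> D1)"
  proof (rule uniform_bound)
    fix ij assume "ij \<in> {..<n} \<times> {..<n}"
    then obtain i j where ij: "ij = (i, j)" "i < n" "j < n" by auto
    show "\<exists>r. \<forall>r'\<ge>r. opposed (fst ij) (snd ij) \<longrightarrow> (\<forall>x\<in>carrier G.
      gap (U (fst ij)) (p (fst ij)) x > r' \<longrightarrow> gap (U (snd ij)) (p (snd ij)) x \<le> r')"
    proof (cases "opposed i j")
      case True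
      then have "i \<noteq> j" "\<not> cyc_adj n i j" by (simp_all add: opposed_def)
      then have "transverse S (U i) (U j)"
        using opposed_transverse[OF xs] ij by (simp add: n_def U_def)
      then obtain r where "\<And>x. x \<in> carrier G \<Longrightarrow> gap (U i) (p i) x > r \<Longrightarrow> gap (U j) (p j) x \<le> r"
        using transverse_domains[OF UD[OF ij(2)] UD[OF ij(3)] _ p[OF ij(2)] p[OF ij(3)]] by blast
      then show ?thesis using ij by (intro exI[of _ r]) force
    qed (use ij in auto)
  qed simp
  then obtain D1 where D1: "\<And>i j x. i < n \<Longrightarrow> j < n \<Longrightarrow> opposed i j \<Longrightarrow> x \<in> carrier G \<Longrightarrow>
      gap (U i) (p i) x > D1 \<Longrightarrow> gap (U j) (p j) x \<le> D1" by fastforce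
  have "\<exists>D2\<ge>0. \<forall>i\<in>{..<n}. gap (U i) (p i) \<one> \<le> D2" by (rule uniform_bound) auto
  then obtain D2 where D2: "\<And>i. i < n \<Longrightarrow> gap (U i) (p i) \<one> \<le> D2" by blast
  define D where "D = max D1 D2"
  define L where "L = 3 * E + 1"
  have L: "L \<ge> 0" using X.E_pos by (simp add: L_def)
  define T where "T = 2 * D + Q + L + 1"
  have "\<exists>m\<ge>0. \<forall>i\<in>{..<n}. K i * (C i + T + E) \<le> m" by (rule uniform_bound) auto
  then obtain m where m: "\<And>i. i < n \<Longrightarrow> K i * (C i + T + E) \<le> m" by blast
  obtain k :: nat where k: "m \<le> k" using real_arch_simple by blast
  define N where "N = M * k"
  have "k \<le> N" using M by (simp add: N_def)
  have far: "cdist S (U i) (p i) (iso_act S (g i [^] N) (U i) (p i)) \<ge> T + E" if i: "i < n" for i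
  proof -
    have "K i * (C i + T + E) \<le> real N" using m[OF i] k \<open>k \<le> N\<close> by simp
    then have "C i + T + E \<le> real N / K i" using K[OF i] by (simp add: pos_le_divide_eq mult.commute)
    then show ?thesis using lox[OF i, of N] by linarith
  qed
  interpret group_ping_pong G n "\<lambda>i. g i [^] N" "\<lambda>i. gap (U i) (p i)" D Q T
  proof
    fix i j x assume ij: "cyc_adj n i j"
    then have I: "i < n" "j < n" by (auto simp: cyc_adj_def)
    show "g i [^] N \<otimes> g j [^] N = g j [^] N \<otimes> g i [^] N"
      using commute_pow[OF _ _ comm, of i j k k] ij gG I by (simp add: N_def n_def nat_pow_pow)
    assume x: "x \<in> carrier G"
    have "dom_act S (g j [^] N) (U i) = U i" using pow_stable[OF gG[OF I(2)] UD[OF I(1)] neighbour[OF ij]] .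
    then have "\<bar>gap (U i) (p i) (g j [^] N \<otimes> x) - gap (U i) (p i) x\<bar>
        \<le> cdist S (U i) (p i) (iso_act S (g j [^] N) (U i) (p i))"
      using gap_small_move[OF _ x UD[OF I(1)] _ p[OF I(1)], of "g j [^] N"] gG[OF I(2)] by simp
    then show "\<bar>gap (U i) (p i) (g j [^] N \<otimes> x) - gap (U i) (p i) x\<bar> \<le> Q" using Q(2)[OF ij, of N] by linarith
  next
    fix i x assume i: "i < n" and x: "x \<in> carrier G"
    have "dom_act S (g i [^] N) (U i) = U i" using pow_stable[OF gG[OF i] UD[OF i] self[OF i]] .
    then show "T - gap (U i) (p i) x \<le> gap (U i) (p i) (g i [^] N \<otimes> x)"
      using gap_large_move[OF _ x UD[OF i] _ p[OF i], of "g i [^] N"] gG[OF i] far[OF i] by simp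
  next
    fix i j x assume "i < n" "j < n" "opposed i j" "x \<in> carrier G" "D < gap (U i) (p i) x"
    then show "gap (U j) (p j) x \<le> D" using D1[of i j x] by (simp add: D_def)
  next
    fix i assume "i < n"
    then show "gap (U i) (p i) \<one> \<le> D" using D2 by (simp add: D_def le_max_iff_disj)
  qed (use gG Q(1) L in \<open>auto simp: T_def\<close>)
  have "undistorted G image_group" if rigid: ?rigid
  proof -
    have Q0: "Q = 0" using Q(3) rigid by blast
    have "rigid_group_ping_pong G n (\<lambda>i. g i [^] N) (\<lambda>i. gap (U i) (p i)) D T A L"
    proof (intro rigid_group_ping_pong.intro rigid_group_ping_pong_axioms.intro)
      show "group_ping_pong G n (\<lambda>i. g i [^] N) (\<lambda>i. gap (U i) (p i)) D 0 T"
        using group_ping_pong_axioms Q0 by simp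
      fix i x s assume "i < n" "x \<in> carrier G" "s \<in> A \<union> m_inv G ` A"
      then show "gap (U i) (p i) (x \<otimes> s) \<le> gap (U i) (p i) x + L"
        unfolding L_def by (intro gap_lipschitz UD p)
    qed (use generators L Q0 in \<open>auto simp: T_def\<close>)
    then show ?thesis by (rule rigid_group_ping_pong.undistorted_image)
  qed
  then show ?thesis using surface_subgroup_image unfolding n_def U_def by blast
qed

end

theorem corollary6:
  fixes G :: "('g, 'b) monoid_scheme"
    and S :: "('g, 'u, 'p, 'z) hhg_structure_scheme"
  assumes "hierarchically_hyperbolic_group G S"
    and "\<exists>xs. induced_cycle (unbounded_domains S) (orthogonality_adj S) xs \<and> length xs \<ge> 5"
  shows "(weak_commutativity G S \<and>
          (\<forall>U\<in>unbounded_domains S. \<exists>g\<in>carrier G. fully_supported G S g U)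
            \<longrightarrow> (\<exists>H. surface_subgroup H G)) \<and>
         ((\<forall>U\<in>unbounded_domains S. \<exists>g\<in>carrier G. rigidly_fully_supported G S g U)
            \<longrightarrow> (\<exists>H. surface_subgroup H G \<and> undistorted G H))"
proof -
  obtain A E where "hhg G S A E" using hierarchically_hyperbolic_groupD[OF assms(1)] by blast
  then interpret hhg G S A E .
  obtain xs where xs: "induced_cycle (unbounded_domains S) (orthogonality_adj S) xs" "length xs \<ge> 5"
    using assms(2) by blast
  have unb: "xs ! i \<in> unbounded_domains S" if "i < length xs" for i
    using xs(1) nth_mem[OF that] unfolding induced_cycle_def by blast
  have orth: "orth S (xs ! i) (xs ! j)" if "cyc_adj (length xs) i j" for i j
  proof -
    have "orthogonality_adj S (xs ! i) (xs ! j)"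
      using xs(1) that unfolding induced_cycle_def cyc_adj_def by blast
    then show ?thesis by (simp add: orthogonality_adj_def)
  qed
  show ?thesis
  proof (intro conjI impI)
    assume *: "weak_commutativity G S \<and> (\<forall>U\<in>unbounded_domains S. \<exists>g\<in>carrier G. fully_supported G S g U)"
    then have "\<forall>i. \<exists>h. i < length xs \<longrightarrow> h \<in> carrier G \<and> fully_supported G S h (xs ! i)"
      using unb by blast
    then obtain g where g: "\<And>i. i < length xs \<Longrightarrow> g i \<in> carrier G \<and> fully_supported G S (g i) (xs ! i)"
      by metis
    have "\<exists>N::nat. N > 0 \<and> g i [^]\<^bsub>G\<^esub> N \<otimes>\<^bsub>G\<^esub> g j [^]\<^bsub>G\<^esub> N = g j [^]\<^bsub>G\<^esub> N \<otimes>\<^bsub>G\<^esub> g i [^]\<^bsub>G\<^esub> N"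
      if ij: "cyc_adj (length xs) i j" for i j
    proof -
      have "i < length xs" "j < length xs" using ij by (auto simp: cyc_adj_def)
      then show ?thesis using * orth[OF ij] g unfolding weak_commutativity_def by blast
    qed
    then obtain M :: nat where M: "M > 0" "\<And>i j. cyc_adj (length xs) i j \<Longrightarrow>
        g i [^]\<^bsub>G\<^esub> M \<otimes>\<^bsub>G\<^esub> g j [^]\<^bsub>G\<^esub> M = g j [^]\<^bsub>G\<^esub> M \<otimes>\<^bsub>G\<^esub> g i [^]\<^bsub>G\<^esub> M"
      using common_commuting_power[of "length xs" g] g by metis
    then show "\<exists>H. surface_subgroup H G"
      using surface_subgroup_of_cycle[where g = g, OF xs _ M] g by blast
  next
    assume "\<forall>U\<in>unbounded_domains S. \<exists>g\<in>carrier G. rigidly_fully_supported G S g U"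
    then have "\<forall>i. \<exists>h. i < length xs \<longrightarrow> h \<in> carrier G \<and> rigidly_fully_supported G S h (xs ! i)"
      using unb by blast
    then obtain g where g: "\<And>i. i < length xs \<Longrightarrow> g i \<in> carrier G \<and> rigidly_fully_supported G S (g i) (xs ! i)"
      by metis
    then have fs: "fully_supported G S (g i) (xs ! i)" if "i < length xs" for i
      using that by (simp add: rigidly_fully_supported_def)
    have "\<exists>N::nat. N > 0 \<and> g i [^]\<^bsub>G\<^esub> N \<otimes>\<^bsub>G\<^esub> g j [^]\<^bsub>G\<^esub> N = g j [^]\<^bsub>G\<^esub> N \<otimes>\<^bsub>G\<^esub> g i [^]\<^bsub>G\<^esub> N"
      if ij: "cyc_adj (length xs) i j" for i j
    proof -
      have I: "i < length xs" "j < length xs" using ij by (auto simp: cyc_adj_def)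
      obtain N :: nat where N: "N > 0" "g i [^]\<^bsub>G\<^esub> N \<otimes>\<^bsub>G\<^esub> g j = g j \<otimes>\<^bsub>G\<^esub> g i [^]\<^bsub>G\<^esub> N"
        using rigid_commute[OF orth[OF ij], of "g i" "g j"] g I by blast
      then have "g i [^]\<^bsub>G\<^esub> N \<otimes>\<^bsub>G\<^esub> g j [^]\<^bsub>G\<^esub> N = g j [^]\<^bsub>G\<^esub> N \<otimes>\<^bsub>G\<^esub> g i [^]\<^bsub>G\<^esub> N"
        using commute_pow[of "g i [^]\<^bsub>G\<^esub> N" "g j" 1 N] g I by simp
      then show ?thesis using N by blast
    qed
    then obtain M :: nat where M: "M > 0" "\<And>i j. cyc_adj (length xs) i j \<Longrightarrow>
        g i [^]\<^bsub>G\<^esub> M \<otimes>\<^bsub>G\<^esub> g j [^]\<^bsub>G\<^esub> M = g j [^]\<^bsub>G\<^esub> M \<otimes>\<^bsub>G\<^esub> g i [^]\<^bsub>G\<^esub> M"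
      using common_commuting_power[of "length xs" g] g by metis
    then show "\<exists>H. surface_subgroup H G \<and> undistorted G H"
      using surface_subgroup_of_cycle[where g = g, OF xs fs M] g by blast
  qed
qed

end
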